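(* Let $G$ be any graph. (i) $\mathfrak FG$ is an $\Omega$-compactification of $G$, and $\mathfrak FG\setminus G$ is totally disconnected. (ii) If $G$ is locally finite and connected, then $\mathfrak F=\Omega$ and $\mathfrak FG$ coincides with the Freudenthal compactification of $G$.
   Context: $G$ is regarded as a 1-complex: edges are copies of $[0,1]$; inner edge points have their usual neighbourhoods, a basic open neighbourhood of a vertex $u$ is a union of half-open intervals $[u,j_e)$, one for each edge $e$ at $u$; $\mathring E$ is the set of inner edge points. $\mathcal X$ is the set of finite subsets of $V(G)$; $\mathcal C_X$ the set of components of $G-X$; $\phi_{X',X}$ ($X\subseteq X'$) sends a component of $G-X'$ to the component of $G-X$ containing it. For an end $\omega$, $C(X,\omega)$ is the component of $G-X$ containing tails of the rays of $\omega$, $\Omega(X,\omega)$ the set of ends $\omega'$ with $C(X,\omega')=C(X,\omega)$. $\mathcal VG$ is $G\cup\Omega$ with the topology generated by the open sets of the 1-complex and the sets $C(X,\omega)\cup\Omega(X,\omega)\cup\mathring E(X,C(X,\omega))$. An $\Omega$-compactification of $G$ is a compact space containing $\mathcal VG$ as a dense subspace whose subspace obtained by deleting $\mathring E$ is Hausdorff. $\mathcal C_X(Y)$: components of $G-X$ with neighbourhood exactly $Y$; $\mathrm{crit}(X)=\{Y\subseteq X:\mathcal C_X(Y)\text{ infinite}\}$; $c_X(C)$ the principal ultrafilter on $\mathcal C_X$ generated by $\{C\}$; for $Y\in\mathrm{crit}(X)$, $\mathcal F_X(Y)$ is the set of $\mathcal C\subseteq\mathcal C_X$ containing a cofinite subset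 of $\mathcal C_X(Y)$. $\mathfrak F_X=\{c_X(C)\}_{C}\cup\{\mathcal F_X(Y)\}_{Y\in\mathrm{crit}(X)}$ with topology generated by $\{\mathcal F:\mathcal C\in\mathcal F\}$. Bonding maps: $\mathfrak f_{X',X}(c_{X'}(C'))=c_X(\phi_{X',X}(C'))$; $\mathfrak f_{X',X}(\mathcal F_{X'}(Y))=\mathcal F_X(Y)$ if $Y\subseteq X$, and $=c_X(C)$ otherwise, $C$ the component of $G-X$ including $\bigcup\mathcal C_{X'}(Y)$. $\mathfrak F=\varprojlim\mathfrak F_X$; ends are identified with the elements $(c_X(C(X,\omega)))_X$, forming $\Omega\subseteq\mathfrak F$. $\mathfrak FG=G\cup\mathfrak F$ with the topology generated by the open sets of the 1-complex $G$ and the sets $\bigcup\mathcal C\cup\mathring E(X,\bigcup\mathcal C)\cup\{(\mathcal F_Y)_Y\in\mathfrak F:\mathcal C\in\mathcal F_X\}$ for $X\in\mathcal X$ and $\mathcal C$ either a singleton subset of $\mathcal C_X$ or a cofinite subset of $\mathcal C_X(Y)$ for some $Y\in\mathrm{crit}(X)$. *)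

theory Defs
  imports "HOL-Analysis.Analysis"
begin

section \<open>Graphs, components and ends\<close>

record 'v graph =
  verts :: "'v set"
  edges :: "'v set set"

definition is_graph :: "'v graph \<Rightarrow> bool" where
  "is_graph G \<longleftrightarrow> (\<forall>e\<in>edges G. e \<subseteq> verts G \<and> card e = 2)"

definition locally_finite_graph :: "'v graph \<Rightarrow> bool" where
  "locally_finite_graph G \<longleftrightarrow> (\<forall>v\<in>verts G. finite {e \<in> edges G. v \<in> e})"

definition adj_minus :: "'v graph \<Rightarrow> 'v set \<Rightarrow> ('v \<times> 'v) set" where
  "adj_minus G X = {(u, v). {u, v} \<in> edges G \<and> u \<notin> X \<and> v \<notin> X}"

definition connected_graph :: "'v graph \<Rightarrow> bool" where
  "connected_graph G \<longleftrightarrow> (\<forall>u\<in>verts G. \<forall>v\<in>verts G. (u, v) \<in> (adj_minus G {})\<^sup>*)"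

definition finite_vsets :: "'v graph \<Rightarrow> 'v set set" where
  "finite_vsets G = {X. finite X \<and> X \<subseteq> verts G}"

text \<open>A component of \<open>G - X\<close> is represented by its vertex set; it is an induced subgraph.\<close>

definition comps :: "'v graph \<Rightarrow> 'v set \<Rightarrow> 'v set set" where
  "comps G X = {(adj_minus G X)\<^sup>* `` {v} | v. v \<in> verts G - X}"

definition comp_proj :: "'v graph \<Rightarrow> 'v set \<Rightarrow> 'v set \<Rightarrow> 'v set \<Rightarrow> 'v set" where
  "comp_proj G X' X C' = (THE C. C \<in> comps G X \<and> C' \<subseteq> C)"

definition rays :: "'v graph \<Rightarrow> (nat \<Rightarrow> 'v) set" where
  "rays G = {r. inj r \<and> range r \<subseteq> verts G \<and> (\<forall>n. {r n, r (Suc n)} \<in> edges G)}"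

definition has_tail_in :: "(nat \<Rightarrow> 'v) \<Rightarrow> 'v set \<Rightarrow> bool" where
  "has_tail_in r C \<longleftrightarrow> (\<exists>n. r ` {n..} \<subseteq> C)"

definition ray_equiv :: "'v graph \<Rightarrow> ((nat \<Rightarrow> 'v) \<times> (nat \<Rightarrow> 'v)) set" where
  "ray_equiv G = {(r, s). r \<in> rays G \<and> s \<in> rays G \<and>
     (\<forall>X\<in>finite_vsets G. \<exists>C\<in>comps G X. has_tail_in r C \<and> has_tail_in s C)}"

definition ends :: "'v graph \<Rightarrow> (nat \<Rightarrow> 'v) set set" where
  "ends G = rays G // ray_equiv G"

definition end_comp :: "'v graph \<Rightarrow> 'v set \<Rightarrow> (nat \<Rightarrow> 'v) set \<Rightarrow> 'v set" where
  "end_comp G X \<omega> = (THE C. C \<in> comps G X \<and> (\<forall>r\<in>\<omega>. has_tail_in r C))"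

definition ends_in :: "'v graph \<Rightarrow> 'v set \<Rightarrow> (nat \<Rightarrow> 'v) set \<Rightarrow> (nat \<Rightarrow> 'v) set set" where
  "ends_in G X \<omega> = {\<omega>' \<in> ends G. end_comp G X \<omega>' = end_comp G X \<omega>}"


section \<open>The 1-complex of a graph\<close>

text \<open>
  Points of the 1-complex are given by barycentric coordinates, which avoids choosing orientations
  of the edges: the edge \<open>{u, v}\<close> is the copy \<open>edge_pt u v ` {0..1}\<close> of the unit interval, where
  \<open>edge_pt u v 0\<close> is the vertex \<open>u\<close>, \<open>edge_pt u v 1\<close> is the vertex \<open>v\<close>, and
  \<open>edge_pt u v t = edge_pt v u (1 - t)\<close>.
\<close>

type_synonym 'v pt = "'v \<Rightarrow> real"

definition vertex_pt :: "'v \<Rightarrow> 'v pt" where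
  "vertex_pt v = (\<lambda>w. if w = v then 1 else 0)"

definition edge_pt :: "'v \<Rightarrow> 'v \<Rightarrow> real \<Rightarrow> 'v pt" where
  "edge_pt u v t = (\<lambda>w. if w = u then 1 - t else if w = v then t else 0)"

definition inner_pts :: "'v set set \<Rightarrow> 'v pt set" where
  "inner_pts F = {edge_pt u v t | u v t. {u, v} \<in> F \<and> 0 < t \<and> t < 1}"

definition inner_pts_between :: "'v graph \<Rightarrow> 'v set \<Rightarrow> 'v set \<Rightarrow> 'v pt set" where
  "inner_pts_between G A B = inner_pts {{a, b} | a b. a \<in> A \<and> b \<in> B \<and> {a, b} \<in> edges G}"

definition induced_pts :: "'v graph \<Rightarrow> 'v set \<Rightarrow> 'v pt set" where
  "induced_pts G C = vertex_pt ` C \<union> inner_pts {e \<in> edges G. e \<subseteq> C}"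

text \<open>In a basic open star around \<open>u\<close> the function \<open>j\<close> picks, for each edge \<open>{u, v}\<close> at \<open>u\<close>, an
  inner point of that edge, independently for different edges. The vertex itself is added
  explicitly so that the star of an isolated vertex is not empty.\<close>

definition complex_basis :: "'v graph \<Rightarrow> 'v pt set set" where
  "complex_basis G =
     {edge_pt u v ` {a<..<b} | u v a b. {u, v} \<in> edges G \<and> 0 \<le> a \<and> a < b \<and> b \<le> 1} \<union>
     {insert (vertex_pt u) (\<Union>v\<in>{v. {u, v} \<in> edges G}. edge_pt u v ` {0..<j v}) | u j.
        u \<in> verts G \<and> (\<forall>v. {u, v} \<in> edges G \<longrightarrow> 0 < j v \<and> j v < 1)}"

definition complex_top :: "'v graph \<Rightarrow> 'v pt topology" where
  "complex_top G = topology_generated_by (complex_basis G)"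


section \<open>The space \<open>VG\<close> and \<open>\<Omega>\<close>-compactifications\<close>

definition VG :: "'v graph \<Rightarrow> ('v pt + (nat \<Rightarrow> 'v) set) topology" where
  "VG G = topology_generated_by (
     {Inl ` U | U. openin (complex_top G) U} \<union>
     {Inl ` (induced_pts G (end_comp G X \<omega>) \<union> inner_pts_between G X (end_comp G X \<omega>))
        \<union> Inr ` ends_in G X \<omega> | X \<omega>. X \<in> finite_vsets G \<and> \<omega> \<in> ends G})"

text \<open>The map \<open>i\<close> is the inclusion of \<open>VG\<close> in \<open>K\<close>. Compactness does not include the
  Hausdorff property.\<close>

definition Omega_compactification ::
    "'v graph \<Rightarrow> 'b topology \<Rightarrow> ('v pt + (nat \<Rightarrow> 'v) set \<Rightarrow> 'b) \<Rightarrow> bool" where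
  "Omega_compactification G K i \<longleftrightarrow>
     compact_space K \<and>
     embedding_map (VG G) K i \<and>
     K closure_of (i ` topspace (VG G)) = topspace K \<and>
     Hausdorff_space (subtopology K (topspace K - i ` Inl ` inner_pts (edges G)))"


section \<open>The inverse system of filters\<close>

definition comps_nbh :: "'v graph \<Rightarrow> 'v set \<Rightarrow> 'v set \<Rightarrow> 'v set set" where
  "comps_nbh G X Y = {C \<in> comps G X. {v \<in> verts G - C. \<exists>u\<in>C. {u, v} \<in> edges G} = Y}"

definition crit :: "'v graph \<Rightarrow> 'v set \<Rightarrow> 'v set set" where
  "crit G X = {Y. Y \<subseteq> X \<and> infinite (comps_nbh G X Y)}"

definition cofinite_in :: "'a set \<Rightarrow> 'a set \<Rightarrow> bool" where
  "cofinite_in A B \<longleftrightarrow> A \<subseteq> B \<and> finite (B - A)"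

definition princ_filter :: "'v graph \<Rightarrow> 'v set \<Rightarrow> 'v set \<Rightarrow> 'v set set set" where
  "princ_filter G X C = {\<C>. \<C> \<subseteq> comps G X \<and> C \<in> \<C>}"

definition crit_filter :: "'v graph \<Rightarrow> 'v set \<Rightarrow> 'v set \<Rightarrow> 'v set set set" where
  "crit_filter G X Y = {\<C>. \<C> \<subseteq> comps G X \<and> (\<exists>\<D>. cofinite_in \<D> (comps_nbh G X Y) \<and> \<D> \<subseteq> \<C>)}"

definition filters_at :: "'v graph \<Rightarrow> 'v set \<Rightarrow> 'v set set set set" where
  "filters_at G X = princ_filter G X ` comps G X \<union> crit_filter G X ` crit G X"

definition bond ::
    "'v graph \<Rightarrow> 'v set \<Rightarrow> 'v set \<Rightarrow> 'v set set set \<Rightarrow> 'v set set set" where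
  "bond G X' X F =
     (if F \<in> princ_filter G X' ` comps G X'
      then princ_filter G X (comp_proj G X' X (THE C'. C' \<in> comps G X' \<and> F = princ_filter G X' C'))
      else let Y = (THE Y. Y \<in> crit G X' \<and> F = crit_filter G X' Y) in
        if Y \<subseteq> X then crit_filter G X Y
        else princ_filter G X (THE C. C \<in> comps G X \<and> \<Union>(comps_nbh G X' Y) \<subseteq> C))"

definition filter_lim :: "'v graph \<Rightarrow> ('v set \<Rightarrow> 'v set set set) set" where
  "filter_lim G = {F \<in> Pi\<^sub>E (finite_vsets G) (filters_at G).
     \<forall>X\<in>finite_vsets G. \<forall>X'\<in>finite_vsets G. X \<subseteq> X' \<longrightarrow> bond G X' X (F X') = F X}"

definition end_pt :: "'v graph \<Rightarrow> (nat \<Rightarrow> 'v) set \<Rightarrow> ('v set \<Rightarrow> 'v set set set)" where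
  "end_pt G \<omega> = (\<lambda>X\<in>finite_vsets G. princ_filter G X (end_comp G X \<omega>))"

definition FG :: "'v graph \<Rightarrow> ('v pt + ('v set \<Rightarrow> 'v set set set)) topology" where
  "FG G = topology_generated_by (
     {Inl ` U | U. openin (complex_top G) U} \<union>
     {Inl ` ((\<Union>C\<in>\<C>. induced_pts G C) \<union> inner_pts_between G X (\<Union>\<C>))
        \<union> Inr ` {F \<in> filter_lim G. \<C> \<in> F X} | X \<C>.
        X \<in> finite_vsets G \<and>
        ((\<exists>C\<in>comps G X. \<C> = {C}) \<or> (\<exists>Y\<in>crit G X. cofinite_in \<C> (comps_nbh G X Y)))})"


section \<open>Topological notions\<close>

definition totally_disconnected_space :: "'a topology \<Rightarrow> bool" where
  "totally_disconnected_space T \<longleftrightarrow> (\<forall>x\<in>topspace T. connected_component_of_set T x = {x})"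

text \<open>The Freudenthal compactification of a space \<open>T\<close>: a (topological) end of \<open>T\<close> is a consistent
  choice of a component of \<open>T - K\<close> for every compact \<open>K\<close>.\<close>

definition compl_comps :: "'a topology \<Rightarrow> 'a set \<Rightarrow> 'a set set" where
  "compl_comps T K = connected_components_of (subtopology T (topspace T - K))"

definition top_ends :: "'a topology \<Rightarrow> ('a set \<Rightarrow> 'a set) set" where
  "top_ends T = {\<epsilon> \<in> Pi\<^sub>E {K. compactin T K} (compl_comps T).
     \<forall>K K'. compactin T K \<and> compactin T K' \<and> K \<subseteq> K' \<longrightarrow> \<epsilon> K' \<subseteq> \<epsilon> K}"

definition freudenthal :: "'a topology \<Rightarrow> ('a + ('a set \<Rightarrow> 'a set)) topology" where
  "freudenthal T = topology_generated_by (
     {Inl ` U | U. openin T U} \<union>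
     {Inl ` C \<union> Inr ` {\<epsilon> \<in> top_ends T. \<epsilon> K = C} | K C. compactin T K \<and> C \<in> compl_comps T K})"

end

theory Submission
  imports Defs
begin

text \<open>
  Every component of \<open>G - X\<close> has its neighbourhood in the finite set \<open>X\<close>, so \<open>\<C>\<^sub>X\<close> splits into finitely
  many classes \<open>\<C>\<^sub>X(Y)\<close>, and an ultrafilter on \<open>\<C>\<^sub>X\<close> is either principal or contains exactly one
  filter \<open>\<F>\<^sub>X(Y)\<close>. Hence every ultrafilter on the vertex set that contains all cofinite sets converges
  to a point of the inverse limit. If a cover of the limit by basic sets had no finite subfamily
  covering all but finitely many vertices, such an ultrafilter would avoid every set of the cover; so
  finitely many basic sets leave only a finite subgraph uncovered, and this gives compactness. Since
  an edge that meets a union \<open>A\<close> of components of \<open>G - X\<close> ends in \<open>A \<union> X\<close>, the part of a basic set that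
  lies in \<open>G\<close> is the open star of \<open>A\<close>.

  If \<open>G\<close> is locally finite and connected, then \<open>G - X\<close> has finitely many components, so a point of the
  limit is a consistent choice of components. Following vertices from which all of the chosen
  components can be reached away from a root yields a ray that induces it. The finite subgraphs are
  cofinal among the compact subsets of the 1-complex, and the components of the complement of \<open>G[X]\<close>
  are the open stars of the components of \<open>G - X\<close>; this identifies \<open>FG\<close> with the Freudenthal
  compactification.
\<close>

section \<open>Ultrafilters\<close>

text \<open>The filters \<open>crit_filter G X Y\<close> are not ultrafilters: a family splitting
  \<open>comps_nbh G X Y\<close> into two infinite halves is left undecided. Uniqueness of limits,
  separation of limit points and total disconnectedness rest on this.

  The ultrafilters live on the vertex set and not on the sets of components, so that one of them
  determines a filter for every \<open>X\<close> at once; compatibility under the bonding maps then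
  follows from uniqueness.

  \<open>FG G\<close> itself need not be Hausdorff. If a vertex \<open>v\<close> sends infinitely
  many edges into \<open>end_comp G X \<omega>\<close> for every \<open>X\<close> containing
  \<open>v\<close>, then every neighbourhood of \<open>v\<close> meets every neighbourhood of the
  end in inner edge points. Separation is therefore tested on vertices and limit points
  only.\<close>

definition fin_inter :: "'a set set \<Rightarrow> bool" where
  "fin_inter S \<longleftrightarrow> (\<forall>F. finite F \<and> F \<subseteq> S \<longrightarrow> \<Inter>F \<noteq> {})"

definition ultrafilter :: "'a set set \<Rightarrow> bool" where
  "ultrafilter U \<longleftrightarrow> {} \<notin> U \<and> (\<forall>P\<in>U. \<forall>Q\<in>U. P \<inter> Q \<in> U) \<and>
     (\<forall>P\<in>U. \<forall>Q. P \<subseteq> Q \<longrightarrow> Q \<in> U) \<and> (\<forall>P. P \<in> U \<or> - P \<in> U)"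

lemma ultrafilterD:
  assumes "ultrafilter U"
  shows "{} \<notin> U" "P \<in> U \<Longrightarrow> Q \<in> U \<Longrightarrow> P \<inter> Q \<in> U"
    "P \<in> U \<or> - P \<in> U" "P \<in> U \<Longrightarrow> P \<subseteq> Q \<Longrightarrow> Q \<in> U"
  using assms unfolding ultrafilter_def by blast+

text \<open>A family maximal for the finite intersection property contains every set that meets all
  its finite intersections (\<open>meet\<close>). Closure under intersections and supersets and the
  dichotomy are all obtained from this one property.\<close>

lemma ultrafilter_exists:
  assumes "fin_inter B"
  shows "\<exists>U. ultrafilter U \<and> B \<subseteq> U"
proof -
  let ?A = "{S. B \<subseteq> S \<and> fin_inter S}"
  have "\<exists>M\<in>?A. \<forall>S\<in>?A. M \<subseteq> S \<longrightarrow> S = M"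
  proof (rule subset_Zorn_nonempty)
    show "?A \<noteq> {}" using assms by auto
    fix \<C> assume ne: "\<C> \<noteq> {}" and ch: "subset.chain ?A \<C>"
    have "\<Inter>F \<noteq> {}" if F: "finite F" "F \<subseteq> \<Union>\<C>" for F
    proof -
      obtain S where S: "S \<in> \<C>" "F \<subseteq> S" using finite_subset_Union_chain[OF F ne ch] .
      then have "fin_inter S" using ch by (auto simp: subset.chain_def)
      then show ?thesis using F(1) S(2) by (simp add: fin_inter_def)
    qed
    then have "fin_inter (\<Union>\<C>)" by (simp add: fin_inter_def)
    moreover have "B \<subseteq> \<Union>\<C>"
      using ne ch unfolding subset.chain_def by blast
    ultimately show "\<Union>\<C> \<in> ?A" by blast
  qed
  then obtain U where U: "U \<in> ?A" and mxA: "\<forall>S\<in>?A. U \<subseteq> S \<longrightarrow> S = U" by (rule bexE)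
  then have BU: "B \<subseteq> U" and fU: "fin_inter U" by auto
  have mx: "S = U" if "U \<subseteq> S" "fin_inter S" for S
    using mxA BU that by blast
  have meet: "P \<in> U" if "\<And>F. finite F \<Longrightarrow> F \<subseteq> U \<Longrightarrow> \<Inter>F \<inter> P \<noteq> {}" for P
  proof -
    have "\<Inter>F \<noteq> {}" if F: "finite F" "F \<subseteq> insert P U" for F
    proof -
      have "\<Inter>(F - {P}) \<inter> P \<noteq> {}"
        using \<open>\<And>F. finite F \<Longrightarrow> F \<subseteq> U \<Longrightarrow> \<Inter>F \<inter> P \<noteq> {}\<close>[of "F - {P}"] F by blast
      then show ?thesis by blast
    qed
    then have "fin_inter (insert P U)" by (simp add: fin_inter_def)
    then have "insert P U = U" using mx by blast
    then show ?thesis by blast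
  qed
  have fi: "\<Inter>F \<noteq> {}" if "finite F" "F \<subseteq> U" for F
    using fU that by (simp add: fin_inter_def)
  have "ultrafilter U"
    unfolding ultrafilter_def
  proof (intro conjI ballI allI impI)
    show "{} \<notin> U" using fi[of "{{}}"] by auto
    show "P \<inter> Q \<in> U" if "P \<in> U" "Q \<in> U" for P Q
    proof (rule meet)
      fix F assume "finite F" "F \<subseteq> U"
      then show "\<Inter>F \<inter> (P \<inter> Q) \<noteq> {}" using fi[of "insert P (insert Q F)"] that by auto
    qed
    show "Q \<in> U" if "P \<in> U" "P \<subseteq> Q" for P Q
    proof (rule meet)
      fix F assume "finite F" "F \<subseteq> U"
      then show "\<Inter>F \<inter> Q \<noteq> {}" using fi[of "insert P F"] that by auto
    qed
    show "P \<in> U \<or> - P \<in> U" for P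
    proof (rule ccontr)
      assume "\<not> ?thesis"
      \<comment> \<open>If neither \<open>P\<close> nor its complement can be absorbed, two finite
        subfamilies have intersections on opposite sides of \<open>P\<close>, and together an empty
        one.\<close>
      then obtain F F' where F: "finite F" "F \<subseteq> U" "\<Inter>F \<inter> P = {}"
          and F': "finite F'" "F' \<subseteq> U" "\<Inter>F' \<inter> - P = {}"
        using meet by metis
      have "\<Inter>(F \<union> F') = {}" using F(3) F'(3) by blast
      then show False using fi[of "F \<union> F'"] F F' by blast
    qed
  qed
  then show ?thesis using BU by blast
qed

lemma ultrafilter_finite_Union:
  assumes U: "ultrafilter U" and "finite \<A>" "\<Union>\<A> \<in> U"
  shows "\<exists>A\<in>\<A>. A \<in> U"
proof (rule ccontr)
  assume "\<not> ?thesis"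
  then have n: "\<And>A. A \<in> \<A> \<Longrightarrow> - A \<in> U" using ultrafilterD(3)[OF U] by blast
  from assms(2,3) n show False
  proof (induction \<A>)
    case empty then show ?case using ultrafilterD(1)[OF U] by simp
  next
    case (insert A \<A>)
    have "- A \<inter> \<Union>(insert A \<A>) \<in> U" using insert ultrafilterD(2)[OF U] by blast
    then have "\<Union>\<A> \<in> U" by (rule ultrafilterD(4)[OF U]) blast
    then show ?case using insert by blast
  qed
qed

section \<open>Components and filters\<close>

definition nbh :: "'v graph \<Rightarrow> 'v set \<Rightarrow> 'v set" where
  "nbh G C = {v \<in> verts G - C. \<exists>u\<in>C. {u, v} \<in> edges G}"

text \<open>These families index the basic open sets around limit points in \<open>FG\<close>. Every
  set belonging to a filter in \<open>filters_at G X\<close> includes one that belongs to the same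
  filter, so they act as a base of each filter.\<close>

definition basic_at :: "'v graph \<Rightarrow> 'v set \<Rightarrow> 'v set set \<Rightarrow> bool" where
  "basic_at G X \<C> \<longleftrightarrow>
     (\<exists>C\<in>comps G X. \<C> = {C}) \<or> (\<exists>Y\<in>crit G X. cofinite_in \<C> (comps_nbh G X Y))"

text \<open>For \<open>X \<subseteq> X'\<close> this is the preimage of \<open>\<A>\<close> under
  the map that sends a component of G - X' to the component of G - X containing it.\<close>

definition comps_inside :: "'v graph \<Rightarrow> 'v set \<Rightarrow> 'v set set \<Rightarrow> 'v set set" where
  "comps_inside G X' \<A> = {C' \<in> comps G X'. \<exists>C\<in>\<A>. C' \<subseteq> C}"

locale sgraph =
  fixes G :: "'v graph"
  assumes is_graph: "is_graph G"
begin

abbreviation "V \<equiv> verts G"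
abbreviation "E \<equiv> edges G"
abbreviation "\<X> \<equiv> finite_vsets G"

section \<open>Components of G - X and their neighbourhoods\<close>

lemma edge_verts:
  assumes "{u, v} \<in> E"
  shows "u \<in> V" "v \<in> V" "u \<noteq> v"
  using assms is_graph by (auto simp: is_graph_def)

lemma edge_obtain:
  assumes "e \<in> E"
  obtains u v where "e = {u, v}" "u \<noteq> v"
  using assms is_graph by (auto simp: is_graph_def card_2_iff)

lemma rtrancl_adj_sym: "(u, v) \<in> (adj_minus G X)\<^sup>* \<Longrightarrow> (v, u) \<in> (adj_minus G X)\<^sup>*"
proof -
  have "sym (adj_minus G X)" by (auto simp: sym_def adj_minus_def insert_commute)
  then show "(u, v) \<in> (adj_minus G X)\<^sup>* \<Longrightarrow> (v, u) \<in> (adj_minus G X)\<^sup>*"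
    by (meson sym_rtrancl symD)
qed

lemma compsI: "v \<in> V \<Longrightarrow> v \<notin> X \<Longrightarrow> (adj_minus G X)\<^sup>* `` {v} \<in> comps G X"
  by (auto simp: comps_def)

lemma comps_eq_class:
  assumes "C \<in> comps G X" "v \<in> C"
  shows "C = (adj_minus G X)\<^sup>* `` {v}"
proof -
  obtain w where w: "C = (adj_minus G X)\<^sup>* `` {w}" using assms by (auto simp: comps_def)
  then show ?thesis using assms by (auto intro: rtrancl_trans rtrancl_adj_sym)
qed

lemma comps_subset:
  assumes "C \<in> comps G X"
  shows "C \<subseteq> V" "C \<inter> X = {}"
proof -
  obtain w where w: "C = (adj_minus G X)\<^sup>* `` {w}" "w \<in> V" "w \<notin> X" using assms by (auto simp: comps_def)
  have "v \<in> V \<and> v \<notin> X" if "(w, v) \<in> (adj_minus G X)\<^sup>*" for v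
    using that by induction (use w edge_verts in \<open>auto simp: adj_minus_def\<close>)
  then show "C \<subseteq> V" "C \<inter> X = {}" using w by auto
qed

lemma comps_nonempty: "C \<in> comps G X \<Longrightarrow> C \<noteq> {}"
  by (auto simp: comps_def)

lemma comps_unique: "C \<in> comps G X \<Longrightarrow> D \<in> comps G X \<Longrightarrow> v \<in> C \<Longrightarrow> v \<in> D \<Longrightarrow> C = D"
  using comps_eq_class by metis

lemma comps_cover:
  assumes "v \<in> V" "v \<notin> X"
  obtains C where "C \<in> comps G X" "v \<in> C"
  using compsI[OF assms] by blast

lemma comps_edge:
  assumes "C \<in> comps G X" "u \<in> C" "{u, v} \<in> E" "v \<notin> X"
  shows "v \<in> C"
proof -
  have "(u, v) \<in> adj_minus G X" using assms comps_subset[OF assms(1)] by (auto simp: adj_minus_def)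
  then show ?thesis using comps_eq_class[OF assms(1,2)] by auto
qed

lemma comps_induct:
  assumes "C \<in> comps G X" "u \<in> C" "w \<in> C" "P u"
    and step: "\<And>v w. v \<in> C \<Longrightarrow> w \<in> C \<Longrightarrow> P v \<Longrightarrow> {v, w} \<in> E \<Longrightarrow> P w"
  shows "P w"
proof -
  have "(u, w) \<in> (adj_minus G X)\<^sup>*" using assms comps_eq_class by blast
  then have "w \<in> C \<and> P w"
  proof induction
    case base show ?case using assms(2,4) ..
  next
    case (step y z)
    then show ?case using assms(5) comps_edge[OF assms(1)] by (auto simp: adj_minus_def)
  qed
  then show ?thesis ..
qed

lemma comps_coarser_ex1:
  assumes "X \<subseteq> X'" "C' \<in> comps G X'"
  shows "\<exists>!C. C \<in> comps G X \<and> C' \<subseteq> C"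
proof -
  obtain v where v: "v \<in> C'" using comps_nonempty[OF assms(2)] by blast
  then have "v \<in> V" "v \<notin> X" using comps_subset[OF assms(2)] assms(1) by auto
  then obtain C where C: "C \<in> comps G X" "v \<in> C" by (rule comps_cover)
  have "w \<in> C" if "w \<in> C'" for w
    by (rule comps_induct[OF assms(2) v that, of "\<lambda>w. w \<in> C"])
       (use C comps_edge[OF C(1)] comps_subset[OF assms(2)] assms(1) in blast)+
  then show ?thesis using C v comps_unique by blast
qed

lemma comp_proj:
  assumes "X \<subseteq> X'" "C' \<in> comps G X'"
  shows "comp_proj G X' X C' \<in> comps G X" "C' \<subseteq> comp_proj G X' X C'"
  using theI'[OF comps_coarser_ex1[OF assms]] by (auto simp: comp_proj_def)

lemma comps_coarser_unique:
  assumes "X \<subseteq> X'" "C' \<in> comps G X'" "C \<in> comps G X" "C' \<subseteq> C" "D \<in> comps G X" "C' \<subseteq> D"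
  shows "C = D"
  using comps_coarser_ex1[OF assms(1,2)] assms by auto

lemma nbh_comps: "C \<in> comps G X \<Longrightarrow> nbh G C \<subseteq> X"
  using comps_edge by (fastforce simp: nbh_def)

lemma comps_nbh_eq: "comps_nbh G X Y = {C \<in> comps G X. nbh G C = Y}"
  by (simp add: comps_nbh_def nbh_def)

text \<open>No edge leaves \<open>C\<close> except into \<open>X\<close>, so a walk in G - X that
  starts in \<open>C\<close> stays there. The two deleted sets need not be comparable in a fixed
  direction: \<open>comps_nbh_refine\<close> applies the lemma both for shrinking and for enlarging
  the deleted set.\<close>

lemma comps_by_nbh:
  assumes "C \<in> comps G X'" "C \<inter> X = {}" "nbh G C \<subseteq> X"
  shows "C \<in> comps G X"
proof -
  obtain v where v: "v \<in> C" using comps_nonempty[OF assms(1)] by blast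
  then have "v \<in> V" "v \<notin> X" using comps_subset[OF assms(1)] assms(2) by auto
  then obtain D where D: "D \<in> comps G X" "v \<in> D" by (rule comps_cover)
  have "w \<in> D" if "w \<in> C" for w
    by (rule comps_induct[OF assms(1) v that, of "\<lambda>w. w \<in> D"])
       (use D comps_edge[OF D(1)] assms(2) in auto)
  moreover have "w \<in> C" if "w \<in> D" for w
    by (rule comps_induct[OF D that, of "\<lambda>w. w \<in> C"])
       (use v assms(3) comps_subset[OF D(1)] in \<open>auto simp: nbh_def\<close>)
  ultimately have "C = D" by blast
  then show ?thesis using D by simp
qed

lemma finite_comps_meeting:
  assumes "finite Z"
  shows "finite {C \<in> comps G X. C \<inter> Z \<noteq> {}}"
proof (rule finite_subset)
  show "{C \<in> comps G X. C \<inter> Z \<noteq> {}} \<subseteq> (\<lambda>v. (adj_minus G X)\<^sup>* `` {v}) ` Z"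
    using comps_eq_class by blast
qed (use assms in simp)

section \<open>Filters on the set of components\<close>

lemma crit_filter_eq:
  "crit_filter G X Y = {\<C>. \<C> \<subseteq> comps G X \<and> finite (comps_nbh G X Y - \<C>)}" (is "_ = ?R")
proof -
  have "(\<exists>\<D>. cofinite_in \<D> (comps_nbh G X Y) \<and> \<D> \<subseteq> \<C>) \<longleftrightarrow> finite (comps_nbh G X Y - \<C>)" for \<C>
  proof
    assume "\<exists>\<D>. cofinite_in \<D> (comps_nbh G X Y) \<and> \<D> \<subseteq> \<C>"
    then show "finite (comps_nbh G X Y - \<C>)"
      by (meson Diff_mono cofinite_in_def finite_subset subset_refl)
  next
    assume "finite (comps_nbh G X Y - \<C>)"
    then have "cofinite_in (comps_nbh G X Y \<inter> \<C>) (comps_nbh G X Y)"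
      by (simp add: cofinite_in_def Diff_Int)
    then show "\<exists>\<D>. cofinite_in \<D> (comps_nbh G X Y) \<and> \<D> \<subseteq> \<C>" by blast
  qed
  then show ?thesis by (auto simp: crit_filter_def)
qed

lemma comps_nbh_subset: "comps_nbh G X Y \<subseteq> comps G X"
  by (auto simp: comps_nbh_def)

lemma filters_at_cases:
  assumes "f \<in> filters_at G X"
  obtains C where "C \<in> comps G X" "f = princ_filter G X C"
  | Y where "Y \<in> crit G X" "f = crit_filter G X Y"
  using assms by (auto simp: filters_at_def)

lemma filters_at_subset: "f \<in> filters_at G X \<Longrightarrow> \<A> \<in> f \<Longrightarrow> \<A> \<subseteq> comps G X"
  by (elim filters_at_cases) (auto simp: princ_filter_def crit_filter_eq)

lemma filters_at_mono:
  "f \<in> filters_at G X \<Longrightarrow> \<A> \<in> f \<Longrightarrow> \<A> \<subseteq> \<B> \<Longrightarrow> \<B> \<subseteq> comps G X \<Longrightarrow> \<B> \<in> f"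
  by (elim filters_at_cases) (auto simp: princ_filter_def crit_filter_eq intro: rev_finite_subset)

lemma filters_at_Int:
  assumes "f \<in> filters_at G X" "\<A> \<in> f" "\<B> \<in> f"
  shows "\<A> \<inter> \<B> \<in> f"
  using assms(1)
proof (cases rule: filters_at_cases)
  case 1 then show ?thesis using assms by (auto simp: princ_filter_def)
next
  case (2 Y) then show ?thesis using assms by (auto simp: crit_filter_eq Diff_Int)
qed

lemma filters_at_nonempty: "f \<in> filters_at G X \<Longrightarrow> {} \<notin> f"
  by (elim filters_at_cases) (auto simp: princ_filter_def crit_filter_eq crit_def)

lemma filters_at_disjoint: "f \<in> filters_at G X \<Longrightarrow> \<A> \<in> f \<Longrightarrow> \<A> \<inter> \<B> = {} \<Longrightarrow> \<B> \<notin> f"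
  using filters_at_Int filters_at_nonempty by metis

lemma basic_at_subset: "basic_at G X \<C> \<Longrightarrow> \<C> \<subseteq> comps G X"
  using comps_nbh_subset by (fastforce simp: basic_at_def cofinite_in_def)

lemma basic_at_nonempty: "basic_at G X \<C> \<Longrightarrow> \<C> \<noteq> {}"
  by (auto simp: basic_at_def cofinite_in_def crit_def)

lemma basic_at_nbh: "Y \<in> crit G X \<Longrightarrow> finite \<A> \<Longrightarrow> basic_at G X (comps_nbh G X Y - \<A>)"
  by (auto simp: basic_at_def cofinite_in_def Diff_Diff_Int)

lemma basic_at_sing: "C \<in> comps G X \<Longrightarrow> basic_at G X {C}"
  by (auto simp: basic_at_def)

text \<open>For an ultrafilter the complement of \<open>\<C>\<close> would do; here this works
  because \<open>\<C>\<close> is basic. A singleton can be removed from an infinite class without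
  losing cofiniteness, and classes \<open>comps_nbh G X Y\<close> with different \<open>Y\<close>
  are disjoint. The lemma makes basic open sets of limit points closed as well.\<close>

lemma filters_at_separate:
  assumes "f \<in> filters_at G X" "basic_at G X \<C>" "\<C> \<notin> f"
  obtains \<D> where "basic_at G X \<D>" "\<D> \<in> f" "\<C> \<inter> \<D> = {}"
  using assms(1)
proof (cases rule: filters_at_cases)
  case (1 C)
  then have "C \<notin> \<C>" using assms basic_at_subset by (auto simp: princ_filter_def)
  then show ?thesis using that[of "{C}"] 1 basic_at_sing by (auto simp: princ_filter_def)
next
  case (2 Y)
  from assms(2) consider D where "D \<in> comps G X" "\<C> = {D}"
    | Y' where "Y' \<in> crit G X" "cofinite_in \<C> (comps_nbh G X Y')" by (auto simp: basic_at_def)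
  then show ?thesis
  proof cases
    case (1 D)
    have "comps_nbh G X Y - {D} \<in> f"
      using 2 comps_nbh_subset by (auto simp: crit_filter_eq Diff_Diff_Int)
    then show ?thesis using that[of "comps_nbh G X Y - {D}"] 1 2 basic_at_nbh by blast
  next
    case Y': (2 Y')
    have "Y \<noteq> Y'" using 2 Y' assms basic_at_subset by (auto simp: crit_filter_eq cofinite_in_def)
    then have "\<C> \<inter> comps_nbh G X Y = {}" using Y' by (auto simp: cofinite_in_def comps_nbh_eq)
    then show ?thesis
      using that[of "comps_nbh G X Y"] 2 basic_at_nbh[of Y X "{}"] comps_nbh_subset by (auto simp: crit_filter_eq)
  qed
qed

lemma filters_at_contains_basic:
  assumes "f \<in> filters_at G X" "\<A> \<in> f"
  obtains \<C> where "basic_at G X \<C>" "\<C> \<in> f" "\<C> \<subseteq> \<A>"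
  using assms(1)
proof (cases rule: filters_at_cases)
  case (1 C)
  then show ?thesis using assms(2) basic_at_sing that[of "{C}"] by (auto simp: princ_filter_def)
next
  case (2 Y)
  have e: "comps_nbh G X Y \<inter> \<A> = comps_nbh G X Y - (comps_nbh G X Y - \<A>)" by blast
  have "basic_at G X (comps_nbh G X Y \<inter> \<A>)"
    using assms(2) 2 unfolding e by (intro basic_at_nbh) (auto simp: crit_filter_eq)
  moreover have "comps_nbh G X Y \<inter> \<A> \<in> f"
    using assms(2) 2 by (auto simp: crit_filter_eq Diff_Int)
  ultimately show ?thesis using that by blast
qed

text \<open>This stands in for the maximality of ultrafilters. A family in \<open>f'\<close> but not
  in \<open>f\<close> could be shrunk to a basic one, and \<open>f\<close> would contain a family
  disjoint from that, which then belongs to \<open>f'\<close> too.\<close>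

lemma filters_at_subset_imp_eq:
  assumes f: "f \<in> filters_at G X" and f': "f' \<in> filters_at G X" and sub: "f \<subseteq> f'"
  shows "f = f'"
proof
  show "f' \<subseteq> f"
  proof
    fix \<A> assume A: "\<A> \<in> f'"
    show "\<A> \<in> f"
    proof (rule ccontr)
      assume "\<A> \<notin> f"
      obtain \<C> where \<C>: "basic_at G X \<C>" "\<C> \<in> f'" "\<C> \<subseteq> \<A>"
        using filters_at_contains_basic[OF f' A] .
      then have "\<C> \<notin> f"
        using \<open>\<A> \<notin> f\<close> filters_at_mono[OF f] filters_at_subset[OF f' A] by blast
      then obtain \<D> where "\<D> \<in> f" "\<C> \<inter> \<D> = {}"
        using filters_at_separate[OF f \<C>(1)] by metis
      then show False using sub \<C>(2) filters_at_disjoint[OF f'] by blast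
    qed
  qed
qed (fact sub)

lemma filters_at_distinct:
  assumes "f \<in> filters_at G X" "f' \<in> filters_at G X" "f \<noteq> f'"
  obtains \<C> where "basic_at G X \<C>" "\<C> \<in> f" "\<C> \<notin> f'"
proof -
  obtain \<A> where A: "\<A> \<in> f" "\<A> \<notin> f'" using assms filters_at_subset_imp_eq by blast
  then obtain \<C> where "basic_at G X \<C>" "\<C> \<in> f" "\<C> \<subseteq> \<A>"
    using filters_at_contains_basic[OF assms(1)] by metis
  then show ?thesis
    using that A filters_at_mono[OF assms(2)] filters_at_subset[OF assms(1)] by metis
qed

section \<open>Bonding maps as pushforwards of filters\<close>

lemma princ_filter_inj:
  "C \<in> comps G X \<Longrightarrow> princ_filter G X C = princ_filter G X D \<Longrightarrow> C = D"
  by (auto simp: princ_filter_def set_eq_iff[of "Collect _"] dest!: spec[of _ "{C}"])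

lemma crit_filter_inj:
  assumes "Y \<in> crit G X" "crit_filter G X Y = crit_filter G X Y'"
  shows "Y = Y'"
proof -
  have "comps_nbh G X Y' \<in> crit_filter G X Y"
    using assms(2) comps_nbh_subset by (auto simp: crit_filter_eq)
  then have "finite (comps_nbh G X Y - comps_nbh G X Y')" by (simp add: crit_filter_eq)
  then have "comps_nbh G X Y \<inter> comps_nbh G X Y' \<noteq> {}"
    using assms(1) by (auto simp: crit_def Diff_triv)
  then show ?thesis by (auto simp: comps_nbh_eq)
qed

text \<open>Together with the two injectivity lemmas this evaluates the case distinction and the
  definite descriptions in \<open>bond\<close>.\<close>

lemma crit_filter_not_princ:
  assumes "Y \<in> crit G X" "C \<in> comps G X"
  shows "crit_filter G X Y \<noteq> princ_filter G X C"
proof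
  assume "crit_filter G X Y = princ_filter G X C"
  then have "{C} \<in> crit_filter G X Y" using assms by (auto simp: princ_filter_def)
  then show False using assms by (auto simp: crit_filter_eq crit_def)
qed

lemma bond_princ:
  assumes "C \<in> comps G X'"
  shows "bond G X' X (princ_filter G X' C) = princ_filter G X (comp_proj G X' X C)"
proof -
  have "(THE C'. C' \<in> comps G X' \<and> princ_filter G X' C = princ_filter G X' C') = C"
    using assms princ_filter_inj by (intro the_equality) auto
  then show ?thesis using assms by (simp add: bond_def)
qed

lemma bond_crit:
  assumes "Y \<in> crit G X'"
  shows "bond G X' X (crit_filter G X' Y) =
    (if Y \<subseteq> X then crit_filter G X Y
     else princ_filter G X (THE C. C \<in> comps G X \<and> \<Union>(comps_nbh G X' Y) \<subseteq> C))"
proof -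
  have "(THE Z. Z \<in> crit G X' \<and> crit_filter G X' Y = crit_filter G X' Z) = Y"
    using assms crit_filter_inj by (intro the_equality) auto
  moreover have "crit_filter G X' Y \<notin> princ_filter G X' ` comps G X'"
    using crit_filter_not_princ[OF assms] by auto
  ultimately show ?thesis by (simp add: bond_def Let_def)
qed

text \<open>A vertex \<open>y\<close> of \<open>Y\<close> outside \<open>X\<close> survives in G - X
  and is adjacent to every component in \<open>comps_nbh G X' Y\<close>. It therefore ties all of
  them into its own component of G - X.\<close>

lemma crit_comp_ex1:
  assumes "X \<subseteq> X'" "Y \<in> crit G X'" "\<not> Y \<subseteq> X"
  shows "\<exists>!C. C \<in> comps G X \<and> \<Union>(comps_nbh G X' Y) \<subseteq> C"
proof -
  obtain y where y: "y \<in> Y" "y \<notin> X" using assms(3) by blast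
  obtain C0 where C0: "C0 \<in> comps_nbh G X' Y"
    using assms(2) infinite_imp_nonempty by (fastforce simp: crit_def)
  then have yV: "y \<in> V" using y by (auto simp: comps_nbh_eq nbh_def)
  then obtain C where C: "C \<in> comps G X" "y \<in> C" using y(2) by (rule comps_cover)
  have "C' \<subseteq> C" if CY: "C' \<in> comps_nbh G X' Y" for C'
  proof -
    have C': "C' \<in> comps G X'" using CY by (simp add: comps_nbh_eq)
    then obtain D where D: "D \<in> comps G X" "C' \<subseteq> D" using comps_coarser_ex1[OF assms(1)] by blast
    obtain u where "u \<in> C'" "{u, y} \<in> E"
      using CY y(1) by (auto simp: comps_nbh_eq nbh_def)
    then have "y \<in> D" using comps_edge[OF D(1)] D y by blast
    then show ?thesis using comps_unique C D by blast
  qed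
  then have *: "\<Union>(comps_nbh G X' Y) \<subseteq> C" by blast
  show ?thesis
  proof (rule ex1I[of _ C])
    show "C \<in> comps G X \<and> \<Union>(comps_nbh G X' Y) \<subseteq> C" using C * by blast
    fix D assume "D \<in> comps G X \<and> \<Union>(comps_nbh G X' Y) \<subseteq> D"
    then show "D = C" using C * C0 comps_coarser_unique[OF assms(1), of C0 D C]
      by (auto simp: comps_nbh_eq)
  qed
qed

text \<open>A component whose neighbours all lie in \<open>X\<close> is unaffected by what happens
  elsewhere. Hence passing from \<open>X\<close> to \<open>X'\<close> destroys only those members of
  the class that meet \<open>X'\<close>, finitely many when \<open>X'\<close> is finite.\<close>

lemma comps_nbh_refine:
  assumes "X \<subseteq> X'" "Y \<subseteq> X"
  shows "comps_nbh G X' Y \<subseteq> comps_nbh G X Y"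
    and "C \<in> comps_nbh G X Y \<Longrightarrow> C \<inter> X' = {} \<Longrightarrow> C \<in> comps_nbh G X' Y"
proof -
  show "comps_nbh G X' Y \<subseteq> comps_nbh G X Y"
  proof
    fix D assume "D \<in> comps_nbh G X' Y"
    then show "D \<in> comps_nbh G X Y"
      using assms comps_by_nbh[of D X' X] comps_subset(2)[of D X'] by (auto simp: comps_nbh_eq)
  qed
  show "C \<in> comps_nbh G X Y \<Longrightarrow> C \<inter> X' = {} \<Longrightarrow> C \<in> comps_nbh G X' Y"
    using assms comps_by_nbh[of C X X'] by (auto simp: comps_nbh_eq)
qed

text \<open>The three cases of \<open>bond\<close> are one pushforward along the map of components.
  If \<open>Y \<subseteq> X\<close> is critical, the classes of \<open>Y\<close> at \<open>X\<close>
  and at \<open>X'\<close> differ by finitely many components, so cofiniteness means the same in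
  both. Otherwise the whole infinite class lies in a single component of G - X, and membership of
  that component decides.\<close>

lemma bond_pushforward:
  assumes XX': "X \<subseteq> X'" and "finite X'" and f: "f \<in> filters_at G X'"
  shows "bond G X' X f \<in> filters_at G X"
    and "\<A> \<in> bond G X' X f \<longleftrightarrow> \<A> \<subseteq> comps G X \<and> comps_inside G X' \<A> \<in> f"
proof -
  have "bond G X' X f \<in> filters_at G X \<and>
    (\<A> \<in> bond G X' X f \<longleftrightarrow> \<A> \<subseteq> comps G X \<and> comps_inside G X' \<A> \<in> f)"
    using f
  proof (cases rule: filters_at_cases)
    case (1 C)
    note p = comp_proj[OF XX' 1(1)]
    have "comp_proj G X' X C \<in> \<A> \<longleftrightarrow> (\<exists>D\<in>\<A>. C \<subseteq> D)" if "\<A> \<subseteq> comps G X"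
      using p comps_coarser_unique[OF XX' 1(1)] that by blast
    then show ?thesis using 1 p(1)
      unfolding 1(2) bond_princ[OF 1(1)] filters_at_def
      by (auto simp: princ_filter_def comps_inside_def)
  next
    case (2 Y)
    show ?thesis
    proof (cases "Y \<subseteq> X")
      case True
      note r = comps_nbh_refine[OF XX' True]
      have Y: "Y \<in> crit G X" using r(1) 2 True by (auto simp: crit_def dest: finite_subset)
      have "finite (comps_nbh G X Y - comps_nbh G X' Y)"
        by (rule finite_subset[OF _ finite_comps_meeting[OF \<open>finite X'\<close>, of X]])
           (use r(2) comps_nbh_subset in blast)
      moreover have "comps_nbh G X Y - \<A> \<subseteq>
          (comps_nbh G X Y - comps_nbh G X' Y) \<union> (comps_nbh G X' Y - \<A>)"
        "comps_nbh G X' Y - \<A> \<subseteq> comps_nbh G X Y - \<A>" using r by auto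
      ultimately have "finite (comps_nbh G X Y - \<A>) \<longleftrightarrow> finite (comps_nbh G X' Y - \<A>)"
        by (meson finite_UnI finite_subset)
      \<comment> \<open>Members of the class at \<open>X'\<close> are also components of G - X, so
        lying inside a member of \<open>\<A>\<close> means being that member.\<close>
      moreover have "comps_nbh G X' Y - \<A> = comps_nbh G X' Y - comps_inside G X' \<A>" if "\<A> \<subseteq> comps G X"
      proof -
        have "C \<in> \<A> \<longleftrightarrow> (\<exists>D\<in>\<A>. C \<subseteq> D)" if "C \<in> comps_nbh G X' Y" for C
        proof -
          have "C \<in> comps G X'" "C \<in> comps G X" using that r(1) comps_nbh_subset by blast+
          then show ?thesis
            using \<open>\<A> \<subseteq> comps G X\<close> comps_coarser_unique[OF XX', of C C] by blast
        qed
        then show ?thesis by (auto simp: comps_inside_def comps_nbh_eq)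
      qed
      moreover have "bond G X' X f = crit_filter G X Y" using 2 True by (simp add: bond_crit)
      moreover have "comps_inside G X' \<A> \<subseteq> comps G X'" by (auto simp: comps_inside_def)
      moreover have "crit_filter G X Y \<in> filters_at G X" using Y by (simp add: filters_at_def)
      ultimately show ?thesis using 2(2) by (auto simp: crit_filter_eq[of _ Y])
    next
      case False
      define C where "C = (THE C. C \<in> comps G X \<and> \<Union>(comps_nbh G X' Y) \<subseteq> C)"
      have C: "C \<in> comps G X" "\<Union>(comps_nbh G X' Y) \<subseteq> C"
        unfolding C_def using theI'[OF crit_comp_ex1[OF XX' 2(1) False]] by auto
      have "C \<in> \<A> \<longleftrightarrow> finite (comps_nbh G X' Y - comps_inside G X' \<A>)" if A: "\<A> \<subseteq> comps G X"
      proof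
        assume "C \<in> \<A>"
        then have e: "comps_nbh G X' Y - comps_inside G X' \<A> = {}"
          using C by (auto simp: comps_inside_def comps_nbh_eq)
        show "finite (comps_nbh G X' Y - comps_inside G X' \<A>)" unfolding e by simp
      next
        assume "finite (comps_nbh G X' Y - comps_inside G X' \<A>)"
        \<comment> \<open>An infinite class minus the preimage of \<open>\<A>\<close> can be finite
          only if some member of the class lies in the preimage; one such member already identifies
          \<open>C\<close> as an element of \<open>\<A>\<close>.\<close>
        then have "comps_nbh G X' Y \<inter> comps_inside G X' \<A> \<noteq> {}"
          using 2 by (auto simp: crit_def Diff_triv)
        then obtain C' D where "C' \<in> comps_nbh G X' Y" "D \<in> \<A>" "C' \<subseteq> D"
          by (auto simp: comps_inside_def)
        moreover have "C' \<in> comps G X'" using \<open>C' \<in> comps_nbh G X' Y\<close> by (simp add: comps_nbh_eq)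
        ultimately have "D = C" using C A comps_coarser_unique[OF XX'] by blast
        then show "C \<in> \<A>" using \<open>D \<in> \<A>\<close> by simp
      qed
      moreover have "bond G X' X f = princ_filter G X C"
        using 2 False by (simp add: bond_crit C_def)
      moreover have "comps_inside G X' \<A> \<subseteq> comps G X'" by (auto simp: comps_inside_def)
      ultimately show ?thesis using 2(2) C(1)
        by (auto simp: crit_filter_eq[of _ Y] princ_filter_def filters_at_def)
    qed
  qed
  then show "bond G X' X f \<in> filters_at G X"
    "\<A> \<in> bond G X' X f \<longleftrightarrow> \<A> \<subseteq> comps G X \<and> comps_inside G X' \<A> \<in> f" by auto
qed

subsection \<open>The inverse limit\<close>

lemma finite_vsets_iff: "X \<in> \<X> \<longleftrightarrow> finite X \<and> X \<subseteq> V"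
  by (simp add: finite_vsets_def)

lemma filter_lim_at: "F \<in> filter_lim G \<Longrightarrow> X \<in> \<X> \<Longrightarrow> F X \<in> filters_at G X"
  by (auto simp: filter_lim_def)

lemma filter_lim_refine:
  assumes "F \<in> filter_lim G" "X \<in> \<X>" "X' \<in> \<X>" "X \<subseteq> X'"
  shows "\<A> \<in> F X \<longleftrightarrow> \<A> \<subseteq> comps G X \<and> comps_inside G X' \<A> \<in> F X'"
proof -
  have "bond G X' X (F X') = F X" using assms by (auto simp: filter_lim_def)
  then show ?thesis
    using bond_pushforward(2)[OF assms(4) _ filter_lim_at[OF assms(1,3)], of \<A>] assms(3)
    by (simp add: finite_vsets_iff)
qed

lemma filter_lim_eqI:
  assumes "F \<in> filter_lim G" "F' \<in> filter_lim G" "\<And>X. X \<in> \<X> \<Longrightarrow> F X = F' X"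
  shows "F = F'"
  using assms by (auto simp: filter_lim_def intro: PiE_ext)

lemma ultrafilter_filter_ex1:
  assumes uf: "ultrafilter U"
    and X: "finite X" "V - X \<in> U"
  shows "\<exists>!f. f \<in> filters_at G X \<and> (\<forall>\<A>\<in>f. \<Union>\<A> \<in> U)"
proof -
  note U = ultrafilterD[OF uf]
  have "\<exists>f. f \<in> filters_at G X \<and> (\<forall>\<A>\<in>f. \<Union>\<A> \<in> U)"
  proof (cases "\<exists>C\<in>comps G X. C \<in> U")
    case True
    then obtain C where C: "C \<in> comps G X" "C \<in> U" by blast
    then have "\<forall>\<A>\<in>princ_filter G X C. \<Union>\<A> \<in> U"
      using U(4)[OF C(2)] by (simp add: princ_filter_def Sup_upper)
    then show ?thesis using C by (auto simp: filters_at_def)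
  next
    case False
    have "\<Union>((\<lambda>Y. \<Union>(comps_nbh G X Y)) ` Pow X) \<in> U"
    proof (rule U(4)[OF X(2)], rule subsetI)
      fix v assume "v \<in> V - X"
      then obtain C where C: "C \<in> comps G X" "v \<in> C" using comps_cover by blast
      then show "v \<in> \<Union>((\<lambda>Y. \<Union>(comps_nbh G X Y)) ` Pow X)"
        using nbh_comps[OF C(1)] by (auto simp: comps_nbh_eq)
    qed
    then obtain Y where Y: "Y \<subseteq> X" "\<Union>(comps_nbh G X Y) \<in> U"
      using ultrafilter_finite_Union[OF uf, of "(\<lambda>Y. \<Union>(comps_nbh G X Y)) ` Pow X"] X(1) by auto
    \<comment> \<open>No single component belongs to \<open>U\<close>, so no finite union of
      components does. The class of \<open>Y\<close> must therefore be infinite, and discarding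
      finitely many of its members keeps its union in \<open>U\<close>.\<close>
    have fin: "\<Union>\<D> \<notin> U" if "finite \<D>" "\<D> \<subseteq> comps G X" for \<D>
      using ultrafilter_finite_Union[OF uf that(1)] that(2) False by blast
    then have Yc: "Y \<in> crit G X" using Y comps_nbh_subset by (auto simp: crit_def)
    moreover have "\<Union>\<A> \<in> U" if "\<A> \<in> crit_filter G X Y" for \<A>
    proof -
      have "- \<Union>(comps_nbh G X Y - \<A>) \<in> U"
        using fin[of "comps_nbh G X Y - \<A>"] that comps_nbh_subset U(3) by (auto simp: crit_filter_eq)
      then have "- \<Union>(comps_nbh G X Y - \<A>) \<inter> \<Union>(comps_nbh G X Y) \<in> U" using U(2) Y(2) by blast
      then show ?thesis by (rule U(4)) blast
    qed
    ultimately show ?thesis by (auto simp: filters_at_def)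
  qed
  moreover have "f = f'" if f: "f \<in> filters_at G X" "\<forall>\<A>\<in>f. \<Union>\<A> \<in> U"
    and f': "f' \<in> filters_at G X" "\<forall>\<A>\<in>f'. \<Union>\<A> \<in> U" for f f'
  proof (rule ccontr)
    assume "f \<noteq> f'"
    then obtain \<C> where \<C>: "basic_at G X \<C>" "\<C> \<in> f" "\<C> \<notin> f'"
      using filters_at_distinct[OF f(1) f'(1)] by metis
    then obtain \<D> where \<D>: "basic_at G X \<D>" "\<D> \<in> f'" "\<C> \<inter> \<D> = {}"
      using filters_at_separate[OF f'(1)] by metis
    have "\<Union>\<C> \<inter> \<Union>\<D> = {}"
      using \<D>(3) basic_at_subset[OF \<C>(1)] basic_at_subset[OF \<D>(1)] comps_unique by blast
    moreover have "\<Union>\<C> \<inter> \<Union>\<D> \<in> U" using U(2) f f' \<C> \<D> by blast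
    ultimately show False using U(1) by simp
  qed
  ultimately show ?thesis by blast
qed

text \<open>Each coordinate is the only filter whose families all have their unions in
  \<open>U\<close>. The image of the coordinate at \<open>X'\<close> under \<open>bond\<close> has
  this property at \<open>X\<close>, so the coordinates are compatible.\<close>

lemma ultrafilter_limit:
  assumes uf: "ultrafilter U"
    and X: "\<And>X. X \<in> \<X> \<Longrightarrow> V - X \<in> U"
  shows "\<exists>F\<in>filter_lim G. \<forall>X\<in>\<X>. \<forall>\<A>\<in>F X. \<Union>\<A> \<in> U"
proof -
  note U = ultrafilterD[OF uf]
  define F where "F = (\<lambda>X\<in>\<X>. THE f. f \<in> filters_at G X \<and> (\<forall>\<A>\<in>f. \<Union>\<A> \<in> U))"
  have ex1: "\<exists>!f. f \<in> filters_at G X \<and> (\<forall>\<A>\<in>f. \<Union>\<A> \<in> U)" if "X \<in> \<X>" for X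
    by (rule ultrafilter_filter_ex1[OF uf]) (use X that in \<open>auto simp: finite_vsets_iff\<close>)
  have F: "F X \<in> filters_at G X \<and> (\<forall>\<A>\<in>F X. \<Union>\<A> \<in> U)" if "X \<in> \<X>" for X
    using theI'[OF ex1[OF that]] that by (simp add: F_def)
  have "bond G X' X (F X') = F X" if "X \<in> \<X>" "X' \<in> \<X>" "X \<subseteq> X'" for X X'
  proof -
    have fin: "finite X'" using that by (simp add: finite_vsets_iff)
    note b = bond_pushforward[OF that(3) fin, of "F X'"]
    have "\<Union>\<A> \<in> U" if "\<A> \<in> bond G X' X (F X')" for \<A>
    proof -
      have "\<Union>(comps_inside G X' \<A>) \<in> U" using b(2)[of \<A>] F \<open>X' \<in> \<X>\<close> that by blast
      then show ?thesis by (rule U(4)) (auto simp: comps_inside_def)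
    qed
    then have "bond G X' X (F X') \<in> filters_at G X \<and> (\<forall>\<A>\<in>bond G X' X (F X'). \<Union>\<A> \<in> U)"
      using b(1) F[OF that(2)] by simp
    then have "(THE f. f \<in> filters_at G X \<and> (\<forall>\<A>\<in>f. \<Union>\<A> \<in> U)) = bond G X' X (F X')"
      by (rule the1_equality[OF ex1[OF that(1)]])
    then show ?thesis using that(1) by (simp add: F_def[THEN fun_cong, of X])
  qed
  moreover have "F \<in> Pi\<^sub>E \<X> (filters_at G)"
    using F by (intro PiE_I) (simp_all add: F_def)
  ultimately have "F \<in> filter_lim G" by (simp add: filter_lim_def)
  then show ?thesis using F by blast
qed

lemma filter_lim_finite_cover:
  assumes "\<And>F. F \<in> filter_lim G \<Longrightarrow> \<exists>(X, \<C>)\<in>\<S>. X \<in> \<X> \<and> \<C> \<in> F X"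
  shows "\<exists>\<T> X. finite \<T> \<and> \<T> \<subseteq> \<S> \<and> X \<in> \<X> \<and> V \<subseteq> X \<union> (\<Union>(Y, \<C>)\<in>\<T>. \<Union>\<C>)"
proof (rule ccontr)
  assume neg0: "\<not> ?thesis"
  have neg: "\<not> V \<subseteq> X \<union> (\<Union>(Y, \<C>)\<in>\<T>. \<Union>\<C>)" if "finite \<T>" "\<T> \<subseteq> \<S>" "X \<in> \<X>" for X \<T>
    by (rule notI, rule notE[OF neg0], intro exI[of _ \<T>] exI[of _ X] conjI) (use that in simp_all)
  \<comment> \<open>These sets make the ultrafilter contain every cofinite set of vertices and avoid
    every family of the cover. A finite subfamily with empty intersection would be precisely a
    finite cover of the kind excluded by \<open>neg\<close>.\<close>
  let ?f = "\<lambda>X. V - X" and ?g = "\<lambda>(Y::'v set, \<C>). - (\<Union>\<C> :: 'v set)"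
  have "fin_inter (?f ` \<X> \<union> ?g ` \<S>)"
    unfolding fin_inter_def
  proof (intro allI impI)
    fix F assume F: "finite F \<and> F \<subseteq> ?f ` \<X> \<union> ?g ` \<S>"
    then have h: "finite (F \<inter> ?f ` \<X>)" "F \<inter> ?f ` \<X> \<subseteq> ?f ` \<X>"
      "finite (F \<inter> ?g ` \<S>)" "F \<inter> ?g ` \<S> \<subseteq> ?g ` \<S>" by auto
    obtain A where A: "A \<subseteq> \<X>" "finite A" "F \<inter> ?f ` \<X> = ?f ` A"
      using finite_subset_image[OF h(1,2)] by (elim exE conjE) (rule that)
    obtain T where T: "T \<subseteq> \<S>" "finite T" "F \<inter> ?g ` \<S> = ?g ` T"
      using finite_subset_image[OF h(3,4)] by (elim exE conjE) (rule that)
    have "\<Union>A \<in> \<X>" using A(1,2) by (auto simp: finite_vsets_def)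
    then obtain v where v: "v \<in> V" "v \<notin> \<Union>A \<union> (\<Union>(Y, \<C>)\<in>T. \<Union>\<C>)"
      using neg[OF T(2,1), of "\<Union>A"] by (meson subsetI)
    have "F = (F \<inter> ?f ` \<X>) \<union> (F \<inter> ?g ` \<S>)"
      using F by (simp only: Int_Un_distrib[symmetric] Int_absorb2)
    then have "F = ?f ` A \<union> ?g ` T" by (simp only: A(3) T(3))
    then have "v \<in> \<Inter>F" using v by auto
    then show "\<Inter>F \<noteq> {}" by blast
  qed
  from ultrafilter_exists[OF this]
  obtain U where uf: "ultrafilter U" and U: "?f ` \<X> \<union> ?g ` \<S> \<subseteq> U" by (elim exE conjE)
  have VX: "V - X \<in> U" if "X \<in> \<X>" for X using U that by blast
  obtain F where F: "F \<in> filter_lim G" "\<forall>X\<in>\<X>. \<forall>\<A>\<in>F X. \<Union>\<A> \<in> U"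
    using ultrafilter_limit[OF uf VX] by blast
  obtain X \<C> where X: "(X, \<C>) \<in> \<S>" "X \<in> \<X>" "\<C> \<in> F X" using assms[OF F(1)] by blast
  have "?g (X, \<C>) \<in> U" using U X(1) by blast
  moreover have "\<Union>\<C> \<in> U" using F(2) X by blast
  ultimately have "\<Union>\<C> \<inter> - \<Union>\<C> \<in> U" by (intro ultrafilterD(2)[OF uf]) simp_all
  then show False using ultrafilterD(1)[OF uf] by simp
qed

subsection \<open>Ends\<close>

text \<open>A ray is injective and so visits \<open>X\<close> only finitely often; after its last
  visit its edges keep it in one component.\<close>

lemma ray_has_tail:
  assumes r: "r \<in> rays G" and X: "finite X"
  obtains C where "C \<in> comps G X" "has_tail_in r C"
proof -
  have r': "inj r" "\<And>n. r n \<in> V" "\<And>n. {r n, r (Suc n)} \<in> E" using r by (auto simp: rays_def)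
  have "finite (r -` X)" using X r'(1) by (simp add: finite_vimageI)
  then obtain N where N: "\<And>n. r n \<in> X \<Longrightarrow> n < N"
    by (meson finite_nat_set_iff_bounded vimageI)
  obtain C where C: "C \<in> comps G X" "r N \<in> C" using comps_cover[of "r N" X] r'(2) N by blast
  have "r n \<in> C" if "N \<le> n" for n
    using that
  proof (induction rule: dec_induct)
    case base then show ?case using C by simp
  next
    case (step n)
    then show ?case using comps_edge[OF C(1) step.IH r'(3)] N[of "Suc n"] by auto
  qed
  then show ?thesis using that C by (auto simp: has_tail_in_def)
qed

lemma tail_comp_unique:
  assumes "has_tail_in r C" "has_tail_in r D" "C \<in> comps G X" "D \<in> comps G X"
  shows "C = D"
proof -
  obtain m n where "r ` {m..} \<subseteq> C" "r ` {n..} \<subseteq> D" using assms by (auto simp: has_tail_in_def)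
  then have "r (max m n) \<in> C" "r (max m n) \<in> D" by auto
  then show ?thesis using comps_unique assms by blast
qed

lemma equiv_ray_equiv: "equiv (rays G) (ray_equiv G)"
proof (rule equivI)
  show "ray_equiv G \<subseteq> rays G \<times> rays G" by (auto simp: ray_equiv_def)
  show "refl_on (rays G) (ray_equiv G)"
    using ray_has_tail by (auto simp: refl_on_def ray_equiv_def finite_vsets_iff) metis
  show "sym (ray_equiv G)" by (auto simp: sym_def ray_equiv_def)
  show "trans (ray_equiv G)"
    using tail_comp_unique unfolding trans_def ray_equiv_def by blast
qed

lemma end_obtain_ray:
  assumes "\<omega> \<in> ends G"
  obtains r where "r \<in> \<omega>" "r \<in> rays G" "\<omega> = ray_equiv G `` {r}"
  using assms equiv_class_self[OF equiv_ray_equiv] by (auto simp: ends_def quotient_def)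

lemma end_comp_ex1:
  assumes "\<omega> \<in> ends G" "X \<in> \<X>"
  shows "\<exists>!C. C \<in> comps G X \<and> (\<forall>r\<in>\<omega>. has_tail_in r C)"
proof -
  obtain r where r: "r \<in> \<omega>" "r \<in> rays G" "\<omega> = ray_equiv G `` {r}" using end_obtain_ray[OF assms(1)] .
  obtain C where C: "C \<in> comps G X" "has_tail_in r C"
    using ray_has_tail[OF r(2)] assms(2) by (auto simp: finite_vsets_iff)
  have "has_tail_in s C" if "s \<in> \<omega>" for s
  proof -
    have "(r, s) \<in> ray_equiv G" using that r(3) by blast
    then obtain D where "D \<in> comps G X" "has_tail_in r D" "has_tail_in s D"
      using assms(2) by (auto simp: ray_equiv_def)
    then show ?thesis using tail_comp_unique C by blast
  qed
  then show ?thesis using C tail_comp_unique r(1) by blast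
qed

lemma end_comp:
  assumes "\<omega> \<in> ends G" "X \<in> \<X>"
  shows "end_comp G X \<omega> \<in> comps G X" "r \<in> \<omega> \<Longrightarrow> has_tail_in r (end_comp G X \<omega>)"
  using theI'[OF end_comp_ex1[OF assms]] by (auto simp: end_comp_def)

lemma end_comp_mono:
  assumes "\<omega> \<in> ends G" "X \<in> \<X>" "X' \<in> \<X>" "X \<subseteq> X'"
  shows "end_comp G X' \<omega> \<subseteq> end_comp G X \<omega>"
proof -
  obtain r where r: "r \<in> \<omega>" using end_obtain_ray[OF assms(1)] by metis
  obtain C where C: "C \<in> comps G X" "end_comp G X' \<omega> \<subseteq> C"
    using comps_coarser_ex1[OF assms(4) end_comp(1)[OF assms(1,3)]] by blast
  then have "has_tail_in r C" using end_comp(2)[OF assms(1,3) r] by (auto simp: has_tail_in_def)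
  then have "C = end_comp G X \<omega>"
    using tail_comp_unique[OF _ end_comp(2)[OF assms(1,2) r]] C end_comp(1)[OF assms(1,2)] by blast
  then show ?thesis using C by simp
qed

lemma end_pt_apply: "X \<in> \<X> \<Longrightarrow> end_pt G \<omega> X = princ_filter G X (end_comp G X \<omega>)"
  by (simp add: end_pt_def)

lemma end_pt_in_filter_lim:
  assumes "\<omega> \<in> ends G"
  shows "end_pt G \<omega> \<in> filter_lim G"
proof -
  have "bond G X' X (princ_filter G X' (end_comp G X' \<omega>)) = princ_filter G X (end_comp G X \<omega>)"
    if "X \<in> \<X>" "X' \<in> \<X>" "X \<subseteq> X'" for X X'
  proof -
    note c' = end_comp(1)[OF assms that(2)] and c = end_comp(1)[OF assms that(1)]
    have "comp_proj G X' X (end_comp G X' \<omega>) = end_comp G X \<omega>"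
      using comps_coarser_unique[OF that(3) c'] comp_proj[OF that(3) c'] c end_comp_mono[OF assms that]
      by blast
    then show ?thesis using bond_princ[OF c'] by simp
  qed
  then show ?thesis
    using end_comp(1)[OF assms] by (auto simp: filter_lim_def end_pt_def filters_at_def)
qed

lemma end_pt_mem:
  assumes "\<omega> \<in> ends G" "X \<in> \<X>" "\<A> \<subseteq> comps G X"
  shows "\<A> \<in> end_pt G \<omega> X \<longleftrightarrow> end_comp G X \<omega> \<in> \<A>"
  using assms by (simp add: end_pt_apply princ_filter_def)

lemma end_eqI:
  assumes "\<omega> \<in> ends G" "\<omega>' \<in> ends G" "\<And>X. X \<in> \<X> \<Longrightarrow> end_comp G X \<omega> = end_comp G X \<omega>'"
  shows "\<omega> = \<omega>'"
proof -
  obtain r where r: "r \<in> \<omega>" "r \<in> rays G" "\<omega> = ray_equiv G `` {r}" using end_obtain_ray[OF assms(1)] .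
  obtain s where s: "s \<in> \<omega>'" "s \<in> rays G" "\<omega>' = ray_equiv G `` {s}" using end_obtain_ray[OF assms(2)] .
  have "\<exists>C\<in>comps G X. has_tail_in r C \<and> has_tail_in s C" if "X \<in> \<X>" for X
    using end_comp[OF assms(1) that] end_comp(2)[OF assms(2) that] r(1) s(1) assms(3)[OF that] by metis
  then have "(r, s) \<in> ray_equiv G" using r(2) s(2) by (simp add: ray_equiv_def)
  then show ?thesis using r s equiv_class_eq[OF equiv_ray_equiv] by blast
qed

lemma inj_on_end_pt: "inj_on (end_pt G) (ends G)"
proof (rule inj_onI)
  fix \<omega> \<omega>' assume w: "\<omega> \<in> ends G" "\<omega>' \<in> ends G" and eq: "end_pt G \<omega> = end_pt G \<omega>'"
  show "\<omega> = \<omega>'"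
  proof (rule end_eqI[OF w])
    fix X assume X: "X \<in> \<X>"
    then have "princ_filter G X (end_comp G X \<omega>) = princ_filter G X (end_comp G X \<omega>')"
      using eq end_pt_apply by metis
    then show "end_comp G X \<omega> = end_comp G X \<omega>'" using princ_filter_inj end_comp(1)[OF w(1) X] by blast
  qed
qed

end

section \<open>The 1-complex\<close>

lemma vertex_pt_inj: "vertex_pt u = vertex_pt v \<longleftrightarrow> u = v"
  by (metis vertex_pt_def zero_neq_one)

lemma edge_pt_0: "u \<noteq> v \<Longrightarrow> edge_pt u v 0 = vertex_pt u"
  by (auto simp: edge_pt_def vertex_pt_def)

lemma edge_pt_1: "u \<noteq> v \<Longrightarrow> edge_pt u v 1 = vertex_pt v"
  by (auto simp: edge_pt_def vertex_pt_def fun_eq_iff)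

lemma edge_pt_swap: "u \<noteq> v \<Longrightarrow> edge_pt v u t = edge_pt u v (1 - t)"
  by (auto simp: edge_pt_def fun_eq_iff)

lemma edge_pt_eq_vertex_pt:
  assumes "u \<noteq> v"
  shows "edge_pt u v t = vertex_pt w \<longleftrightarrow> u = w \<and> t = 0 \<or> v = w \<and> t = 1"
proof
  assume eq: "edge_pt u v t = vertex_pt w"
  show "u = w \<and> t = 0 \<or> v = w \<and> t = 1"
    using fun_cong[OF eq, of u] fun_cong[OF eq, of v] assms
    by (auto simp: edge_pt_def vertex_pt_def split: if_splits)
next
  assume "u = w \<and> t = 0 \<or> v = w \<and> t = 1"
  then show "edge_pt u v t = vertex_pt w" using assms edge_pt_0 edge_pt_1 by metis
qed

lemma edge_pt_eq_inner:
  assumes "u \<noteq> v" "u' \<noteq> v'" "0 < t" "t < 1"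
  shows "edge_pt u v t = edge_pt u' v' t' \<longleftrightarrow>
    u' = u \<and> v' = v \<and> t' = t \<or> u' = v \<and> v' = u \<and> t' = 1 - t"
proof
  assume eq: "edge_pt u v t = edge_pt u' v' t'"
  \<comment> \<open>At an inner point the coordinates of both ends are nonzero, so the support of
    the point recovers the edge.\<close>
  have "u = u' \<or> u = v'" "v = u' \<or> v = v'"
    using fun_cong[OF eq, of u] fun_cong[OF eq, of v] assms
    by (auto simp: edge_pt_def split: if_splits)
  then show "u' = u \<and> v' = v \<and> t' = t \<or> u' = v \<and> v' = u \<and> t' = 1 - t"
    using fun_cong[OF eq, of u] fun_cong[OF eq, of v] assms
    by (auto simp: edge_pt_def split: if_splits)
next
  assume "u' = u \<and> v' = v \<and> t' = t \<or> u' = v \<and> v' = u \<and> t' = 1 - t"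
  then show "edge_pt u v t = edge_pt u' v' t'" using edge_pt_swap[of u v] assms by auto
qed

definition points :: "'v graph \<Rightarrow> 'v pt set" where
  "points G = vertex_pt ` verts G \<union> inner_pts (edges G)"

text \<open>Incident edges are taken with their full interior. This single operation describes the
  graph part of all basic sets in \<open>VG\<close> and \<open>FG\<close>, is monotone, and commutes
  with unions, which the combination of \<open>induced_pts\<close> and
  \<open>inner_pts_between\<close> does not show.\<close>

definition ostar :: "'v graph \<Rightarrow> 'v set \<Rightarrow> 'v pt set" where
  "ostar G A = vertex_pt ` A \<union> inner_pts {e \<in> edges G. e \<inter> A \<noteq> {}}"

context sgraph
begin

abbreviation "T \<equiv> complex_top G"

lemma inner_pts_iff:
  assumes "F \<subseteq> E" "{u, v} \<in> E"
  shows "edge_pt u v t \<in> inner_pts F \<longleftrightarrow> {u, v} \<in> F \<and> 0 < t \<and> t < 1"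
proof
  assume "edge_pt u v t \<in> inner_pts F"
  then obtain u' v' t' where eq: "edge_pt u' v' t' = edge_pt u v t" and F: "{u', v'} \<in> F" "0 < t'" "t' < 1"
    by (auto simp: inner_pts_def)
  have "u \<noteq> v" "u' \<noteq> v'" using assms edge_verts F by blast+
  then show "{u, v} \<in> F \<and> 0 < t \<and> t < 1"
    using eq F by (auto simp: edge_pt_eq_inner insert_commute)
qed (auto simp: inner_pts_def)

lemma inner_pts_mono: "F \<subseteq> F' \<Longrightarrow> inner_pts F \<subseteq> inner_pts F'"
  by (auto simp: inner_pts_def)

lemma vertex_pt_not_inner:
  assumes "F \<subseteq> E"
  shows "vertex_pt w \<notin> inner_pts F"
proof
  assume "vertex_pt w \<in> inner_pts F"
  then obtain u v t where "edge_pt u v t = vertex_pt w" and F: "{u, v} \<in> F" "0 < t" "t < 1"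
    by (auto simp: inner_pts_def)
  moreover have "u \<noteq> v" using assms F edge_verts by blast
  ultimately show False by (auto simp: edge_pt_eq_vertex_pt)
qed

lemma points_cases:
  assumes "p \<in> points G"
  obtains v where "v \<in> V" "p = vertex_pt v"
  | u v t where "{u, v} \<in> E" "0 < t" "t < 1" "p = edge_pt u v t"
  using assms by (auto simp: points_def inner_pts_def)

lemma vertex_in_points: "vertex_pt v \<in> points G \<longleftrightarrow> v \<in> V"
  using vertex_pt_not_inner[of E] by (auto simp: points_def vertex_pt_inj)

lemma edge_pt_vertex_image:
  assumes "{u, v} \<in> E"
  shows "edge_pt u v t \<in> vertex_pt ` A \<longleftrightarrow> u \<in> A \<and> t = 0 \<or> v \<in> A \<and> t = 1"
  using edge_pt_eq_vertex_pt[OF edge_verts(3)[OF assms]] by (auto simp: image_iff)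

lemma edge_in_points: "{u, v} \<in> E \<Longrightarrow> 0 \<le> t \<Longrightarrow> t \<le> 1 \<Longrightarrow> edge_pt u v t \<in> points G"
proof -
  assume uv: "{u, v} \<in> E" and t: "0 \<le> t" "t \<le> 1"
  from t consider "t = 0" | "t = 1" | "0 < t" "t < 1" by linarith
  then show ?thesis
  proof cases
    case 3
    then show ?thesis using inner_pts_iff[OF subset_refl uv] uv by (simp add: points_def)
  qed (simp_all add: edge_pt_0 edge_pt_1 edge_verts[OF uv] vertex_in_points)
qed

section \<open>Open sets of the 1-complex\<close>

lemma star_eq:
  "insert (vertex_pt u) (\<Union>v\<in>{v. {u, v} \<in> E}. edge_pt u v ` {0..<j v}) =
   insert (vertex_pt u) {edge_pt u v t | v t. {u, v} \<in> E \<and> 0 \<le> t \<and> t < j v}"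
proof -
  have "(\<Union>v\<in>{v. {u, v} \<in> E}. edge_pt u v ` {0..<j v}) =
     {edge_pt u v t | v t. {u, v} \<in> E \<and> 0 \<le> t \<and> t < j v}"
    (is "?L = ?R")
  proof
    show "?L \<subseteq> ?R"
      by (rule subsetI, elim UN_E imageE, rule CollectI) (rule exI, rule exI, auto intro: refl)
    show "?R \<subseteq> ?L" by auto
  qed
  then show ?thesis by (rule arg_cong)
qed

lemma basis_cases:
  assumes "B \<in> complex_basis G"
  obtains (edge) u v a b where "B = edge_pt u v ` {a<..<b}" "{u, v} \<in> E" "0 \<le> a" "a < b" "b \<le> 1"
  | (star) u j where "B = insert (vertex_pt u) {edge_pt u v t | v t. {u, v} \<in> E \<and> 0 \<le> t \<and> t < j v}"
    "u \<in> V" "\<And>v. {u, v} \<in> E \<Longrightarrow> 0 < j v \<and> j v < 1"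
  using assms unfolding complex_basis_def star_eq by blast

lemma edge_in_star_iff:
  assumes uv: "{u, v} \<in> E" and t: "0 \<le> t" "t \<le> 1" and j: "\<And>v. {w, v} \<in> E \<Longrightarrow> 0 < j v \<and> j v < 1"
  shows "edge_pt u v t \<in> insert (vertex_pt w) {edge_pt w v t | v t. {w, v} \<in> E \<and> 0 \<le> t \<and> t < j v} \<longleftrightarrow>
    u = w \<and> t < j v \<or> v = w \<and> 1 - t < j u"
proof -
  have ne: "u \<noteq> v" using edge_verts uv by blast
  have vu: "{v, u} \<in> E" using uv by (simp add: insert_commute)
  show ?thesis
  proof
    assume "edge_pt u v t \<in> insert (vertex_pt w) {edge_pt w v t | v t. {w, v} \<in> E \<and> 0 \<le> t \<and> t < j v}"
    then consider "edge_pt u v t = vertex_pt w"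
      | v' s where "edge_pt u v t = edge_pt w v' s" "{w, v'} \<in> E" "0 \<le> s" "s < j v'" by blast
    then show "u = w \<and> t < j v \<or> v = w \<and> 1 - t < j u"
    proof cases
      case 1
      then show ?thesis using ne j[of v] j[of u] uv vu by (auto simp: edge_pt_eq_vertex_pt)
    next
      case (2 v' s)
      have ne': "w \<noteq> v'" using edge_verts 2 by blast
      show ?thesis
      proof (cases "s = 0")
        case True
        then have "edge_pt u v t = vertex_pt w" using 2 ne' by (simp add: edge_pt_0)
        then show ?thesis using ne j[of v] j[of u] uv vu by (auto simp: edge_pt_eq_vertex_pt)
      next
        case False
        then have "edge_pt w v' s = edge_pt u v t" "0 < s" "s < 1" using 2 j[of v'] by auto
        then show ?thesis using edge_pt_eq_inner[OF ne' ne, of s t] 2 by auto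
      qed
    qed
  next
    assume "u = w \<and> t < j v \<or> v = w \<and> 1 - t < j u"
    then show "edge_pt u v t \<in> insert (vertex_pt w) {edge_pt w v t | v t. {w, v} \<in> E \<and> 0 \<le> t \<and> t < j v}"
      using uv vu t edge_pt_swap[of v u] ne by force
  qed
qed

text \<open>The radii supplied for the various edges at a vertex need not have a positive lower
  bound. They need none, because the function \<open>j\<close> of a basic star is chosen
  independently on each edge.\<close>

lemma complex_basis_nbhd:
  assumes "U \<subseteq> points G"
    and eps: "\<And>u v t. {u, v} \<in> E \<Longrightarrow> 0 \<le> t \<Longrightarrow> t \<le> 1 \<Longrightarrow> edge_pt u v t \<in> U \<Longrightarrow>
       \<exists>e>0. \<forall>s. 0 \<le> s \<longrightarrow> s \<le> 1 \<longrightarrow> \<bar>s - t\<bar> < e \<longrightarrow> edge_pt u v s \<in> U"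
    and pU: "p \<in> U"
  shows "\<exists>B\<in>complex_basis G. p \<in> B \<and> B \<subseteq> U"
proof -
  have "p \<in> points G" using assms(1) pU by blast
  then show ?thesis
  proof (cases rule: points_cases)
    case (1 w)
    have "\<exists>e. {w, v} \<in> E \<longrightarrow> 0 < e \<and> e < 1 \<and> (\<forall>s. 0 \<le> s \<longrightarrow> s < e \<longrightarrow> edge_pt w v s \<in> U)" for v
    proof (cases "{w, v} \<in> E")
      case True
      then have "edge_pt w v 0 \<in> U" using 1 pU edge_pt_0 edge_verts by metis
      then obtain e where "e > 0" "\<forall>s. 0 \<le> s \<longrightarrow> s \<le> 1 \<longrightarrow> \<bar>s - 0\<bar> < e \<longrightarrow> edge_pt w v s \<in> U"
        using eps[OF True, of 0] by auto
      \<comment> \<open>Any cap strictly between 0 and 1 would serve; it ensures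
        \<open>j v < 1\<close> as \<open>complex_basis\<close> requires.\<close>
      then show ?thesis by (intro exI[of _ "min e (1/2)"]) auto
    qed auto
    then obtain j where j: "\<And>v. {w, v} \<in> E \<Longrightarrow> 0 < j v \<and> j v < 1 \<and> (\<forall>s. 0 \<le> s \<longrightarrow> s < j v \<longrightarrow> edge_pt w v s \<in> U)"
      by metis
    let ?B = "insert (vertex_pt w) (\<Union>v\<in>{v. {w, v} \<in> E}. edge_pt w v ` {0..<j v})"
    have "?B \<in> complex_basis G"
      unfolding complex_basis_def
      by (intro UnI2 CollectI exI[of _ w] exI[of _ j] conjI refl) (use 1(1) j in blast)+
    moreover have "?B \<subseteq> U" using pU 1 j by auto
    ultimately show ?thesis using 1 by blast
  next
    case (2 u v t)
    then obtain e where e: "e > 0" "\<forall>s. 0 \<le> s \<longrightarrow> s \<le> 1 \<longrightarrow> \<bar>s - t\<bar> < e \<longrightarrow> edge_pt u v s \<in> U"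
      using eps[of u v t] pU by auto
    \<comment> \<open>The interval around \<open>t\<close> is clipped to the unit interval; it still
      contains \<open>t\<close>, which is an inner parameter.\<close>
    let ?a = "max 0 (t - e)" and ?b = "min 1 (t + e)"
    have "edge_pt u v ` {?a<..<?b} \<in> complex_basis G"
      using 2 e(1) unfolding complex_basis_def
      by (intro UnI1 CollectI exI[of _ u] exI[of _ v] exI[of _ ?a] exI[of _ ?b]) auto
    moreover have "p \<in> edge_pt u v ` {?a<..<?b}" using 2 e(1) by auto
    moreover have "edge_pt u v ` {?a<..<?b} \<subseteq> U" using e(2) by auto
    ultimately show ?thesis by blast
  qed
qed

text \<open>This identifies the topology as the final one for the edge maps: on points of the graph,
  openness is openness of the preimage in every copy of [0,1]. It reduces later openness and
  continuity arguments to intervals.\<close>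

lemma openin_complex_iff:
  "openin T U \<longleftrightarrow> U \<subseteq> points G \<and>
     (\<forall>u v t. {u, v} \<in> E \<longrightarrow> 0 \<le> t \<longrightarrow> t \<le> 1 \<longrightarrow> edge_pt u v t \<in> U \<longrightarrow>
       (\<exists>e>0. \<forall>s. 0 \<le> s \<longrightarrow> s \<le> 1 \<longrightarrow> \<bar>s - t\<bar> < e \<longrightarrow> edge_pt u v s \<in> U))"
    (is "_ \<longleftrightarrow> ?R U")
proof
  assume "openin T U"
  then have "generate_topology_on (complex_basis G) U"
    by (simp add: complex_top_def openin_topology_generated_by_iff)
  then show "?R U"
  proof induction
    case Empty then show ?case by simp
  next
    case (Int U U')
    have "\<exists>e>0. \<forall>s. 0 \<le> s \<longrightarrow> s \<le> 1 \<longrightarrow> \<bar>s - t\<bar> < e \<longrightarrow> edge_pt u v s \<in> U \<inter> U'"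
      if uv: "{u, v} \<in> E" "0 \<le> t" "t \<le> 1" "edge_pt u v t \<in> U \<inter> U'" for u v t
    proof -
      obtain e where "e > 0" "\<forall>s. 0 \<le> s \<longrightarrow> s \<le> 1 \<longrightarrow> \<bar>s - t\<bar> < e \<longrightarrow> edge_pt u v s \<in> U"
        using Int uv by blast
      moreover obtain e' where "e' > 0" "\<forall>s. 0 \<le> s \<longrightarrow> s \<le> 1 \<longrightarrow> \<bar>s - t\<bar> < e' \<longrightarrow> edge_pt u v s \<in> U'"
        using Int uv by blast
      ultimately show ?thesis by (intro exI[of _ "min e e'"]) auto
    qed
    then show ?case using Int.IH by blast
  next
    case (UN K)
    have "\<exists>e>0. \<forall>s. 0 \<le> s \<longrightarrow> s \<le> 1 \<longrightarrow> \<bar>s - t\<bar> < e \<longrightarrow> edge_pt u v s \<in> \<Union>K"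
      if uv: "{u, v} \<in> E" "0 \<le> t" "t \<le> 1" "edge_pt u v t \<in> \<Union>K" for u v t
    proof -
      obtain k where k: "k \<in> K" "edge_pt u v t \<in> k" using uv by blast
      then obtain e where "e > 0" "\<forall>s. 0 \<le> s \<longrightarrow> s \<le> 1 \<longrightarrow> \<bar>s - t\<bar> < e \<longrightarrow> edge_pt u v s \<in> k"
        using UN.IH[OF k(1)] uv by blast
      then show ?thesis using k by blast
    qed
    then show ?case using UN.IH by blast
  next
    case (Basis B)
    from this show ?case
    proof (cases rule: basis_cases)
      case (edge u v a b)
      have ne: "u \<noteq> v" using edge edge_verts by blast
      have "\<exists>e>0. \<forall>s. 0 \<le> s \<longrightarrow> s \<le> 1 \<longrightarrow> \<bar>s - t\<bar> < e \<longrightarrow> edge_pt x y s \<in> B"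
        if xy: "{x, y} \<in> E" "0 \<le> t" "t \<le> 1" "edge_pt x y t \<in> B" for x y t
      proof -
        obtain r where r: "a < r" "r < b" "edge_pt u v r = edge_pt x y t" using xy(4) edge(1) by auto
        have "x \<noteq> y" using xy edge_verts by blast
        \<comment> \<open>A basic interval is written with one orientation of its edge but has to be
          tested along both, with the parameter reversed in the second case.\<close>
        then consider "x = u" "y = v" "t = r" | "x = v" "y = u" "t = 1 - r"
          using edge_pt_eq_inner[OF ne _, of x y r t] r edge by auto
        then show ?thesis
        proof cases
          case 1
          have "edge_pt x y s \<in> B" if "\<bar>s - t\<bar> < min (r - a) (b - r)" for s
            unfolding edge(1) 1(1,2) using that 1(3) by (intro imageI) auto
          then show ?thesis using r by (intro exI[of _ "min (r - a) (b - r)"]) auto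
        next
          case 2
          have "edge_pt x y s \<in> B" if "\<bar>s - t\<bar> < min (r - a) (b - r)" for s
          proof -
            have "edge_pt x y s = edge_pt u v (1 - s)" using 2 ne edge_pt_swap by metis
            then show ?thesis unfolding edge(1) using that 2(3) by (auto intro!: imageI)
          qed
          then show ?thesis using r by (intro exI[of _ "min (r - a) (b - r)"]) auto
        qed
      qed
      moreover have "B \<subseteq> points G" using edge edge_in_points by auto
      ultimately show ?thesis by blast
    next
      case (star w j)
      have "\<exists>e>0. \<forall>s. 0 \<le> s \<longrightarrow> s \<le> 1 \<longrightarrow> \<bar>s - t\<bar> < e \<longrightarrow> edge_pt x y s \<in> B"
        if xy: "{x, y} \<in> E" "0 \<le> t" "t \<le> 1" "edge_pt x y t \<in> B" for x y t
      proof -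
        have iff: "edge_pt x y s \<in> B \<longleftrightarrow> x = w \<and> s < j y \<or> y = w \<and> 1 - s < j x" if "0 \<le> s" "s \<le> 1" for s
          unfolding star(1) by (rule edge_in_star_iff[OF xy(1) that]) (rule star(3))
        consider "x = w" "t < j y" | "y = w" "1 - t < j x" using iff xy by blast
        then show ?thesis
        proof cases
          case 1
          then show ?thesis using iff by (intro exI[of _ "j y - t"]) auto
        next
          case 2
          then show ?thesis using iff by (intro exI[of _ "j x - (1 - t)"]) auto
        qed
      qed
      moreover have "B \<subseteq> points G"
        using star edge_in_points vertex_in_points by (fastforce dest: star(3))
      ultimately show ?thesis by blast
    qed
  qed
next
  assume R: "?R U"
  have "\<exists>B\<in>complex_basis G. p \<in> B \<and> B \<subseteq> U" if "p \<in> U" for p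
    by (rule complex_basis_nbhd) (use R that in blast)+
  then show "openin T U"
    unfolding complex_top_def using openin_subopen topology_generated_by_Basis by metis
qed

lemma openin_complexI:
  assumes "U \<subseteq> points G"
    and "\<And>u v t. {u, v} \<in> E \<Longrightarrow> 0 \<le> t \<Longrightarrow> t \<le> 1 \<Longrightarrow> edge_pt u v t \<in> U \<Longrightarrow>
       \<exists>e>0. \<forall>s. 0 \<le> s \<longrightarrow> s \<le> 1 \<longrightarrow> \<bar>s - t\<bar> < e \<longrightarrow> edge_pt u v s \<in> U"
  shows "openin T U"
  using assms openin_complex_iff by blast

lemma openin_complex_basis:
  assumes "openin T U" "p \<in> U"
  shows "\<exists>B\<in>complex_basis G. p \<in> B \<and> B \<subseteq> U"
  by (rule complex_basis_nbhd) (use assms openin_complex_iff in blast)+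

lemma topspace_complex: "topspace T = points G"
proof -
  have "openin T (points G)"
    by (rule openin_complexI) (use edge_in_points in \<open>auto intro: exI[of _ 1]\<close>)
  moreover have "topspace T \<subseteq> points G" using openin_complex_iff[of "topspace T"] by blast
  ultimately show ?thesis by (simp add: openin_subset subset_antisym)
qed

section \<open>Open stars of vertex sets\<close>

lemma edge_in_ostar_iff:
  assumes "{u, v} \<in> E" "0 \<le> t" "t \<le> 1"
  shows "edge_pt u v t \<in> ostar G A \<longleftrightarrow> u \<in> A \<and> t < 1 \<or> v \<in> A \<and> 0 < t"
  using assms edge_pt_vertex_image[OF assms(1), of t A]
    inner_pts_iff[of "{e \<in> E. e \<inter> A \<noteq> {}}" u v t] by (auto simp: ostar_def)

lemma vertex_in_ostar_iff: "vertex_pt v \<in> ostar G A \<longleftrightarrow> v \<in> A"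
  using vertex_pt_not_inner[of "{e \<in> E. e \<inter> A \<noteq> {}}"] by (auto simp: ostar_def vertex_pt_inj)

lemma ostar_subset_points: "A \<subseteq> V \<Longrightarrow> ostar G A \<subseteq> points G"
  using inner_pts_mono[of "{e \<in> E. e \<inter> A \<noteq> {}}" E] by (auto simp: ostar_def points_def)

lemma ostar_mono: "A \<subseteq> B \<Longrightarrow> ostar G A \<subseteq> ostar G B"
  using inner_pts_mono[of "{e \<in> E. e \<inter> A \<noteq> {}}" "{e \<in> E. e \<inter> B \<noteq> {}}"] by (auto simp: ostar_def)

lemma inner_pts_UN: "inner_pts (\<Union>i\<in>I. F i) = (\<Union>i\<in>I. inner_pts (F i))"
  unfolding inner_pts_def by blast

lemma inner_pts_Un: "inner_pts (F \<union> F') = inner_pts F \<union> inner_pts F'"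
  unfolding inner_pts_def by blast

lemma ostar_Union: "ostar G (\<Union>\<A>) = (\<Union>A\<in>\<A>. ostar G A)"
proof -
  have "{e \<in> E. e \<inter> \<Union>\<A> \<noteq> {}} = (\<Union>A\<in>\<A>. {e \<in> E. e \<inter> A \<noteq> {}})" by blast
  then show ?thesis by (auto simp: ostar_def inner_pts_UN)
qed

lemma openin_ostar:
  assumes "A \<subseteq> V"
  shows "openin T (ostar G A)"
proof (rule openin_complexI)
  show "ostar G A \<subseteq> points G" using assms by (rule ostar_subset_points)
  fix u v t assume uv: "{u, v} \<in> E" "0 \<le> t" "t \<le> (1::real)" "edge_pt u v t \<in> ostar G A"
  then consider "u \<in> A" "t < 1" | "v \<in> A" "0 < t" using edge_in_ostar_iff by blast
  then show "\<exists>e>0. \<forall>s. 0 \<le> s \<longrightarrow> s \<le> 1 \<longrightarrow> \<bar>s - t\<bar> < e \<longrightarrow> edge_pt u v s \<in> ostar G A"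
  proof cases
    case 1 then show ?thesis using uv edge_in_ostar_iff by (intro exI[of _ "1 - t"]) auto
  next
    case 2 then show ?thesis using uv edge_in_ostar_iff by (intro exI[of _ t]) auto
  qed
qed

lemma comp_complex_eq_ostar:
  assumes "\<C> \<subseteq> comps G X"
  shows "(\<Union>C\<in>\<C>. induced_pts G C) \<union> inner_pts_between G X (\<Union>\<C>) = ostar G (\<Union>\<C>)"
proof -
  have "(\<Union>C\<in>\<C>. {e \<in> E. e \<subseteq> C}) \<union> {{a, b} |a b. a \<in> X \<and> b \<in> \<Union>\<C> \<and> {a, b} \<in> E} =
      {e \<in> E. e \<inter> \<Union>\<C> \<noteq> {}}" (is "?L = ?R")
  proof
    have "e \<in> ?R" if "e \<in> E" "e \<subseteq> C" "C \<in> \<C>" for e C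
      using that by (auto elim: edge_obtain)
    moreover have "{a, b} \<in> ?R" if "b \<in> \<Union>\<C>" "{a, b} \<in> E" for a b
      using that by blast
    ultimately show "?L \<subseteq> ?R" by blast
    show "?R \<subseteq> ?L"
    proof
      fix e assume e: "e \<in> ?R"
      then obtain u C where u: "u \<in> e" "C \<in> \<C>" "u \<in> C" by blast
      obtain x y where "e = {x, y}" using e edge_obtain by blast
      then obtain v where v: "e = {u, v}" using u(1) by (cases "u = x") auto
      show "e \<in> ?L"
      proof (cases "v \<in> X")
        case True
        then have "e = {v, u}" "{v, u} \<in> E" using e v by (auto simp: insert_commute)
        then show ?thesis using True u by blast
      next
        case False
        then have "v \<in> C" using comps_edge[of C X u v] assms u v e by blast
        then show ?thesis using e u v by blast
      qed
    qed
  qed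
  then have "ostar G (\<Union>\<C>) = (\<Union>C\<in>\<C>. vertex_pt ` C) \<union> ((\<Union>C\<in>\<C>. inner_pts {e \<in> E. e \<subseteq> C}) \<union>
      inner_pts_between G X (\<Union>\<C>))"
    by (simp only: ostar_def image_Union inner_pts_between_def flip: inner_pts_Un inner_pts_UN)
  then show ?thesis by (simp only: induced_pts_def UN_Un_distrib Un_assoc)
qed

section \<open>Compact finite subgraphs and the Hausdorff property\<close>

lemma induced_eq: "induced_pts G X = vertex_pt ` X \<union> (\<Union>(u, v)\<in>{(u, v). u \<in> X \<and> v \<in> X \<and> {u, v} \<in> E}. edge_pt u v ` {0..1})"
    (is "_ = ?R")
proof
  show "induced_pts G X \<subseteq> ?R" by (force simp: induced_pts_def inner_pts_def)
  have "edge_pt u v t \<in> induced_pts G X" if "u \<in> X" "v \<in> X" "{u, v} \<in> E" "0 \<le> t" "t \<le> 1" for u v t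
  proof -
    have "t = 0 \<or> t = 1 \<or> 0 < t \<and> t < 1" using that by auto
    then show ?thesis using that edge_pt_vertex_image[OF that(3), of t X] inner_pts_iff[of "{e \<in> E. e \<subseteq> X}" u v t]
      by (auto simp: induced_pts_def)
  qed
  moreover have "vertex_pt ` X \<subseteq> induced_pts G X" by (simp add: induced_pts_def)
  ultimately show "?R \<subseteq> induced_pts G X" by auto
qed

lemma continuous_edge_pt:
  assumes "{u, v} \<in> E"
  shows "continuous_map (top_of_set {0..1}) T (edge_pt u v)"
  unfolding continuous_map_alt
proof (intro conjI allI impI)
  show "edge_pt u v \<in> topspace (top_of_set {0..1}) \<rightarrow> topspace T"
    using edge_in_points[OF assms] by (auto simp: topspace_complex)
  fix U assume "openin T U"
  then have U: "\<And>t. 0 \<le> t \<Longrightarrow> t \<le> 1 \<Longrightarrow> edge_pt u v t \<in> U \<Longrightarrow>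
       \<exists>e>0. \<forall>s. 0 \<le> s \<longrightarrow> s \<le> 1 \<longrightarrow> \<bar>s - t\<bar> < e \<longrightarrow> edge_pt u v s \<in> U"
    using assms openin_complex_iff by blast
  show "openin (top_of_set {0..1}) (edge_pt u v -` U \<inter> topspace (top_of_set {0..1}))"
    unfolding openin_euclidean_subtopology_iff using U by (fastforce simp: dist_real_def)
qed

text \<open>Written with closed instead of open edges, a finite induced subgraph is a finite set of
  vertices and finitely many continuous images of [0,1].\<close>

lemma compactin_induced:
  assumes "X \<in> \<X>"
  shows "compactin T (induced_pts G X)"
  unfolding induced_eq
proof (rule compactin_Un)
  have X: "finite X" "X \<subseteq> V" using assms by (simp_all add: finite_vsets_iff)
  show "compactin T (vertex_pt ` X)"
    using X by (intro finite_imp_compactin) (auto simp: topspace_complex vertex_in_points)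
  have "finite {(u, v). u \<in> X \<and> v \<in> X \<and> {u, v} \<in> E}"
    by (rule finite_subset[of _ "X \<times> X"]) (use X(1) in auto)
  then show "compactin T (\<Union>(u, v)\<in>{(u, v). u \<in> X \<and> v \<in> X \<and> {u, v} \<in> E}. edge_pt u v ` {0..1})"
    by (intro compactin_Union) (auto intro!: image_compactin continuous_edge_pt simp: compactin_subtopology)
qed

text \<open>Along every edge a barycentric coordinate is 1-Lipschitz. Since the coordinates separate
  points, the Hausdorff property is inherited from the real line.\<close>

lemma continuous_coordinate: "continuous_map T euclideanreal (\<lambda>p. p w)"
  unfolding continuous_map_alt
proof (intro conjI allI impI)
  fix S :: "real set" assume "openin euclideanreal S"
  then have S: "\<And>x. x \<in> S \<Longrightarrow> \<exists>e>0. \<forall>y. \<bar>y - x\<bar> < e \<longrightarrow> y \<in> S"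
    by (simp add: open_dist dist_real_def)
  show "openin T ((\<lambda>p. p w) -` S \<inter> topspace T)"
  proof (rule openin_complexI)
    show "(\<lambda>p. p w) -` S \<inter> topspace T \<subseteq> points G" by (simp add: topspace_complex)
    fix u v t assume uv: "{u, v} \<in> E" "0 \<le> t" "t \<le> (1::real)" "edge_pt u v t \<in> (\<lambda>p. p w) -` S \<inter> topspace T"
    then obtain e where e: "e > 0" "\<And>y. \<bar>y - edge_pt u v t w\<bar> < e \<Longrightarrow> y \<in> S"
      using S[of "edge_pt u v t w"] by auto
    have "\<bar>edge_pt u v s w - edge_pt u v t w\<bar> \<le> \<bar>s - t\<bar>" for s
      by (auto simp: edge_pt_def)
    then have "edge_pt u v s \<in> (\<lambda>p. p w) -` S \<inter> topspace T" if "0 \<le> s" "s \<le> 1" "\<bar>s - t\<bar> < e" for s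
      using that e(2) edge_in_points[OF uv(1) that(1,2)] by (auto simp: topspace_complex intro: le_less_trans)
    then show "\<exists>e>0. \<forall>s. 0 \<le> s \<longrightarrow> s \<le> 1 \<longrightarrow> \<bar>s - t\<bar> < e \<longrightarrow> edge_pt u v s \<in> (\<lambda>p. p w) -` S \<inter> topspace T"
      using e(1) by blast
  qed
qed simp

lemma Hausdorff_complex: "Hausdorff_space T"
  unfolding Hausdorff_space_def
proof (intro allI impI)
  fix p q assume pq: "p \<in> topspace T \<and> q \<in> topspace T \<and> p \<noteq> q"
  then obtain w where "p w \<noteq> q w" by blast
  then obtain A B where AB: "open A" "open B" "p w \<in> A" "q w \<in> B" "A \<inter> B = {}"
    using hausdorff by metis
  have "openin T {x \<in> topspace T. x w \<in> A}" "openin T {x \<in> topspace T. x w \<in> B}"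
    using openin_continuous_map_preimage[OF continuous_coordinate] AB(1,2) by simp_all
  then show "\<exists>U W. openin T U \<and> openin T W \<and> p \<in> U \<and> q \<in> W \<and> disjnt U W"
    using pq AB(3-5) by (intro exI[of _ "{x \<in> topspace T. x w \<in> A}"] exI[of _ "{x \<in> topspace T. x w \<in> B}"])
      (auto simp: disjnt_iff)
qed

section \<open>Connected stars and complements of finite subgraphs\<close>

lemma connectedin_edge_segment:
  assumes "{u, v} \<in> E" "connected S" "S \<subseteq> {0..1}"
  shows "connectedin T (edge_pt u v ` S)"
  by (rule connectedin_continuous_map_image[OF continuous_edge_pt[OF assms(1)]])
     (use assms(2,3) in \<open>simp add: connectedin_subtopology\<close>)

text \<open>All segments share the centre. The bound \<open>j v \<le> 1\<close>, weaker than in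
  \<open>complex_basis\<close>, lets the constant 1 through, which gives the whole open star of
  \<open>u\<close>.\<close>

lemma connectedin_star:
  assumes "u \<in> V" and j: "\<And>v. {u, v} \<in> E \<Longrightarrow> 0 < j v \<and> j v \<le> 1"
  shows "connectedin T (insert (vertex_pt u) (\<Union>v\<in>{v. {u, v} \<in> E}. edge_pt u v ` {0..<j v}))"
proof -
  \<comment> \<open>The singleton puts the centre into the union even if \<open>u\<close> is
    isolated.\<close>
  let ?F = "insert {vertex_pt u} ((\<lambda>v. edge_pt u v ` {0..<j v}) ` {v. {u, v} \<in> E})"
  have "vertex_pt u \<in> edge_pt u v ` {0..<j v}" if "{u, v} \<in> E" for v
    using edge_pt_0[OF edge_verts(3)[OF that]] j[OF that] by (intro image_eqI[of _ _ 0]) auto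
  then have "vertex_pt u \<in> \<Inter>?F" by auto
  moreover have "connectedin T S" if "S \<in> ?F" for S
    using that
  proof
    assume "S = {vertex_pt u}"
    then show ?thesis using assms(1) by (simp add: connectedin_sing topspace_complex vertex_in_points)
  next
    assume "S \<in> (\<lambda>v. edge_pt u v ` {0..<j v}) ` {v. {u, v} \<in> E}"
    then obtain v where v: "{u, v} \<in> E" "S = edge_pt u v ` {0..<j v}" by blast
    show ?thesis unfolding v(2)
      by (rule connectedin_edge_segment[OF v(1)]) (use j[OF v(1)] in auto)
  qed
  ultimately have "connectedin T (\<Union>?F)" by (intro connectedin_Union) auto
  then show ?thesis by simp
qed

lemma connectedin_basis:
  assumes "B \<in> complex_basis G"
  shows "connectedin T B"
proof -
  from assms consider u v a b where "B = edge_pt u v ` {a<..<b}" "{u, v} \<in> E" "0 \<le> a" "b \<le> (1::real)"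
    | u j where "B = insert (vertex_pt u) (\<Union>v\<in>{v. {u, v} \<in> E}. edge_pt u v ` {0..<j v})" "u \<in> V"
      "\<forall>v. {u, v} \<in> E \<longrightarrow> 0 < j v \<and> j v < (1::real)"
    unfolding complex_basis_def by blast
  then show ?thesis
  proof cases
    case 1
    then show ?thesis using connectedin_edge_segment[of u v "{a<..<b}"] by fastforce
  next
    case (2 u j)
    then show ?thesis using connectedin_star[of u j] by (simp add: less_imp_le)
  qed
qed

text \<open>The connected basis from \<open>connectedin_basis\<close> makes the 1-complex locally
  connected, and compact sets are closed because it is Hausdorff. Components of an open set in a
  locally connected space are open.\<close>

lemma openin_compl_comps:
  assumes K: "compactin T K" and C: "C \<in> compl_comps T K"
  shows "openin T C"
proof -
  let ?U = "topspace T - K"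
  have "closedin T K" using K Hausdorff_complex by (simp add: compactin_imp_closedin)
  then have U: "openin T ?U" by blast
  have CU: "C \<subseteq> ?U" using C connected_components_of_subset unfolding compl_comps_def by fastforce
  have h: "\<exists>B. openin T B \<and> p \<in> B \<and> B \<subseteq> C" if p: "p \<in> C" for p
  proof -
    obtain B where B: "B \<in> complex_basis G" "p \<in> B" "B \<subseteq> ?U"
      using openin_complex_basis[OF U] p CU by blast
    have "connectedin (subtopology T ?U) B"
      using connectedin_basis[OF B(1)] B(3) by (simp add: connectedin_subtopology)
    moreover have "\<not> disjnt C B" using p B(2) by (auto simp: disjnt_iff)
    ultimately have "B \<subseteq> C" using connected_components_of_maximal C unfolding compl_comps_def by blast
    moreover have "openin T B" unfolding complex_top_def by (rule topology_generated_by_Basis[OF B(1)])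
    ultimately show ?thesis using B(2) by blast
  qed
  show ?thesis by (rule openin_subopen[THEN iffD2]) (intro ballI h)
qed

lemma ostar_sing: "u \<in> V \<Longrightarrow> ostar G {u} = insert (vertex_pt u) (\<Union>v\<in>{v. {u, v} \<in> E}. edge_pt u v ` {0..<1})"
    (is "_ \<Longrightarrow> _ = ?R")
proof
  assume u: "u \<in> V"
  show "ostar G {u} \<subseteq> ?R"
  proof
    fix p assume p: "p \<in> ostar G {u}"
    then have "p \<in> points G" using ostar_subset_points u by blast
    then show "p \<in> ?R"
    proof (cases rule: points_cases)
      case (1 v)
      then show ?thesis using p by (simp add: vertex_in_ostar_iff)
    next
      case (2 x y t)
      then have "x = u \<or> y = u" using p by (simp add: edge_in_ostar_iff)
      then show ?thesis
      proof
        assume "x = u"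
        then show ?thesis using 2 by auto
      next
        assume "y = u"
        then have "p = edge_pt u x (1 - t)" "{u, x} \<in> E"
          using 2 edge_verts(3)[OF 2(1)] edge_pt_swap[of u x t] by (auto simp: insert_commute)
        then show ?thesis using 2 by auto
      qed
    qed
  qed
  show "?R \<subseteq> ostar G {u}" by (auto simp: edge_in_ostar_iff vertex_in_ostar_iff)
qed

lemma connectedin_ostar_sing: "u \<in> V \<Longrightarrow> connectedin T (ostar G {u})"
  unfolding ostar_sing by (rule connectedin_star) auto

text \<open>Stars of single vertices are connected, and those of adjacent vertices overlap inside
  their common edge, so they can be chained along a walk in the component.\<close>

lemma connectedin_ostar:
  assumes C: "C \<in> comps G X"
  shows "connectedin T (ostar G C)"
proof -
  obtain u where u: "u \<in> C" using comps_nonempty[OF C] by blast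
  have CV: "C \<subseteq> V" by (rule comps_subset(1)[OF C])
  \<comment> \<open>The chains for different \<open>w\<close> are all required to contain
    \<open>vertex_pt u\<close>, so that their union over \<open>C\<close> is connected as
    well.\<close>
  have "\<exists>S. connectedin T S \<and> S \<subseteq> ostar G C \<and> vertex_pt u \<in> S \<and> ostar G {w} \<subseteq> S" if w: "w \<in> C" for w
  proof (rule comps_induct[OF C u w])
    show "\<exists>S. connectedin T S \<and> S \<subseteq> ostar G C \<and> vertex_pt u \<in> S \<and> ostar G {u} \<subseteq> S"
      using connectedin_ostar_sing[of u] u CV ostar_mono[of "{u}" C]
      by (intro exI[of _ "ostar G {u}"]) (auto simp: vertex_in_ostar_iff)
  next
    fix x y assume xy: "x \<in> C" "y \<in> C" "{x, y} \<in> E"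
      and "\<exists>S. connectedin T S \<and> S \<subseteq> ostar G C \<and> vertex_pt u \<in> S \<and> ostar G {x} \<subseteq> S"
    then obtain S where S: "connectedin T S" "S \<subseteq> ostar G C" "vertex_pt u \<in> S" "ostar G {x} \<subseteq> S" by blast
    \<comment> \<open>Any inner point of the edge lies in both stars; the midpoint is a concrete
      choice.\<close>
    have "edge_pt x y (1/2) \<in> ostar G {x}" "edge_pt x y (1/2) \<in> ostar G {y}"
      using edge_in_ostar_iff[OF xy(3)] by auto
    then have "connectedin T (S \<union> ostar G {y})"
      using S(4) connectedin_ostar_sing[of y] xy(2) CV by (intro connectedin_Un S(1)) auto
    then show "\<exists>S. connectedin T S \<and> S \<subseteq> ostar G C \<and> vertex_pt u \<in> S \<and> ostar G {y} \<subseteq> S"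
      using S(2,3) xy(2) ostar_mono[of "{y}" C] by (intro exI[of _ "S \<union> ostar G {y}"]) auto
  qed
  then obtain S where S: "\<And>w. w \<in> C \<Longrightarrow> connectedin T (S w) \<and> S w \<subseteq> ostar G C \<and> vertex_pt u \<in> S w \<and> ostar G {w} \<subseteq> S w"
    by metis
  have "ostar G C = (\<Union>w\<in>C. ostar G {w})" using ostar_Union[of "(\<lambda>w. {w}) ` C"] by simp
  then have "ostar G C = \<Union>(S ` C)" using S by blast
  moreover have "connectedin T (\<Union>(S ` C))"
  proof (rule connectedin_Union)
    have "vertex_pt u \<in> \<Inter>(S ` C)" using S by blast
    then show "\<Inter>(S ` C) \<noteq> {}" by blast
  qed (use S in blast)
  ultimately show ?thesis by simp
qed

lemma ostar_comps_disjoint: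
  assumes "C \<in> comps G X" "D \<in> comps G X" "C \<noteq> D"
  shows "ostar G C \<inter> ostar G D = {}"
proof (rule ccontr)
  assume "\<not> ?thesis"
  then obtain p where p: "p \<in> ostar G C" "p \<in> ostar G D" by blast
  have CD: "x \<notin> D" if "x \<in> C" for x using comps_unique assms that by blast
  have "p \<in> points G" using p(1) ostar_subset_points[OF comps_subset(1)[OF assms(1)]] by blast
  then show False
  proof (cases rule: points_cases)
    case (1 v)
    then show ?thesis using p CD by (simp add: vertex_in_ostar_iff)
  next
    case (2 u v t)
    then have "u \<in> C \<or> v \<in> C" "u \<in> D \<or> v \<in> D" using p by (auto simp: edge_in_ostar_iff)
    then have "u \<in> C \<and> v \<in> D \<or> v \<in> C \<and> u \<in> D" using CD by blast
    then show ?thesis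
    proof
      assume uv: "u \<in> C \<and> v \<in> D"
      then have "v \<notin> X" using comps_subset(2)[OF assms(2)] by blast
      then show False using comps_edge[OF assms(1) _ 2(1)] uv CD by blast
    next
      assume uv: "v \<in> C \<and> u \<in> D"
      then have "v \<notin> X" using comps_subset(2)[OF assms(1)] by blast
      then show False using comps_edge[OF assms(2) _ 2(1)] uv CD by blast
    qed
  qed
qed

lemma in_comp_iff:
  assumes "v \<in> V"
  shows "(\<exists>C\<in>comps G X. v \<in> C) \<longleftrightarrow> v \<notin> X"
proof
  assume "v \<notin> X"
  show "\<exists>C\<in>comps G X. v \<in> C" using compsI[OF assms \<open>v \<notin> X\<close>] by blast
next
  assume "\<exists>C\<in>comps G X. v \<in> C"
  then show "v \<notin> X" by (metis IntI comps_subset(2) empty_iff)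
qed

lemma compl_induced: "topspace T - induced_pts G X = \<Union>(ostar G ` comps G X)"
proof -
  have iff: "p \<notin> induced_pts G X \<longleftrightarrow> p \<in> \<Union>(ostar G ` comps G X)" if p: "p \<in> points G" for p
    using p
  proof (cases rule: points_cases)
    case (1 v)
    have "p \<in> induced_pts G X \<longleftrightarrow> v \<in> X"
      using 1 vertex_pt_not_inner[of "{e \<in> E. e \<subseteq> X}" v] by (auto simp: induced_pts_def vertex_pt_inj)
    moreover have "v \<notin> X \<longleftrightarrow> (\<exists>C\<in>comps G X. v \<in> C)" using in_comp_iff[OF 1(1), of X] by simp
    ultimately show ?thesis using 1 by (simp add: vertex_in_ostar_iff)
  next
    case (2 u v t)
    have "p \<in> induced_pts G X \<longleftrightarrow> u \<in> X \<and> v \<in> X"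
      using 2 inner_pts_iff[of "{e \<in> E. e \<subseteq> X}" u v t] edge_pt_vertex_image[of u v t X]
      by (auto simp: induced_pts_def)
    moreover have "\<not> (u \<in> X \<and> v \<in> X) \<longleftrightarrow> (\<exists>C\<in>comps G X. u \<in> C \<or> v \<in> C)"
      using in_comp_iff[OF edge_verts(1)[OF 2(1)], of X] in_comp_iff[OF edge_verts(2)[OF 2(1)], of X] by metis
    ultimately show ?thesis using 2 by (simp add: edge_in_ostar_iff)
  qed
  have "\<Union>(ostar G ` comps G X) \<subseteq> points G"
    using ostar_subset_points[OF comps_subset(1)] by blast
  then show ?thesis unfolding topspace_complex using iff by blast
qed

text \<open>The stars of the components of G - X partition the complement of the subgraph into open
  sets, so each of them is clopen there. Being connected too, it is a component.\<close>

lemma component_induced: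
  assumes C: "C \<in> comps G X" and p: "p \<in> ostar G C"
  shows "connected_component_of_set (subtopology T (topspace T - induced_pts G X)) p = ostar G C"
proof
  let ?S = "topspace T - induced_pts G X"
  let ?T = "subtopology T ?S"
  have sub: "ostar G D \<subseteq> ?S" if "D \<in> comps G X" for D using that unfolding compl_induced by blast
  show "ostar G C \<subseteq> connected_component_of_set ?T p"
    using connectedin_ostar[OF C] sub[OF C] p
    by (intro connected_component_of_maximal) (simp_all add: connectedin_subtopology)
  have op: "openin ?T (ostar G D)" if "D \<in> comps G X" for D
    using subset_openin_subtopology[OF openin_ostar[OF comps_subset(1)[OF that]] sub[OF that]] .
  have top: "topspace ?T = \<Union>(ostar G ` comps G X)" using compl_induced by auto
  have "topspace ?T - ostar G C = \<Union>(ostar G ` (comps G X - {C}))"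
    unfolding top using ostar_comps_disjoint[OF C] by blast
  moreover have "openin ?T (\<Union>(ostar G ` (comps G X - {C})))" using op by (intro openin_Union) blast
  ultimately have cl: "closedin ?T (ostar G C)"
    unfolding closedin_def top using C by auto
  show "connected_component_of_set ?T p \<subseteq> ostar G C"
  proof
    fix q assume "q \<in> connected_component_of_set ?T p"
    then obtain Q where Q: "connectedin ?T Q" "p \<in> Q" "q \<in> Q" unfolding connected_component_of_def by blast
    then show "q \<in> ostar G C" using connectedin_clopen_cases[OF Q(1) cl op[OF C]] p by (auto simp: disjnt_iff)
  qed
qed

lemma compl_comps_induced: "compl_comps T (induced_pts G X) = ostar G ` comps G X"
proof -
  let ?S = "topspace T - induced_pts G X"
  have top: "topspace (subtopology T ?S) = \<Union>(ostar G ` comps G X)" using compl_induced by auto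
  have "compl_comps T (induced_pts G X) =
      connected_component_of_set (subtopology T ?S) ` (\<Union>(ostar G ` comps G X))"
    unfolding compl_comps_def connected_components_of_def top ..
  also have "\<dots> = (\<Union>C\<in>comps G X. connected_component_of_set (subtopology T ?S) ` ostar G C)"
    by (rule image_UN)
  also have "\<dots> = (\<Union>C\<in>comps G X. {ostar G C})"
  proof (rule SUP_cong[OF refl])
    fix C assume C: "C \<in> comps G X"
    then obtain v where "v \<in> C" using comps_nonempty by blast
    then have "ostar G C \<noteq> {}" using vertex_in_ostar_iff by blast
    then show "connected_component_of_set (subtopology T ?S) ` ostar G C = {ostar G C}"
      using component_induced[OF C] by (auto simp: image_iff)
  qed
  finally show ?thesis by blast
qed

lemma ostar_subset_iff: "ostar G A \<subseteq> ostar G B \<longleftrightarrow> A \<subseteq> B"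
proof
  assume sub: "ostar G A \<subseteq> ostar G B"
  show "A \<subseteq> B"
  proof
    fix v assume "v \<in> A"
    then have "vertex_pt v \<in> ostar G A" by (simp add: vertex_in_ostar_iff)
    then have "vertex_pt v \<in> ostar G B" by (rule subsetD[OF sub])
    then show "v \<in> B" by (simp add: vertex_in_ostar_iff)
  qed
qed (rule ostar_mono)

lemma induced_mono: "X \<subseteq> X' \<Longrightarrow> induced_pts G X \<subseteq> induced_pts G X'"
  using inner_pts_mono[of "{e \<in> E. e \<subseteq> X}" "{e \<in> E. e \<subseteq> X'}"] unfolding induced_pts_def by blast

end

section \<open>The compactification\<close>

text \<open>This is Alexander's subbase theorem for \<open>topology_generated_by\<close>. The work
  is to identify that topology with the one built from finite intersections and arbitrary unions
  relative to the union of \<open>B\<close>.\<close>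

lemma compact_space_generated_by:
  assumes fin: "\<And>\<C>. \<C> \<subseteq> B \<Longrightarrow> \<Union>\<C> = \<Union>B \<Longrightarrow> \<exists>\<C>'. finite \<C>' \<and> \<C>' \<subseteq> \<C> \<and> \<Union>\<C>' = \<Union>B"
  shows "compact_space (topology_generated_by B)"
proof (rule Alexander_subbase)
  let ?X = "topology (arbitrary union_of (finite intersection_of (\<lambda>x. x \<in> B) relative_to \<Union>B))"
  have "openin ?X S" if "S \<in> B" for S
    using that by (simp add: openin_subbase Sup_upper arbitrary_union_of_inc finite_intersection_of_inc
        relative_to_subset_inc)
  then have "openin ?X S" if "openin (topology_generated_by B) S" for S
    using generate_topology_on_coarsest[OF istopology_openin] openin_topology_generated_by[OF that]
    by blast
  moreover have "openin (topology_generated_by B) S" if "openin ?X S" for S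
  proof (rule minimal_topology_subbase[OF _ _ that])
    show "openin (topology_generated_by B) (\<Union>B)"
      by (metis openin_topspace topology_generated_by_topspace)
  qed (simp add: topology_generated_by_Basis)
  ultimately show "?X = topology_generated_by B" by (auto simp: topology_eq)
qed (use fin in simp)

lemma disjnt_Int_subset: "U \<inter> W \<inter> Z = {} \<Longrightarrow> S \<subseteq> Z \<Longrightarrow> disjnt (U \<inter> S) (W \<inter> S)"
  unfolding disjnt_def by blast

definition fg_set :: "'v graph \<Rightarrow> 'v set \<Rightarrow> 'v set set \<Rightarrow> ('v pt + ('v set \<Rightarrow> 'v set set set)) set" where
  "fg_set G X \<C> = Inl ` ostar G (\<Union>\<C>) \<union> Inr ` {F \<in> filter_lim G. \<C> \<in> F X}"

definition fg_basis :: "'v graph \<Rightarrow> ('v pt + ('v set \<Rightarrow> 'v set set set)) set set" where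
  "fg_basis G = {Inl ` U | U. openin (complex_top G) U} \<union>
     {fg_set G X \<C> | X \<C>. X \<in> finite_vsets G \<and> basic_at G X \<C>}"

definition vg_set :: "'v graph \<Rightarrow> 'v set \<Rightarrow> (nat \<Rightarrow> 'v) set \<Rightarrow> ('v pt + (nat \<Rightarrow> 'v) set) set" where
  "vg_set G X \<omega> = Inl ` ostar G (end_comp G X \<omega>) \<union> Inr ` ends_in G X \<omega>"

definition vg_basis :: "'v graph \<Rightarrow> ('v pt + (nat \<Rightarrow> 'v) set) set set" where
  "vg_basis G = {Inl ` U | U. openin (complex_top G) U} \<union>
     {vg_set G X \<omega> | X \<omega>. X \<in> finite_vsets G \<and> \<omega> \<in> ends G}"

context sgraph
begin

section \<open>Compactness of \<open>FG G\<close>\<close>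

lemma filters_at_comps: "f \<in> filters_at G X \<Longrightarrow> comps G X \<in> f"
proof (elim filters_at_cases)
  fix Y assume "f = crit_filter G X Y"
  then show ?thesis
    using comps_nbh_subset[of X Y] by (auto simp: crit_filter_eq intro: finite_subset[of _ "{}"])
qed (simp add: princ_filter_def)

lemma filters_at_finite_inter:
  assumes f: "f \<in> filters_at G X" and "finite A" "A \<subseteq> f"
  obtains C where "C \<in> comps G X" "\<And>\<A>. \<A> \<in> A \<Longrightarrow> C \<in> \<A>"
proof -
  have "comps G X \<inter> \<Inter>A \<in> f"
    using assms(2,3)
  proof (induction A)
    case empty
    then show ?case using filters_at_comps[OF f] by simp
  next
    case (insert \<A> A)
    then have "\<A> \<inter> (comps G X \<inter> \<Inter>A) \<in> f" using filters_at_Int[OF f] by blast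
    moreover have "\<A> \<inter> (comps G X \<inter> \<Inter>A) = comps G X \<inter> \<Inter>(insert \<A> A)" by blast
    ultimately show ?case by simp
  qed
  then have "comps G X \<inter> \<Inter>A \<noteq> {}" using filters_at_nonempty[OF f] by metis
  then show ?thesis using that by blast
qed

lemma FG_eq: "FG G = topology_generated_by (fg_basis G)"
proof -
  let ?L = "\<lambda>X \<C>. Inl ` ((\<Union>C\<in>\<C>. induced_pts G C) \<union> inner_pts_between G X (\<Union>\<C>))
        \<union> Inr ` {F \<in> filter_lim G. \<C> \<in> F X}"
  have "?L X \<C> = fg_set G X \<C>" if "basic_at G X \<C>" for X \<C>
    unfolding fg_set_def comp_complex_eq_ostar[OF basic_at_subset[OF that]] ..
  then have "(S = ?L X \<C> \<and> X \<in> \<X> \<and> basic_at G X \<C>) \<longleftrightarrow>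
      (S = fg_set G X \<C> \<and> X \<in> \<X> \<and> basic_at G X \<C>)" for S X \<C>
    by (cases "basic_at G X \<C>") (simp_all only: simp_thms)
  then show ?thesis
    unfolding FG_def fg_basis_def basic_at_def[symmetric] by (simp only:)
qed

lemma openin_FG_Inl: "openin T U \<Longrightarrow> openin (FG G) (Inl ` U)"
  unfolding FG_eq fg_basis_def by (intro topology_generated_by_Basis) blast

lemma openin_FG_set: "X \<in> \<X> \<Longrightarrow> basic_at G X \<C> \<Longrightarrow> openin (FG G) (fg_set G X \<C>)"
  unfolding FG_eq fg_basis_def by (intro topology_generated_by_Basis) blast

lemma basic_at_Union_subset: "basic_at G X \<C> \<Longrightarrow> \<Union>\<C> \<subseteq> V"
  using basic_at_subset comps_subset(1) by blast

lemma filter_lim_basic: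
  assumes "F \<in> filter_lim G" "X \<in> \<X>"
  obtains \<C> where "basic_at G X \<C>" "\<C> \<in> F X"
  using filters_at_contains_basic filters_at_comps filter_lim_at[OF assms] by metis

lemma empty_finite_vset: "{} \<in> \<X>"
  by (simp add: finite_vsets_iff)

lemma Inr_in_fg_set: "Inr F \<in> fg_set G X \<C> \<longleftrightarrow> F \<in> filter_lim G \<and> \<C> \<in> F X"
  by (auto simp: fg_set_def)

lemma Inl_in_fg_set: "Inl p \<in> fg_set G X \<C> \<longleftrightarrow> p \<in> ostar G (\<Union>\<C>)"
  by (auto simp: fg_set_def)

lemma topspace_FG: "topspace (FG G) = Inl ` points G \<union> Inr ` filter_lim G"
proof
  have "W \<subseteq> Inl ` points G \<union> Inr ` filter_lim G" if "W \<in> fg_basis G" for W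
    using that ostar_subset_points[OF basic_at_Union_subset] openin_subset[of T]
    unfolding fg_basis_def topspace_complex fg_set_def by blast
  then show "topspace (FG G) \<subseteq> Inl ` points G \<union> Inr ` filter_lim G"
    unfolding FG_eq topology_generated_by_topspace by blast
  have "Inl ` points G \<subseteq> topspace (FG G)"
    using openin_FG_Inl[of "points G"] openin_topspace[of T] openin_subset by (fastforce simp: topspace_complex)
  moreover have "Inr F \<in> topspace (FG G)" if F: "F \<in> filter_lim G" for F
  proof -
    obtain \<C> where c: "basic_at G {} \<C>" "\<C> \<in> F {}" using filter_lim_basic[OF F empty_finite_vset] .
    then show ?thesis
      using openin_subset[OF openin_FG_set[OF empty_finite_vset c(1)]] Inr_in_fg_set F by blast
  qed
  ultimately show "Inl ` points G \<union> Inr ` filter_lim G \<subseteq> topspace (FG G)" by blast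
qed

text \<open>A finite cover of almost all vertices also covers the limit points. A point
  \<open>F\<close> outside all the sets would contain, for each of them, a family of components
  disjoint from it. Refined to one finite set \<open>Z\<close>, these finitely many families have a
  common component, and its vertices would be uncovered.\<close>

lemma vertex_cover_imp_filter_cover:
  assumes fin: "finite \<T>" and T: "\<And>Y \<C>. (Y, \<C>) \<in> \<T> \<Longrightarrow> Y \<in> \<X> \<and> basic_at G Y \<C>"
    and X: "X \<in> \<X>" and cov: "V \<subseteq> X \<union> (\<Union>(Y, \<C>)\<in>\<T>. \<Union>\<C>)" and F: "F \<in> filter_lim G"
  shows "\<exists>(Y, \<C>)\<in>\<T>. \<C> \<in> F Y"
proof (rule ccontr)
  assume neg: "\<not> ?thesis"
  have "\<exists>\<D>. \<D> \<in> F (fst p) \<and> snd p \<inter> \<D> = {} \<and> \<D> \<subseteq> comps G (fst p)" if p: "p \<in> \<T>" for p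
  proof -
    obtain Y \<C> where e: "p = (Y, \<C>)" by (cases p)
    then have Y: "Y \<in> \<X>" "basic_at G Y \<C>" "\<C> \<notin> F Y" using T p neg by auto
    obtain \<D> where "basic_at G Y \<D>" "\<D> \<in> F Y" "\<C> \<inter> \<D> = {}"
      using filters_at_separate[OF filter_lim_at[OF F Y(1)] Y(2,3)] .
    then show ?thesis using e basic_at_subset[of Y \<D>] by (intro exI[of _ \<D>]) simp
  qed
  then obtain D where D: "\<And>p. p \<in> \<T> \<Longrightarrow> D p \<in> F (fst p) \<and> snd p \<inter> D p = {} \<and> D p \<subseteq> comps G (fst p)"
    by metis
  \<comment> \<open>Including \<open>X\<close> makes sure that a vertex of a component of G - Z is
    among those the cover has to reach.\<close>
  define Z where "Z = X \<union> (\<Union>p\<in>\<T>. fst p)"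
  have Z: "Z \<in> \<X>" using X T fin by (fastforce simp: Z_def finite_vsets_iff)
  have "comps_inside G Z (D p) \<in> F Z" if p: "p \<in> \<T>" for p
  proof -
    have "fst p \<in> \<X>" using T[of "fst p" "snd p"] p by simp
    moreover have "fst p \<subseteq> Z" using p by (auto simp: Z_def)
    ultimately show ?thesis using filter_lim_refine[OF F _ Z] D[OF p] by blast
  qed
  then have "(\<lambda>p. comps_inside G Z (D p)) ` \<T> \<subseteq> F Z" by blast
  then obtain C where C: "C \<in> comps G Z" "\<And>\<A>. \<A> \<in> (\<lambda>p. comps_inside G Z (D p)) ` \<T> \<Longrightarrow> C \<in> \<A>"
    using filters_at_finite_inter[OF filter_lim_at[OF F Z], of "(\<lambda>p. comps_inside G Z (D p)) ` \<T>"] fin by blast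
  obtain v where v: "v \<in> C" using comps_nonempty[OF C(1)] by blast
  then have "v \<in> V" "v \<notin> X" using comps_subset[OF C(1)] by (auto simp: Z_def)
  then obtain Y \<C> A where A: "(Y, \<C>) \<in> \<T>" "A \<in> \<C>" "v \<in> A" using cov by blast
  have "C \<in> comps_inside G Z (D (Y, \<C>))" using C(2) A(1) by blast
  then obtain B where B: "B \<in> D (Y, \<C>)" "C \<subseteq> B" by (auto simp: comps_inside_def)
  have "A \<in> comps G Y" "B \<in> comps G Y" using A B T[OF A(1)] D[OF A(1)] basic_at_subset by auto
  then have "A = B" using comps_unique A(3) v B(2) by blast
  then show False using A B D[OF A(1)] by auto
qed

lemma compact_space_FG: "compact_space (FG G)"
  unfolding FG_eq
proof (rule compact_space_generated_by)
  fix \<U> assume U: "\<U> \<subseteq> fg_basis G" and cov: "\<Union>\<U> = \<Union>(fg_basis G)"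
  have top: "\<Union>(fg_basis G) = Inl ` points G \<union> Inr ` filter_lim G"
    using topspace_FG unfolding FG_eq topology_generated_by_topspace .
  define S where "S = {(X, \<C>). X \<in> \<X> \<and> basic_at G X \<C> \<and> fg_set G X \<C> \<in> \<U>}"
  have key: "\<exists>(X, \<C>)\<in>S. X \<in> \<X> \<and> \<C> \<in> F X" if F: "F \<in> filter_lim G" for F
  proof -
    have "Inr F \<in> \<Union>\<U>" using F top cov by blast
    then obtain W where W: "W \<in> \<U>" "Inr F \<in> W" by blast
    moreover have "W \<in> fg_basis G" using W U by blast
    then consider A where "W = Inl ` A" | X \<C> where "X \<in> \<X>" "basic_at G X \<C>" "W = fg_set G X \<C>"
      unfolding fg_basis_def by blast
    then show ?thesis
    proof cases
      case 1
      then show ?thesis using W by auto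
    next
      case (2 X \<C>)
      then show ?thesis using W Inr_in_fg_set unfolding S_def by blast
    qed
  qed
  have finc: "\<exists>\<T> X. finite \<T> \<and> \<T> \<subseteq> S \<and> X \<in> \<X> \<and> V \<subseteq> X \<union> (\<Union>(Y, \<C>)\<in>\<T>. \<Union>\<C>)"
    by (rule filter_lim_finite_cover) (rule key)
  obtain \<T> X where T: "finite \<T>" "\<T> \<subseteq> S" "X \<in> \<X>" "V \<subseteq> X \<union> (\<Union>(Y, \<C>)\<in>\<T>. \<Union>\<C>)"
    using finc by (elim exE conjE) (rule that)
  have op: "openin T (Inl -` W)" if W: "W \<in> \<U>" for W
  proof -
    have "W \<in> fg_basis G" using W U by blast
    then consider A where "W = Inl ` A" "openin T A" | X \<C> where "basic_at G X \<C>" "W = fg_set G X \<C>"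
      unfolding fg_basis_def by blast
    then show ?thesis
    proof cases
      case 1
      then show ?thesis by (simp add: inj_vimage_image_eq)
    next
      case (2 X \<C>)
      then have "Inl -` W = ostar G (\<Union>\<C>)" using Inl_in_fg_set by auto
      then show ?thesis using openin_ostar[OF basic_at_Union_subset[OF 2(1)]] by simp
    qed
  qed
  then have op': "openin T A" if "A \<in> (\<lambda>W. Inl -` W) ` \<U>" for A using that by blast
  \<comment> \<open>The finitely many sets from \<open>\<T>\<close> handle limit points and the
    stars of vertices outside \<open>X\<close>. What remains lies in the compact subgraph on
    \<open>X\<close>, where the traces of the given cover are open.\<close>
  have sub: "induced_pts G X \<subseteq> \<Union>((\<lambda>W. Inl -` W) ` \<U>)"
  proof
    fix p assume "p \<in> induced_pts G X"
    then have "p \<in> points G"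
      using compactin_subset_topspace[OF compactin_induced[OF T(3)]] by (auto simp: topspace_complex)
    then have "Inl p \<in> \<Union>\<U>" using top cov by blast
    then show "p \<in> \<Union>((\<lambda>W. Inl -` W) ` \<U>)" by blast
  qed
  obtain \<G> where G: "finite \<G>" "\<G> \<subseteq> (\<lambda>W. Inl -` W) ` \<U>" "induced_pts G X \<subseteq> \<Union>\<G>"
    using compactinD[OF compactin_induced[OF T(3)] _ sub] op' by auto
  obtain \<U>1 where U1: "\<U>1 \<subseteq> \<U>" "finite \<U>1" "\<G> = (\<lambda>W. Inl -` W) ` \<U>1"
    using finite_subset_image[OF G(1,2)] by blast
  define \<U>2 where "\<U>2 = (\<lambda>(Y, \<C>). fg_set G Y \<C>) ` \<T>"
  have U2: "finite \<U>2" "\<U>2 \<subseteq> \<U>" using T(1,2) by (auto simp: \<U>2_def S_def)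
  have ostarT: "Inl ` ostar G A \<subseteq> \<Union>\<U>2" if "A \<subseteq> (\<Union>(Y, \<C>)\<in>\<T>. \<Union>\<C>)" for A
  proof -
    have "ostar G A \<subseteq> (\<Union>(Y, \<C>)\<in>\<T>. ostar G (\<Union>\<C>))"
      using ostar_mono[OF that] ostar_Union[of "(\<lambda>(Y, \<C>). \<Union>\<C>) ` \<T>"] by (simp add: case_prod_beta)
    then show ?thesis unfolding \<U>2_def fg_set_def by blast
  qed
  have covd: "w \<in> (\<Union>(Y, \<C>)\<in>\<T>. \<Union>\<C>)" if "w \<in> V" "w \<notin> X" for w
    using subsetD[OF T(4) that(1)] that(2) by (simp only: Un_iff simp_thms)
  have indX: "Inl ` induced_pts G X \<subseteq> \<Union>\<U>1" using G(3) U1(3) by blast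
  have all: "x \<in> \<Union>(\<U>1 \<union> \<U>2)" if x: "x \<in> Inl ` points G \<union> Inr ` filter_lim G" for x
  proof -
    have Sb: "Y \<in> \<X> \<and> basic_at G Y \<C>" if "(Y, \<C>) \<in> \<T>" for Y \<C> using T(2) that by (auto simp: S_def)
    from x consider p where "p \<in> points G" "x = Inl p" | F where "F \<in> filter_lim G" "x = Inr F" by blast
    then show ?thesis
    proof cases
      case 1
      from 1(1) show ?thesis
      proof (cases rule: points_cases)
        case v: (1 v)
        show ?thesis
        proof (cases "v \<in> X")
          case True
          then have "p \<in> induced_pts G X" using v by (simp add: induced_pts_def)
          then show ?thesis using indX 1 by blast
        next
          case False
          then have "p \<in> ostar G {v}" "{v} \<subseteq> (\<Union>(Y, \<C>)\<in>\<T>. \<Union>\<C>)"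
            using v covd by (simp_all add: vertex_in_ostar_iff)
          then show ?thesis using ostarT 1 by blast
        qed
      next
        case e: (2 u v t)
        show ?thesis
        proof (cases "u \<in> X \<and> v \<in> X")
          case True
          then have "p \<in> induced_pts G X" using e by (auto simp: induced_pts_def inner_pts_iff)
          then show ?thesis using indX 1 by blast
        next
          case False
          \<comment> \<open>An edge not contained in the subgraph on \<open>X\<close> has an end
            outside \<open>X\<close>, and the open star of that end contains the full interior of
            the edge.\<close>
          then obtain w where w: "w \<in> {u, v}" "w \<notin> X" by blast
          then have "{w} \<subseteq> (\<Union>(Y, \<C>)\<in>\<T>. \<Union>\<C>)" using covd[of w] edge_verts[OF e(1)] by blast
          moreover have "p \<in> ostar G {w}" using w e by (auto simp: edge_in_ostar_iff)
          ultimately show ?thesis using ostarT 1 by blast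
        qed
      qed
    next
      case (2 F)
      obtain Y \<C> where "(Y, \<C>) \<in> \<T>" "\<C> \<in> F Y"
        using vertex_cover_imp_filter_cover[OF T(1) Sb T(3,4) 2(1)] by blast
      then have "x \<in> fg_set G Y \<C>" "fg_set G Y \<C> \<in> \<U>2" using 2 Inr_in_fg_set by (auto simp: \<U>2_def)
      then show ?thesis by blast
    qed
  qed
  have "\<Union>(fg_basis G) \<subseteq> \<Union>(\<U>1 \<union> \<U>2)" unfolding top by (rule subsetI) (rule all)
  moreover have "\<Union>(\<U>1 \<union> \<U>2) \<subseteq> \<Union>(fg_basis G)"
    using Union_mono[of "\<U>1 \<union> \<U>2" \<U>] U1(1) U2(2) unfolding cov by simp
  ultimately have "\<Union>(\<U>1 \<union> \<U>2) = \<Union>(fg_basis G)" by (rule subset_antisym[rotated])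
  then show "\<exists>\<C>'. finite \<C>' \<and> \<C>' \<subseteq> \<U> \<and> \<Union>\<C>' = \<Union>(fg_basis G)"
    using U1(1,2) U2 by (intro exI[of _ "\<U>1 \<union> \<U>2"] conjI) simp_all
qed

section \<open>Neighbourhoods of limit points and density\<close>

lemma fg_set_mono:
  assumes "X \<in> \<X>" "X' \<in> \<X>" "X \<subseteq> X'" "\<C> \<subseteq> comps G X" "\<C>' \<subseteq> comps_inside G X' \<C>"
  shows "fg_set G X' \<C>' \<subseteq> fg_set G X \<C>"
proof -
  have "\<Union>\<C>' \<subseteq> \<Union>\<C>" using assms(5) by (auto simp: comps_inside_def)
  then have "ostar G (\<Union>\<C>') \<subseteq> ostar G (\<Union>\<C>)" by (rule ostar_mono)
  moreover have "\<C> \<in> F X" if F: "F \<in> filter_lim G" "\<C>' \<in> F X'" for F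
  proof -
    have "comps_inside G X' \<C> \<in> F X'"
      by (rule filters_at_mono[OF filter_lim_at[OF F(1) assms(2)] F(2) assms(5)])
         (auto simp: comps_inside_def)
    then show ?thesis using filter_lim_refine[OF F(1) assms(1-3)] assms(4) by blast
  qed
  ultimately show ?thesis unfolding fg_set_def by (intro Un_mono image_mono) auto
qed

text \<open>The generating sets form only a subbase by definition. At a limit point they are a base:
  two of them, given at \<open>X\<close> and \<open>X'\<close>, can be refined to the common level
  \<open>X \<union> X'\<close>, where the filter contains a basic family inside both
  preimages.\<close>

lemma FG_nbhd_base:
  assumes "openin (FG G) W" "Inr F \<in> W" and F: "F \<in> filter_lim G"
  shows "\<exists>X\<in>\<X>. \<exists>\<C>. basic_at G X \<C> \<and> \<C> \<in> F X \<and> fg_set G X \<C> \<subseteq> W"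
proof -
  have "generate_topology_on (fg_basis G) W"
    using assms(1) by (simp add: FG_eq openin_topology_generated_by_iff)
  then show ?thesis using assms(2)
  proof induction
    case (Int W W')
    obtain X \<C> where X: "X \<in> \<X>" "basic_at G X \<C>" "\<C> \<in> F X" "fg_set G X \<C> \<subseteq> W" using Int by blast
    obtain X' \<C>' where X': "X' \<in> \<X>" "basic_at G X' \<C>'" "\<C>' \<in> F X'" "fg_set G X' \<C>' \<subseteq> W'"
      using Int by blast
    let ?Z = "X \<union> X'"
    have Z: "?Z \<in> \<X>" using X X' by (auto simp: finite_vsets_iff)
    note fZ = filter_lim_at[OF F Z]
    have "comps_inside G ?Z \<C> \<in> F ?Z" "comps_inside G ?Z \<C>' \<in> F ?Z"
      using filter_lim_refine[OF F X(1) Z] filter_lim_refine[OF F X'(1) Z] X X' by auto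
    then have "comps_inside G ?Z \<C> \<inter> comps_inside G ?Z \<C>' \<in> F ?Z" by (rule filters_at_Int[OF fZ])
    then obtain \<D> where D: "basic_at G ?Z \<D>" "\<D> \<in> F ?Z" "\<D> \<subseteq> comps_inside G ?Z \<C> \<inter> comps_inside G ?Z \<C>'"
      using filters_at_contains_basic[OF fZ] by metis
    then have "fg_set G ?Z \<D> \<subseteq> fg_set G X \<C>" "fg_set G ?Z \<D> \<subseteq> fg_set G X' \<C>'"
      using fg_set_mono[OF X(1) Z _ basic_at_subset[OF X(2)]] fg_set_mono[OF X'(1) Z _ basic_at_subset[OF X'(2)]]
      by auto
    then show ?case using D Z X X' by blast
  next
    case (UN K)
    then show ?case by blast
  next
    case (Basis W)
    then consider A where "W = Inl ` A" | X \<C> where "X \<in> \<X>" "basic_at G X \<C>" "W = fg_set G X \<C>"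
      unfolding fg_basis_def by blast
    then show ?case
    proof cases
      case 1
      then show ?thesis using Basis by auto
    next
      case 2
      then show ?thesis using Basis(2) Inr_in_fg_set by blast
    qed
  qed simp
qed

lemma fg_set_vertex:
  assumes "basic_at G X \<C>"
  obtains v where "v \<in> V" "Inl (vertex_pt v) \<in> fg_set G X \<C>"
proof -
  obtain C where C: "C \<in> \<C>" using basic_at_nonempty[OF assms] by blast
  then have "C \<in> comps G X" using basic_at_subset[OF assms] by blast
  then obtain v where "v \<in> C" "v \<in> V" using comps_nonempty comps_subset(1) by blast
  then show ?thesis using that C by (auto simp: Inl_in_fg_set vertex_in_ostar_iff)
qed

text \<open>The family indexing a basic neighbourhood of a limit point is nonempty, and so are its
  components. Thus every such neighbourhood contains a vertex.\<close>

lemma FG_dense: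
  assumes "Inl ` points G \<subseteq> S"
  shows "FG G closure_of S = topspace (FG G)"
  unfolding dense_intersects_open
proof (intro allI impI)
  fix W assume W: "openin (FG G) W \<and> W \<noteq> {}"
  then obtain x where x: "x \<in> W" by blast
  then have "x \<in> Inl ` points G \<union> Inr ` filter_lim G" using W openin_subset topspace_FG by blast
  then consider p where "p \<in> points G" "x = Inl p" | F where "F \<in> filter_lim G" "x = Inr F" by blast
  then show "S \<inter> W \<noteq> {}"
  proof cases
    case 1
    then show ?thesis using x assms by blast
  next
    case 2
    then obtain X \<C> where "basic_at G X \<C>" "fg_set G X \<C> \<subseteq> W" using FG_nbhd_base W x by blast
    then obtain v where "v \<in> V" "Inl (vertex_pt v) \<in> W" using fg_set_vertex by blast
    then show ?thesis using assms vertex_in_points by blast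
  qed
qed

section \<open>Separation of vertices and limit points\<close>

lemma filter_lim_separate:
  assumes "F \<in> filter_lim G" "F' \<in> filter_lim G" "F \<noteq> F'"
  obtains X \<C> \<D> where "X \<in> \<X>" "basic_at G X \<C>" "\<C> \<in> F X" "basic_at G X \<D>" "\<D> \<in> F' X" "\<C> \<inter> \<D> = {}"
proof -
  obtain X where X: "X \<in> \<X>" "F X \<noteq> F' X" using filter_lim_eqI[OF assms(1,2)] assms(3) by blast
  obtain \<C> where C: "basic_at G X \<C>" "\<C> \<in> F X" "\<C> \<notin> F' X"
    using filters_at_distinct[OF filter_lim_at[OF assms(1) X(1)] filter_lim_at[OF assms(2) X(1)] X(2)] .
  obtain \<D> where "basic_at G X \<D>" "\<D> \<in> F' X" "\<C> \<inter> \<D> = {}"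
    using filters_at_separate[OF filter_lim_at[OF assms(2) X(1)] C(1,3)] .
  then show ?thesis using that X C by blast
qed

lemma basic_Union_disjoint:
  assumes "basic_at G X \<C>" "basic_at G X \<D>" "\<C> \<inter> \<D> = {}"
  shows "\<Union>\<C> \<inter> \<Union>\<D> = {}"
  using assms(3) basic_at_subset[OF assms(1)] basic_at_subset[OF assms(2)] comps_unique by blast

lemma Hausdorff_FG: "Hausdorff_space (subtopology (FG G) (topspace (FG G) - Inl ` inner_pts E))"
proof -
  let ?S = "topspace (FG G) - Inl ` inner_pts E"
  have S: "x \<in> Inl ` vertex_pt ` V \<union> Inr ` filter_lim G" if "x \<in> ?S" for x
    using that unfolding topspace_FG points_def by blast
  then have S': "(\<exists>v\<in>V. x = Inl (vertex_pt v)) \<or> (\<exists>F\<in>filter_lim G. x = Inr F)" if "x \<in> ?S" for x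
    using that by blast
  \<comment> \<open>Only common vertices and limit points are forbidden. The open sets chosen below
    may share inner edge points, as the stars of two adjacent vertices do.\<close>
  define sep where "sep x y \<longleftrightarrow> (\<exists>U W. openin (FG G) U \<and> openin (FG G) W \<and> x \<in> U \<and> y \<in> W \<and>
      U \<inter> W \<inter> (Inl ` vertex_pt ` V \<union> Inr ` filter_lim G) = {})" for x y
  have vv: "sep (Inl (vertex_pt u)) (Inl (vertex_pt v))" if "u \<in> V" "v \<in> V" "u \<noteq> v" for u v
    unfolding sep_def
    using that openin_FG_Inl[OF openin_ostar, of "{u}"] openin_FG_Inl[OF openin_ostar, of "{v}"]
    by (intro exI[of _ "Inl ` ostar G {u}"] exI[of _ "Inl ` ostar G {v}"])
       (auto simp: vertex_in_ostar_iff inj_image_mem_iff)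
  have vF: "sep (Inl (vertex_pt v)) (Inr F)" if v: "v \<in> V" and F: "F \<in> filter_lim G" for v F
  proof -
    \<comment> \<open>Deleting \<open>v\<close> itself suffices: no component of G - v contains
      \<open>v\<close>, whichever neighbourhood of \<open>F\<close> is taken at this level.\<close>
    have X: "{v} \<in> \<X>" using v by (simp add: finite_vsets_iff)
    obtain \<C> where C: "basic_at G {v} \<C>" "\<C> \<in> F {v}" using filter_lim_basic[OF F X] .
    have "v \<notin> \<Union>\<C>" using basic_at_subset[OF C(1)] comps_subset(2) by blast
    then have "Inl ` ostar G {v} \<inter> fg_set G {v} \<C> \<inter> (Inl ` vertex_pt ` V \<union> Inr ` filter_lim G) = {}"
      by (auto simp: Inl_in_fg_set vertex_in_ostar_iff)
    then show ?thesis
      unfolding sep_def using openin_FG_Inl[OF openin_ostar, of "{v}"] openin_FG_set[OF X C(1)] v F C(2)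
      by (intro exI[of _ "Inl ` ostar G {v}"] exI[of _ "fg_set G {v} \<C>"])
         (auto simp: Inr_in_fg_set vertex_in_ostar_iff)
  qed
  then have Fv: "sep (Inr F) (Inl (vertex_pt v))" if "v \<in> V" "F \<in> filter_lim G" for v F
    using that unfolding sep_def by (metis Int_commute)
  have FF: "sep (Inr F) (Inr F')" if F: "F \<in> filter_lim G" "F' \<in> filter_lim G" "F \<noteq> F'" for F F'
  proof -
    obtain X \<C> \<D> where X: "X \<in> \<X>" "basic_at G X \<C>" "\<C> \<in> F X" "basic_at G X \<D>" "\<D> \<in> F' X" "\<C> \<inter> \<D> = {}"
      using filter_lim_separate[OF F] .
    have "H \<in> filter_lim G \<Longrightarrow> \<C> \<in> H X \<Longrightarrow> \<D> \<notin> H X" for H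
      using filters_at_disjoint[OF filter_lim_at[OF _ X(1)]] X(6) by blast
    then have "fg_set G X \<C> \<inter> fg_set G X \<D> \<inter> (Inl ` vertex_pt ` V \<union> Inr ` filter_lim G) = {}"
      using basic_Union_disjoint[OF X(2,4,6)] by (auto simp: Inl_in_fg_set Inr_in_fg_set vertex_in_ostar_iff)
    then show ?thesis
      unfolding sep_def using openin_FG_set[OF X(1)] X F Inr_in_fg_set
      by (intro exI[of _ "fg_set G X \<C>"] exI[of _ "fg_set G X \<D>"]) auto
  qed
  have "sep x y" if "x \<in> ?S" "y \<in> ?S" "x \<noteq> y" for x y
    using S'[OF that(1)] S'[OF that(2)] by (elim disjE bexE) (use that(3) vv vF Fv FF in \<open>simp_all add: vertex_pt_inj\<close>)
  moreover have "\<exists>U W. openin (subtopology (FG G) ?S) U \<and> openin (subtopology (FG G) ?S) W \<and>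
      x \<in> U \<and> y \<in> W \<and> disjnt U W" if xy: "x \<in> ?S" "y \<in> ?S" "sep x y" for x y
  proof -
    obtain U W where UW: "openin (FG G) U" "openin (FG G) W" "x \<in> U" "y \<in> W"
      "U \<inter> W \<inter> (Inl ` vertex_pt ` V \<union> Inr ` filter_lim G) = {}" using xy(3) unfolding sep_def by blast
    have "disjnt (U \<inter> ?S) (W \<inter> ?S)" by (rule disjnt_Int_subset[OF UW(5)]) (use S in blast)
    then show ?thesis using xy(1,2) UW
      by (intro exI[of _ "U \<inter> ?S"] exI[of _ "W \<inter> ?S"] conjI openin_subtopology_Int IntI)
  qed
  ultimately show ?thesis unfolding Hausdorff_space_def by auto
qed

text \<open>Within the space of limit points every basic set is clopen, its complement being open by
  \<open>filters_at_separate\<close>. Two distinct limit points differ on such a set, so no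
  connected set contains both.\<close>

lemma totally_disconnected_FG:
  "totally_disconnected_space (subtopology (FG G) (topspace (FG G) - Inl ` topspace T))"
proof -
  have S: "topspace (FG G) - Inl ` topspace T = Inr ` filter_lim G"
    unfolding topspace_FG topspace_complex by blast
  let ?K = "subtopology (FG G) (Inr ` filter_lim G)"
  have top: "topspace ?K = Inr ` filter_lim G" by (auto simp: topspace_FG)
  have op: "openin ?K (Inr ` {F \<in> filter_lim G. \<C> \<in> F X})" if "X \<in> \<X>" "basic_at G X \<C>" for X \<C>
  proof -
    have "openin ?K (fg_set G X \<C> \<inter> Inr ` filter_lim G)"
      by (rule openin_subtopology_Int[OF openin_FG_set[OF that]])
    moreover have "fg_set G X \<C> \<inter> Inr ` filter_lim G = Inr ` {F \<in> filter_lim G. \<C> \<in> F X}"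
      by (auto simp: fg_set_def)
    ultimately show ?thesis by simp
  qed
  have cl: "closedin ?K (Inr ` {F \<in> filter_lim G. \<C> \<in> F X})" if X: "X \<in> \<X>" "basic_at G X \<C>" for X \<C>
  proof -
    have h: "\<exists>W. openin ?K W \<and> x \<in> W \<and> W \<subseteq> topspace ?K - Inr ` {F \<in> filter_lim G. \<C> \<in> F X}"
      if x: "x \<in> topspace ?K - Inr ` {F \<in> filter_lim G. \<C> \<in> F X}" for x
    proof -
      obtain F where F: "F \<in> filter_lim G" "x = Inr F" "\<C> \<notin> F X" using x unfolding top by blast
      obtain \<D> where D: "basic_at G X \<D>" "\<D> \<in> F X" "\<C> \<inter> \<D> = {}"
        using filters_at_separate[OF filter_lim_at[OF F(1) X(1)] X(2) F(3)] .
      have "\<C> \<notin> H X" if "H \<in> filter_lim G" "\<D> \<in> H X" for H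
        using filters_at_disjoint[OF filter_lim_at[OF that(1) X(1)] that(2)] D(3) by blast
      then show ?thesis unfolding top using op[OF X(1) D(1)] F D(2)
        by (intro exI[of _ "Inr ` {F \<in> filter_lim G. \<D> \<in> F X}"]) auto
    qed
    have "openin ?K (topspace ?K - Inr ` {F \<in> filter_lim G. \<C> \<in> F X})"
      by (rule openin_subopen[THEN iffD2]) (intro ballI h)
    then show ?thesis unfolding closedin_def top by blast
  qed
  have "y = x" if xy: "connected_component_of ?K x y" for x y
  proof (rule ccontr)
    assume "y \<noteq> x"
    obtain Q where Q: "connectedin ?K Q" "x \<in> Q" "y \<in> Q" using xy unfolding connected_component_of_def by blast
    then have "x \<in> topspace ?K" "y \<in> topspace ?K" using connectedin_subset_topspace by blast+
    then obtain F F' where F: "F \<in> filter_lim G" "F' \<in> filter_lim G" "x = Inr F" "y = Inr F'" unfolding top by blast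
    then have "F \<noteq> F'" using \<open>y \<noteq> x\<close> by blast
    then obtain X \<C> \<D> where X: "X \<in> \<X>" "basic_at G X \<C>" "\<C> \<in> F X" "\<D> \<in> F' X" "\<C> \<inter> \<D> = {}"
      using filter_lim_separate[OF F(1,2)] by metis
    have "\<C> \<notin> F' X" using filters_at_disjoint[OF filter_lim_at[OF F(2) X(1)] X(4)] X(5) by blast
    then show False
      using connectedin_clopen_cases[OF Q(1) cl[OF X(1,2)] op[OF X(1,2)]] Q(2,3) F X(3)
      by (auto simp: disjnt_iff)
  qed
  then show ?thesis
    unfolding S totally_disconnected_space_def by (auto simp: connected_component_of_refl)
qed

section \<open>The embedding of \<open>VG G\<close>\<close>

lemma VG_eq: "VG G = topology_generated_by (vg_basis G)"
proof -
  let ?L = "\<lambda>X \<omega>. Inl ` (induced_pts G (end_comp G X \<omega>) \<union> inner_pts_between G X (end_comp G X \<omega>))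
        \<union> Inr ` ends_in G X \<omega>"
  have "?L X \<omega> = vg_set G X \<omega>" if "X \<in> \<X>" "\<omega> \<in> ends G" for X \<omega>
    using comp_complex_eq_ostar[of "{end_comp G X \<omega>}" X] end_comp(1)[OF that(2,1)] by (simp add: vg_set_def)
  then have "(S = ?L X \<omega> \<and> X \<in> \<X> \<and> \<omega> \<in> ends G) \<longleftrightarrow> (S = vg_set G X \<omega> \<and> X \<in> \<X> \<and> \<omega> \<in> ends G)" for S X \<omega>
    by (cases "X \<in> \<X> \<and> \<omega> \<in> ends G") (simp_all only: simp_thms)
  then show ?thesis
    unfolding VG_def vg_basis_def by (simp only:)
qed

lemma topspace_VG: "topspace (VG G) = Inl ` points G \<union> Inr ` ends G"
proof
  have "W \<subseteq> Inl ` points G \<union> Inr ` ends G" if "W \<in> vg_basis G" for W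
  proof -
    from that consider A where "W = Inl ` A" "openin T A" | X \<omega> where "X \<in> \<X>" "\<omega> \<in> ends G" "W = vg_set G X \<omega>"
      unfolding vg_basis_def by blast
    then show ?thesis
    proof cases
      case 1
      then show ?thesis using openin_subset[of T] topspace_complex by blast
    next
      case (2 X \<omega>)
      then show ?thesis using ostar_subset_points[OF comps_subset(1)[OF end_comp(1)]]
        unfolding vg_set_def ends_in_def by blast
    qed
  qed
  then show "topspace (VG G) \<subseteq> Inl ` points G \<union> Inr ` ends G"
    unfolding VG_eq topology_generated_by_topspace by blast
  have "Inl ` points G \<in> vg_basis G"
    unfolding vg_basis_def using openin_topspace[of T] topspace_complex by (intro UnI1) auto
  moreover have "\<exists>W\<in>vg_basis G. Inr \<omega> \<in> W" if "\<omega> \<in> ends G" for \<omega>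
  proof (intro bexI)
    show "Inr \<omega> \<in> vg_set G {} \<omega>" using that by (simp add: vg_set_def ends_in_def)
    show "vg_set G {} \<omega> \<in> vg_basis G" using that empty_finite_vset unfolding vg_basis_def by blast
  qed
  ultimately show "Inl ` points G \<union> Inr ` ends G \<subseteq> topspace (VG G)"
    unfolding VG_eq topology_generated_by_topspace by blast
qed

lemma openin_VG_Inl: "openin T U \<Longrightarrow> openin (VG G) (Inl ` U)"
  unfolding VG_eq vg_basis_def by (intro topology_generated_by_Basis) blast

lemma openin_VG_set: "X \<in> \<X> \<Longrightarrow> \<omega> \<in> ends G \<Longrightarrow> openin (VG G) (vg_set G X \<omega>)"
  unfolding VG_eq vg_basis_def by (intro topology_generated_by_Basis) blast

lemma embedding_VG: "embedding_map (VG G) (FG G) (map_sum id (end_pt G))"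
proof -
  let ?i = "map_sum id (end_pt G)" and ?g = "map_sum id (inv_into (ends G) (end_pt G))"
  let ?S = "?i ` topspace (VG G)"
  have S: "?S = Inl ` points G \<union> Inr ` end_pt G ` ends G"
    unfolding topspace_VG by (simp add: image_Un image_image)
  have SF: "?S \<subseteq> topspace (FG G)"
    unfolding S topspace_FG using end_pt_in_filter_lim by blast
  have cont: "continuous_map (VG G) (FG G) ?i"
    unfolding FG_eq
  proof (rule continuous_on_generated_topo)
    show "?i ` topspace (VG G) \<subseteq> \<Union>(fg_basis G)"
      using SF unfolding FG_eq topology_generated_by_topspace .
    fix W assume "W \<in> fg_basis G"
    then consider A where "W = Inl ` A" "openin T A" | X \<C> where "X \<in> \<X>" "basic_at G X \<C>" "W = fg_set G X \<C>"
      unfolding fg_basis_def by blast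
    then show "openin (VG G) (?i -` W \<inter> topspace (VG G))"
    proof cases
      case 1
      then have "?i -` W \<inter> topspace (VG G) = Inl ` A"
        using openin_subset[OF 1(2)] unfolding topspace_VG topspace_complex by auto
      then show ?thesis using openin_VG_Inl 1 by simp
    next
      case (2 X \<C>)
      \<comment> \<open>\<open>\<C>\<close> may consist of many components, whereas a basic set of
        \<open>VG G\<close> uses one. The preimage is therefore assembled from an open star in the
        1-complex and one basic set for each end that lives in a member of
        \<open>\<C>\<close>.\<close>
      let ?O = "{\<omega> \<in> ends G. end_comp G X \<omega> \<in> \<C>}"
      have "?i -` W \<inter> topspace (VG G) = Inl ` ostar G (\<Union>\<C>) \<union> Inr ` ?O"
        using ostar_subset_points[OF basic_at_Union_subset[OF 2(2)]]
          end_pt_mem[OF _ 2(1) basic_at_subset[OF 2(2)]] end_pt_in_filter_lim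
        unfolding topspace_VG 2(3) by (auto simp: Inl_in_fg_set Inr_in_fg_set)
      also have "\<dots> = Inl ` ostar G (\<Union>\<C>) \<union> (\<Union>\<omega>\<in>?O. vg_set G X \<omega>)"
      proof -
        have "ostar G (end_comp G X \<omega>) \<subseteq> ostar G (\<Union>\<C>)" if "\<omega> \<in> ?O" for \<omega>
          using that by (intro ostar_mono) blast
        moreover have "\<omega> \<in> ends_in G X \<omega>" "ends_in G X \<omega> \<subseteq> ?O" if "\<omega> \<in> ?O" for \<omega>
          using that by (auto simp: ends_in_def)
        ultimately show ?thesis unfolding vg_set_def by blast
      qed
      finally show ?thesis
        using openin_VG_Inl[OF openin_ostar[OF basic_at_Union_subset[OF 2(2)]]] openin_VG_set[OF 2(1)]
        by (auto intro!: openin_Un openin_Union)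
    qed
  qed
  have inv: "inv_into (ends G) (end_pt G) (end_pt G \<omega>) = \<omega>" if "\<omega> \<in> ends G" for \<omega>
    using that inj_on_end_pt by (rule inv_into_f_f[rotated])
  have gi: "?g (?i x) = x" if "x \<in> topspace (VG G)" for x
    using that inv unfolding topspace_VG by auto
  have topS: "topspace (subtopology (FG G) ?S) = ?S" using SF by auto
  have "continuous_map (subtopology (FG G) ?S) (topology_generated_by (vg_basis G)) ?g"
  proof (rule continuous_on_generated_topo)
    show "?g ` topspace (subtopology (FG G) ?S) \<subseteq> \<Union>(vg_basis G)"
      using gi unfolding topS topology_generated_by_topspace[symmetric] VG_eq[symmetric] by auto
    fix W assume W: "W \<in> vg_basis G"
    then consider A where "W = Inl ` A" "openin T A" | X \<omega> where "X \<in> \<X>" "\<omega> \<in> ends G" "W = vg_set G X \<omega>"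
      unfolding vg_basis_def by blast
    then show "openin (subtopology (FG G) ?S) (?g -` W \<inter> topspace (subtopology (FG G) ?S))"
    proof cases
      case 1
      have "?g -` W \<inter> ?S = Inl ` A \<inter> ?S" unfolding S 1(1) using inv by auto
      then show ?thesis unfolding topS using openin_subtopology_Int[OF openin_FG_Inl[OF 1(2)]] by simp
    next
      case (2 X \<omega>)
      \<comment> \<open>In the other direction a basic set of \<open>VG G\<close> is the trace of
        the basic set of \<open>FG G\<close> for a singleton family.\<close>
      note c = end_comp(1)[OF 2(2,1)]
      have "?g -` W \<inter> ?S = fg_set G X {end_comp G X \<omega>} \<inter> ?S"
        unfolding S 2(3) vg_set_def ends_in_def
        using inv end_pt_in_filter_lim end_pt_mem[OF _ 2(1), of _ "{end_comp G X \<omega>}"] c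
        by (auto simp: Inl_in_fg_set Inr_in_fg_set)
      then show ?thesis unfolding topS
        using openin_subtopology_Int[OF openin_FG_set[OF 2(1) basic_at_sing[OF c]]] by simp
    qed
  qed
  then have contg: "continuous_map (subtopology (FG G) ?S) (VG G) ?g" by (simp only: VG_eq)
  have "homeomorphic_maps (VG G) (subtopology (FG G) ?S) ?i ?g"
    unfolding homeomorphic_maps_def
    using cont contg gi by (auto simp: continuous_map_in_subtopology)
  then show ?thesis unfolding embedding_map_def homeomorphic_map_maps by blast
qed

lemma Omega_compactification_FG: "Omega_compactification G (FG G) (map_sum id (end_pt G))"
proof -
  have "map_sum id (end_pt G) ` Inl ` inner_pts E = Inl ` inner_pts E" by (simp add: image_image)
  moreover have "Inl ` points G \<subseteq> map_sum id (end_pt G) ` topspace (VG G)"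
    unfolding topspace_VG by (simp add: image_Un image_image)
  ultimately show ?thesis
    unfolding Omega_compactification_def
    using compact_space_FG embedding_VG FG_dense Hausdorff_FG by simp
qed

end

section \<open>Locally finite connected graphs\<close>

locale lf_graph = sgraph +
  assumes lf: "locally_finite_graph G" and conn: "connected_graph G"
begin

definition nbrs :: "'a set \<Rightarrow> 'a set" where
  "nbrs A = {u. \<exists>v\<in>A. {v, u} \<in> E}"

lemma finite_nbrs:
  assumes "finite A" "A \<subseteq> V"
  shows "finite (nbrs A)" "nbrs A \<subseteq> V"
proof -
  have "finite (nbrs A)"
  proof (rule finite_subset)
    show "nbrs A \<subseteq> (\<Union>v\<in>A. \<Union>{e \<in> E. v \<in> e})" by (auto simp: nbrs_def)
    have "finite e" if "e \<in> E" for e using that edge_obtain by blast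
    then show "finite (\<Union>v\<in>A. \<Union>{e \<in> E. v \<in> e})"
      using assms lf by (auto simp: locally_finite_graph_def)
  qed
  then show "finite (nbrs A)" "nbrs A \<subseteq> V" using edge_verts by (auto simp: nbrs_def)
qed

lemma comps_isolated:
  assumes "C \<in> comps G X" "nbh G C = {}"
  shows "C = V"
proof -
  obtain v where v: "v \<in> C" using comps_nonempty[OF assms(1)] by blast
  have "w \<in> C" if "w \<in> V" for w
  proof -
    have "(v, w) \<in> (adj_minus G {})\<^sup>*"
      using conn v that comps_subset(1)[OF assms(1)] by (auto simp: connected_graph_def)
    then show ?thesis
    proof induction
      case base then show ?case using v .
    next
      case (step y z)
      then have "{y, z} \<in> E" by (auto simp: adj_minus_def)
      then show ?case using step.IH assms(2) edge_verts unfolding nbh_def by blast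
    qed
  qed
  then show ?thesis using comps_subset(1)[OF assms(1)] by blast
qed

text \<open>A component with a neighbour has it in \<open>X\<close> and so meets the finite set
  \<open>nbrs X\<close>, which only finitely many components can do. A component without neighbours
  is all of \<open>V\<close> by connectedness; the extra element \<open>V\<close> accounts for this
  case, for example when \<open>X\<close> is empty.\<close>

lemma finite_comps:
  assumes X: "X \<in> \<X>"
  shows "finite (comps G X)"
proof (rule finite_subset)
  show "comps G X \<subseteq> insert V {C \<in> comps G X. C \<inter> nbrs X \<noteq> {}}"
  proof
    fix C assume C: "C \<in> comps G X"
    show "C \<in> insert V {C \<in> comps G X. C \<inter> nbrs X \<noteq> {}}"
    proof (cases "nbh G C = {}")
      case True
      then show ?thesis using comps_isolated[OF C] by simp
    next
      case False
      then obtain u v where "u \<in> C" "v \<in> nbh G C" "{u, v} \<in> E" by (auto simp: nbh_def)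
      then have "u \<in> C \<inter> nbrs X" using nbh_comps[OF C] by (auto simp: nbrs_def insert_commute)
      then show ?thesis using C by blast
    qed
  qed
  show "finite (insert V {C \<in> comps G X. C \<inter> nbrs X \<noteq> {}})"
    using finite_comps_meeting finite_nbrs(1) X by (simp add: finite_vsets_iff)
qed

section \<open>Limit points as ends\<close>

lemma crit_empty: "X \<in> \<X> \<Longrightarrow> crit G X = {}"
  using finite_subset[OF comps_nbh_subset finite_comps] by (auto simp: crit_def)

text \<open>As \<open>X\<close> varies this is a direction of the graph: a choice of one component
  of each G - X that is monotone in \<open>X\<close>.\<close>

definition dir :: "('a set \<Rightarrow> 'a set set set) \<Rightarrow> 'a set \<Rightarrow> 'a set" where
  "dir F X = (THE C. C \<in> comps G X \<and> F X = princ_filter G X C)"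

lemma dir_eqI: "C \<in> comps G X \<Longrightarrow> F X = princ_filter G X C \<Longrightarrow> dir F X = C"
  unfolding dir_def using princ_filter_inj by (intro the_equality) auto

lemma dir:
  assumes "F \<in> filter_lim G" "X \<in> \<X>"
  shows "dir F X \<in> comps G X" "F X = princ_filter G X (dir F X)"
proof -
  obtain C where "C \<in> comps G X" "F X = princ_filter G X C"
    using filter_lim_at[OF assms] crit_empty[OF assms(2)] by (auto simp: filters_at_def)
  then show "dir F X \<in> comps G X" "F X = princ_filter G X (dir F X)" using dir_eqI[of C X F] by auto
qed

lemma sing_mem_iff_dir:
  assumes "F \<in> filter_lim G" "X \<in> \<X>" "C \<in> comps G X"
  shows "{C} \<in> F X \<longleftrightarrow> C = dir F X"
  using dir[OF assms(1,2)] assms(3) by (auto simp: princ_filter_def)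

lemma dir_mono:
  assumes F: "F \<in> filter_lim G" and X: "X \<in> \<X>" "X' \<in> \<X>" "X \<subseteq> X'"
  shows "dir F X' \<subseteq> dir F X"
proof -
  have "{dir F X} \<in> F X" using sing_mem_iff_dir[OF F X(1)] dir(1)[OF F X(1)] by blast
  then have "comps_inside G X' {dir F X} \<in> F X'" using filter_lim_refine[OF F X] by blast
  then have "dir F X' \<in> comps_inside G X' {dir F X}"
    unfolding dir(2)[OF F X(2)] by (simp add: princ_filter_def)
  then show ?thesis by (simp add: comps_inside_def)
qed

lemma basic_at_iff: "X \<in> \<X> \<Longrightarrow> basic_at G X \<C> \<longleftrightarrow> (\<exists>C\<in>comps G X. \<C> = {C})"
  by (simp add: basic_at_def crit_empty)

text \<open>The witness is the distance from \<open>v0\<close>. What the ray construction takes from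
  it is that layer 0 is the root alone and that each later vertex has a neighbour one layer
  below.\<close>

lemma rooted_layers:
  assumes v0: "v0 \<in> V"
  shows "\<exists>d :: 'a \<Rightarrow> nat. d v0 = 0 \<and> (\<forall>v\<in>V. d v = 0 \<longrightarrow> v = v0) \<and>
    (\<forall>v\<in>V. \<forall>n. d v = Suc n \<longrightarrow> (\<exists>u. {u, v} \<in> E \<and> d u = n))"
proof -
  let ?R = "adj_minus G {}"
  define d where "d v = (LEAST n. (v0, v) \<in> ?R ^^ n)" for v
  have ex: "(v0, v) \<in> ?R ^^ d v" if "v \<in> V" for v
  proof -
    have "(v0, v) \<in> ?R\<^sup>*" using conn v0 that by (auto simp: connected_graph_def)
    then obtain n where "(v0, v) \<in> ?R ^^ n" using rtrancl_power by blast
    then show ?thesis unfolding d_def by (rule LeastI)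
  qed
  have le: "d v \<le> n" if "(v0, v) \<in> ?R ^^ n" for v n unfolding d_def using that by (rule Least_le)
  show ?thesis
  proof (intro exI[of _ d] conjI ballI allI impI)
    show "d v0 = 0" using le[of v0 0] by simp
    show "v = v0" if "v \<in> V" "d v = 0" for v using ex[OF that(1)] that(2) by simp
    fix v n assume v: "v \<in> V" "d v = Suc n"
    then have "(v0, v) \<in> ?R ^^ Suc n" using ex by metis
    then obtain u where u: "(v0, u) \<in> ?R ^^ n" "(u, v) \<in> ?R" by auto
    then have uv: "{u, v} \<in> E" by (simp add: adj_minus_def)
    have "(v0, v) \<in> ?R ^^ Suc (d u)" using ex[OF edge_verts(1)[OF uv]] u(2) by auto
    then have "Suc n \<le> Suc (d u)" using le v(2) by metis
    then have "d u = n" using le[OF u(1)] by simp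
    then show "\<exists>u. {u, v} \<in> E \<and> d u = n" using uv by blast
  qed
qed

text \<open>The balls \<open>B n\<close> are finite by local finiteness and cofinal among the finite
  vertex sets, so it suffices to follow the sequence of components \<open>C n\<close>. Directing
  edges away from the root makes every infinite directed walk injective.\<close>

lemma filter_lim_is_end:
  assumes F: "F \<in> filter_lim G"
  shows "F \<in> end_pt G ` ends G"
proof -
  obtain v0 where v0: "v0 \<in> V"
    using dir(1)[OF F empty_finite_vset] comps_nonempty comps_subset(1) by blast
  obtain d :: "'a \<Rightarrow> nat" where d0: "d v0 = 0" and d0': "\<And>v. v \<in> V \<Longrightarrow> d v = 0 \<Longrightarrow> v = v0"
    and dS: "\<And>v n. v \<in> V \<Longrightarrow> d v = Suc n \<Longrightarrow> \<exists>u. {u, v} \<in> E \<and> d u = n"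
    using rooted_layers[OF v0] by blast
  define B where "B n = {v \<in> V. d v \<le> n}" for n
  have finB: "finite (B n)" for n
  proof (induction n)
    case 0
    have "B 0 \<subseteq> {v0}" using d0' by (auto simp: B_def)
    then show ?case by (rule finite_subset) simp
  next
    case (Suc n)
    have "B (Suc n) \<subseteq> B n \<union> nbrs (B n)"
    proof
      fix v assume v: "v \<in> B (Suc n)"
      show "v \<in> B n \<union> nbrs (B n)"
      proof (cases "d v = Suc n")
        case True
        then obtain u where u: "{u, v} \<in> E" "d u = n" using dS v by (auto simp: B_def)
        then have "u \<in> B n" using edge_verts(1)[OF u(1)] by (simp add: B_def)
        then show ?thesis using u(1) by (auto simp: nbrs_def)
      qed (use v in \<open>auto simp: B_def\<close>)
    qed
    then show ?case using finite_nbrs(1)[OF Suc] Suc by (auto simp: B_def intro: finite_subset)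
  qed
  have B: "B n \<in> \<X>" for n using finB by (auto simp: finite_vsets_iff B_def)
  have Bmono: "B m \<subseteq> B n" if "m \<le> n" for m n using that by (auto simp: B_def)
  define C where "C n = dir F (B n)" for n
  have C: "C n \<in> comps G (B n)" for n unfolding C_def by (rule dir(1)[OF F B])
  have Cmono: "C n \<subseteq> C m" if "m \<le> n" for m n unfolding C_def by (rule dir_mono[OF F B B Bmono[OF that]])
  have Cd: "v \<in> V" "n < d v" if "v \<in> C n" for v n
    using that comps_subset[OF C[of n]] by (auto simp: B_def not_le[symmetric])
  define D where "D = {(u, v). {u, v} \<in> E \<and> d v = Suc (d u)}"
  have reach: "(v0, v) \<in> D\<^sup>*" if "v \<in> V" for v
    using that
  proof (induction "d v" arbitrary: v)
    case 0
    then show ?case using d0' by simp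
  next
    case (Suc n)
    then obtain u where "{u, v} \<in> E" "d u = n" using dS by metis
    then have "(v0, u) \<in> D\<^sup>*" "(u, v) \<in> D" using Suc edge_verts(1) by (auto simp: D_def)
    then show ?case by (rule rtrancl_into_rtrancl)
  qed
  define good where "good v \<longleftrightarrow> v \<in> V \<and> (\<forall>m. \<exists>w\<in>C m. (v, w) \<in> D\<^sup>*)" for v
  have good0: "good v0" using v0 reach comps_nonempty[OF C] Cd(1) unfolding good_def by blast
  have step: "\<exists>u. (v, u) \<in> D \<and> good u" if v: "good v" for v
  proof (rule ccontr)
    assume neg: "\<not> ?thesis"
    have "\<exists>m. \<forall>w\<in>C m. (u, w) \<notin> D\<^sup>*" if "(v, u) \<in> D" for u
      using neg that edge_verts unfolding good_def D_def by blast
    then obtain m where m: "\<And>u w. (v, u) \<in> D \<Longrightarrow> w \<in> C (m u) \<Longrightarrow> (u, w) \<notin> D\<^sup>*" by metis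
    have "{u. (v, u) \<in> D} \<subseteq> nbrs {v}" by (auto simp: D_def nbrs_def)
    then have fin: "finite {u. (v, u) \<in> D}"
      using finite_nbrs(1)[of "{v}"] v finite_subset by (auto simp: good_def)
    \<comment> \<open>If each of the finitely many successors \<open>u\<close> lost contact with
      some \<open>C (m u)\<close>, then \<open>C M\<close> would be out of reach through all of
      them. Including \<open>d v\<close> puts \<open>C M\<close> strictly beyond the layer of
      \<open>v\<close>, so the path from \<open>v\<close> to it has a first edge.\<close>
    define M where "M = Max (insert (d v) (m ` {u. (v, u) \<in> D}))"
    have M: "d v \<le> M" "\<And>u. (v, u) \<in> D \<Longrightarrow> m u \<le> M" using fin by (auto simp: M_def)
    obtain w where w: "w \<in> C M" "(v, w) \<in> D\<^sup>*" using v by (auto simp: good_def)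
    have "v \<noteq> w" using Cd(2)[OF w(1)] M(1) by auto
    then obtain u where u: "(v, u) \<in> D" "(u, w) \<in> D\<^sup>*" using w(2) by (metis converse_rtranclE)
    then show False using m[OF u(1)] Cmono[OF M(2)[OF u(1)]] w(1) by blast
  qed
  obtain r where r: "r 0 = v0" "\<And>n. good (r n)" "\<And>n. (r n, r (Suc n)) \<in> D"
  proof -
    have "\<exists>r. \<forall>n. (good (r n) \<and> (n = 0 \<longrightarrow> r n = v0)) \<and> (r n, r (Suc n)) \<in> D"
      \<comment> \<open>The clause for \<open>n = 0\<close> starts the walk at the root, so that
        \<open>r n\<close> lies in layer \<open>n\<close> and \<open>r\<close> is injective.\<close>
      by (rule dependent_nat_choice[of "\<lambda>n x. good x \<and> (n = 0 \<longrightarrow> x = v0)" "\<lambda>n x y. (x, y) \<in> D"])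
         (use good0 step in auto)
    then show ?thesis using that by blast
  qed
  have dr: "d (r n) = n" for n
  proof (induction n)
    case (Suc n)
    then show ?case using r(3)[of n] by (simp add: D_def)
  qed (simp add: r(1) d0)
  have ray: "r \<in> rays G"
    using r(3) edge_verts(1) dr unfolding rays_def D_def by (auto simp: inj_def) metis
  \<comment> \<open>Layers increase along a directed path, so a path from \<open>r k\<close> into
    \<open>C n\<close> avoids \<open>B n\<close>. Traced backwards from its end in
    \<open>C n\<close>, it never leaves this component.\<close>
  have tail: "r k \<in> C n" if "n < k" for n k
  proof -
    obtain w where w: "w \<in> C n" "(r k, w) \<in> D\<^sup>*" using r(2)[of k] by (auto simp: good_def)
    have "n < d x \<longrightarrow> x \<in> C n" if "(x, w) \<in> D\<^sup>*" for x
      using that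
    proof (induction rule: converse_rtrancl_induct)
      case base
      then show ?case using w by simp
    next
      case (step y z)
      have yz: "{z, y} \<in> E" "d z = Suc (d y)" using step(1) by (auto simp: D_def insert_commute)
      show ?case
      proof
        assume "n < d y"
        then show "y \<in> C n" using step.IH yz comps_edge[OF C _ yz(1)] by (auto simp: B_def)
      qed
    qed
    then show ?thesis using w(2) dr that by simp
  qed
  define \<omega> where "\<omega> = ray_equiv G `` {r}"
  have w: "\<omega> \<in> ends G" unfolding \<omega>_def ends_def using ray by (rule quotientI)
  have rw: "r \<in> \<omega>" unfolding \<omega>_def using equiv_class_self[OF equiv_ray_equiv ray] .
  have endC: "end_comp G (B n) \<omega> = C n" for n
  proof (rule tail_comp_unique[OF end_comp(2)[OF w B rw] _ end_comp(1)[OF w B] C])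
    show "has_tail_in r (C n)" unfolding has_tail_in_def using tail by (intro exI[of _ "Suc n"]) auto
  qed
  have "end_comp G X \<omega> = dir F X" if X: "X \<in> \<X>" for X
  proof -
    \<comment> \<open>For empty \<open>X\<close> the maximum is an unspecified number, but the
      inclusion is then trivial.\<close>
    have "X \<subseteq> B (Max (d ` X))" using X by (auto simp: B_def finite_vsets_iff)
    then obtain n where n: "X \<subseteq> B n" by blast
    have "C n \<subseteq> dir F X" "C n \<subseteq> end_comp G X \<omega>"
      using dir_mono[OF F X B n] end_comp_mono[OF w X B n] endC by (auto simp: C_def)
    then show ?thesis
      using comps_coarser_unique[OF n C] end_comp(1)[OF w X] dir(1)[OF F X] by blast
  qed
  then have "end_pt G \<omega> = F"
    using dir(2)[OF F] end_pt_apply by (intro filter_lim_eqI[OF end_pt_in_filter_lim[OF w] F]) simp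
  then show ?thesis using w by blast
qed

lemma filter_lim_eq_ends: "filter_lim G = end_pt G ` ends G"
  using filter_lim_is_end end_pt_in_filter_lim by blast

subsection \<open>The Freudenthal compactification\<close>

text \<open>Finitely many open stars of single vertices cover \<open>K\<close>. By local finiteness
  each of them lies in a finite induced subgraph, namely on its centre and the neighbours of the
  centre.\<close>

lemma compactin_subset_induced:
  assumes K: "compactin T K"
  shows "\<exists>X\<in>\<X>. K \<subseteq> induced_pts G X"
proof -
  let ?U = "(\<lambda>v. ostar G {v}) ` V"
  have "points G \<subseteq> \<Union>?U"
  proof
    fix p assume "p \<in> points G"
    then show "p \<in> \<Union>?U"
    proof (cases rule: points_cases)
      case (1 v)
      then show ?thesis by (auto simp: vertex_in_ostar_iff)
    next
      case (2 u v t)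
      then show ?thesis using edge_verts(1)[OF 2(1)] by (auto simp: edge_in_ostar_iff)
    qed
  qed
  then have sub: "K \<subseteq> \<Union>?U" using compactin_subset_topspace[OF K] topspace_complex by blast
  have "openin T U" if "U \<in> ?U" for U using that openin_ostar by auto
  then obtain \<F> where F: "finite \<F>" "\<F> \<subseteq> ?U" "K \<subseteq> \<Union>\<F>" using compactinD[OF K _ sub] by metis
  then obtain A where A: "A \<subseteq> V" "finite A" "\<F> = (\<lambda>v. ostar G {v}) ` A"
    using finite_subset_image[OF F(1,2)] by blast
  let ?X = "A \<union> nbrs A"
  have "ostar G {v} \<subseteq> induced_pts G ?X" if v: "v \<in> A" for v
  proof -
    have "{e \<in> E. e \<inter> {v} \<noteq> {}} \<subseteq> {e \<in> E. e \<subseteq> ?X}"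
    proof
      fix e assume "e \<in> {e \<in> E. e \<inter> {v} \<noteq> {}}"
      then have e: "e \<in> E" "v \<in> e" by auto
      then obtain x y where "e = {x, y}" using edge_obtain by blast
      then obtain w where "e = {v, w}" using e(2) by (cases "v = x") auto
      then show "e \<in> {e \<in> E. e \<subseteq> ?X}" using e v by (auto simp: nbrs_def)
    qed
    then show ?thesis using inner_pts_mono v unfolding ostar_def induced_pts_def by blast
  qed
  then have "K \<subseteq> induced_pts G ?X" using F(3) A(3) by blast
  moreover have "?X \<in> \<X>" using finite_nbrs[OF A(2,1)] A by (simp add: finite_vsets_iff)
  ultimately show ?thesis by blast
qed

lemma component_in_compl_comps:
  assumes "X \<in> \<X>" "K \<subseteq> induced_pts G X" "C \<in> comps G X"
  shows "\<exists>D\<in>compl_comps T K. ostar G C \<subseteq> D"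
proof -
  have "ostar G C \<subseteq> topspace T - K" using compl_induced[of X] assms(2,3) by blast
  then have c: "connectedin (subtopology T (topspace T - K)) (ostar G C)"
    using connectedin_ostar[OF assms(3)] by (simp add: connectedin_subtopology)
  have "ostar G C \<noteq> {}" using comps_nonempty[OF assms(3)] by (simp add: ostar_def)
  then have "topspace (subtopology T (topspace T - K)) \<noteq> {}" using connectedin_subset_topspace[OF c] by blast
  then have "subtopology T (topspace T - K) \<noteq> trivial_topology"
    unfolding null_topspace_iff_trivial[symmetric] .
  then show ?thesis
    using exists_connected_component_of_superset[OF c] unfolding compl_comps_def by blast
qed

lemma compl_comps_unique:
  assumes "D \<in> compl_comps T K" "D' \<in> compl_comps T K" "S \<subseteq> D" "S \<subseteq> D'" "S \<noteq> {}"
  shows "D = D'"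
  using assms pairwise_disjoint_connected_components_of unfolding compl_comps_def
  by (metis connected_components_of_overlap inf.bounded_iff subset_empty)

text \<open>The value at \<open>K\<close> is read off at any finite \<open>X\<close> whose induced
  subgraph includes \<open>K\<close>. The restriction to compact \<open>K\<close> matches the
  extensional functions in \<open>top_ends\<close>, so that equality of ends is equality of
  functions.\<close>

definition top_end :: "('a set \<Rightarrow> 'a set set set) \<Rightarrow> 'a pt set \<Rightarrow> 'a pt set" where
  "top_end F = (\<lambda>K\<in>{K. compactin T K}.
     THE D. D \<in> compl_comps T K \<and> (\<exists>X\<in>\<X>. K \<subseteq> induced_pts G X \<and> ostar G (dir F X) \<subseteq> D))"

lemma ostar_dir_nonempty: "F \<in> filter_lim G \<Longrightarrow> X \<in> \<X> \<Longrightarrow> ostar G (dir F X) \<noteq> {}"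
  using comps_nonempty[OF dir(1)] by (simp add: ostar_def)

text \<open>Existence uses one sufficiently large \<open>X\<close>. Independence of that choice
  comes from comparing \<open>X\<close> and \<open>X'\<close> with their union: its chosen component
  has a nonempty star inside both candidates.\<close>

lemma top_end_ex1:
  assumes F: "F \<in> filter_lim G" and K: "compactin T K"
  shows "\<exists>!D. D \<in> compl_comps T K \<and> (\<exists>X\<in>\<X>. K \<subseteq> induced_pts G X \<and> ostar G (dir F X) \<subseteq> D)"
proof -
  obtain X where X: "X \<in> \<X>" "K \<subseteq> induced_pts G X" using compactin_subset_induced[OF K] by blast
  obtain D where D: "D \<in> compl_comps T K" "ostar G (dir F X) \<subseteq> D"
    using component_in_compl_comps[OF X dir(1)[OF F X(1)]] by blast
  show ?thesis
  proof (rule ex1I[of _ D])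
    show "D \<in> compl_comps T K \<and> (\<exists>X\<in>\<X>. K \<subseteq> induced_pts G X \<and> ostar G (dir F X) \<subseteq> D)"
      using D X by blast
    fix D' assume "D' \<in> compl_comps T K \<and> (\<exists>X\<in>\<X>. K \<subseteq> induced_pts G X \<and> ostar G (dir F X) \<subseteq> D')"
    then obtain X' where D': "D' \<in> compl_comps T K" and X': "X' \<in> \<X>" "ostar G (dir F X') \<subseteq> D'" by blast
    have Z: "X \<union> X' \<in> \<X>" using X X' by (simp add: finite_vsets_iff)
    have "ostar G (dir F (X \<union> X')) \<subseteq> D" "ostar G (dir F (X \<union> X')) \<subseteq> D'"
      using ostar_mono[OF dir_mono[OF F X(1) Z]] ostar_mono[OF dir_mono[OF F X'(1) Z]] D(2) X'(2) by blast+
    then show "D' = D" using compl_comps_unique[OF D' D(1)] ostar_dir_nonempty[OF F Z] by blast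
  qed
qed

lemma top_end:
  assumes F: "F \<in> filter_lim G" and K: "compactin T K"
  shows "top_end F K \<in> compl_comps T K"
    and "X \<in> \<X> \<Longrightarrow> K \<subseteq> induced_pts G X \<Longrightarrow> ostar G (dir F X) \<subseteq> top_end F K"
    and "D \<in> compl_comps T K \<Longrightarrow> X \<in> \<X> \<Longrightarrow> K \<subseteq> induced_pts G X \<Longrightarrow> ostar G (dir F X) \<subseteq> D \<Longrightarrow>
      top_end F K = D"
proof -
  have e: "top_end F K = (THE D. D \<in> compl_comps T K \<and> (\<exists>X\<in>\<X>. K \<subseteq> induced_pts G X \<and> ostar G (dir F X) \<subseteq> D))"
    using K by (simp add: top_end_def)
  show "top_end F K \<in> compl_comps T K" unfolding e using theI'[OF top_end_ex1[OF F K]] by blast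
  show eq: "top_end F K = D" if "D \<in> compl_comps T K" "X \<in> \<X>" "K \<subseteq> induced_pts G X" "ostar G (dir F X) \<subseteq> D" for X D
    unfolding e by (rule the1_equality[OF top_end_ex1[OF F K]]) (use that in blast)
  assume X: "X \<in> \<X>" "K \<subseteq> induced_pts G X"
  obtain D where D: "D \<in> compl_comps T K" "ostar G (dir F X) \<subseteq> D"
    using component_in_compl_comps[OF X dir(1)[OF F X(1)]] by blast
  then show "ostar G (dir F X) \<subseteq> top_end F K" using eq[OF D(1) X D(2)] by simp
qed

lemma top_end_induced:
  assumes F: "F \<in> filter_lim G" and X: "X \<in> \<X>"
  shows "top_end F (induced_pts G X) = ostar G (dir F X)"
  by (rule top_end(3)[OF F compactin_induced[OF X] _ X]) (use dir(1)[OF F X] compl_comps_induced in auto)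

lemma top_end_in_top_ends:
  assumes F: "F \<in> filter_lim G"
  shows "top_end F \<in> top_ends T"
proof -
  have "top_end F K' \<subseteq> top_end F K" if K: "compactin T K" "compactin T K'" "K \<subseteq> K'" for K K'
  proof -
    obtain X where X: "X \<in> \<X>" "K' \<subseteq> induced_pts G X" using compactin_subset_induced[OF K(2)] by blast
    let ?S = "subtopology T (topspace T - K)"
    have c': "top_end F K' \<in> connected_components_of (subtopology T (topspace T - K'))"
      using top_end(1)[OF F K(2)] by (simp add: compl_comps_def)
    have "connectedin T (top_end F K')" "top_end F K' \<subseteq> topspace T - K'"
      using connectedin_connected_components_of[OF c'] by (auto simp: connectedin_subtopology)
    then have "connectedin ?S (top_end F K')" using K(3) by (auto simp: connectedin_subtopology)
    \<comment> \<open>Both components contain the star chosen at one \<open>X\<close> that is large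
      enough for \<open>K'\<close>, hence also for \<open>K\<close>.\<close>
    moreover have "\<not> disjnt (top_end F K) (top_end F K')"
      using top_end(2)[OF F K(2) X] top_end(2)[OF F K(1) X(1) order_trans[OF K(3) X(2)]]
        ostar_dir_nonempty[OF F X(1)] unfolding disjnt_def by blast
    ultimately show ?thesis
      using connected_components_of_maximal[of "top_end F K" ?S] top_end(1)[OF F K(1)] by (simp add: compl_comps_def)
  qed
  moreover have "top_end F \<in> Pi\<^sub>E {K. compactin T K} (compl_comps T)"
    using top_end(1)[OF F] by (intro PiE_I) (auto simp: top_end_def)
  ultimately show ?thesis by (simp add: top_ends_def)
qed

lemma inj_on_top_end: "inj_on top_end (filter_lim G)"
proof (rule inj_onI)
  fix F F' assume F: "F \<in> filter_lim G" "F' \<in> filter_lim G" and eq: "top_end F = top_end F'"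
  show "F = F'"
  proof (rule filter_lim_eqI[OF F])
    fix X assume X: "X \<in> \<X>"
    have "ostar G (dir F X) = ostar G (dir F' X)" using top_end_induced[OF _ X] F eq by metis
    then have "dir F X = dir F' X" using ostar_subset_iff by (metis subset_antisym order_refl)
    then show "F X = F' X" using dir(2)[OF F(1) X] dir(2)[OF F(2) X] by simp
  qed
qed

text \<open>The values of \<open>\<epsilon>\<close> at the finite induced subgraphs are stars of
  components, and their monotonicity gives a point of the inverse limit. Since these subgraphs are
  cofinal among the compact sets, they determine \<open>\<epsilon>\<close> at every
  \<open>K\<close>.\<close>

lemma top_end_surj:
  assumes \<epsilon>: "\<epsilon> \<in> top_ends T"
  shows "\<epsilon> \<in> top_end ` filter_lim G"
proof -
  have comp: "\<epsilon> K \<in> compl_comps T K" if "compactin T K" for K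
    using \<epsilon> that by (auto simp: top_ends_def)
  have mono: "\<epsilon> K' \<subseteq> \<epsilon> K" if "compactin T K" "compactin T K'" "K \<subseteq> K'" for K K'
    using \<epsilon> that by (auto simp: top_ends_def)
  have "\<exists>C. C \<in> comps G X \<and> \<epsilon> (induced_pts G X) = ostar G C" if "X \<in> \<X>" for X
    using comp[OF compactin_induced[OF that]] unfolding compl_comps_induced by blast
  then obtain c where c: "\<And>X. X \<in> \<X> \<Longrightarrow> c X \<in> comps G X \<and> \<epsilon> (induced_pts G X) = ostar G (c X)" by metis
  define F where "F = (\<lambda>X\<in>\<X>. princ_filter G X (c X))"
  have cm: "c X' \<subseteq> c X" if "X \<in> \<X>" "X' \<in> \<X>" "X \<subseteq> X'" for X X'
    using mono[OF compactin_induced[OF that(1)] compactin_induced[OF that(2)] induced_mono[OF that(3)]]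
      c[OF that(1)] c[OF that(2)] ostar_subset_iff by simp
  have "bond G X' X (F X') = F X" if X: "X \<in> \<X>" "X' \<in> \<X>" "X \<subseteq> X'" for X X'
  proof -
    have c': "c X' \<in> comps G X'" using c X by blast
    have "comp_proj G X' X (c X') = c X"
      using comps_coarser_unique[OF X(3) c'] comp_proj[OF X(3) c'] c[OF X(1)] cm[OF X] by blast
    then show ?thesis using bond_princ[OF c', of X] X by (simp add: F_def)
  qed
  moreover have "F \<in> Pi\<^sub>E \<X> (filters_at G)"
    using c by (intro PiE_I) (simp_all add: F_def filters_at_def)
  ultimately have F: "F \<in> filter_lim G" by (simp add: filter_lim_def)
  have dirF: "dir F X = c X" if "X \<in> \<X>" for X using c[OF that] that by (intro dir_eqI) (simp_all add: F_def)
  have "top_end F = \<epsilon>"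
  proof (rule PiE_ext)
    show "top_end F \<in> Pi\<^sub>E {K. compactin T K} (compl_comps T)"
      using top_end_in_top_ends[OF F] by (simp add: top_ends_def)
    show "\<epsilon> \<in> Pi\<^sub>E {K. compactin T K} (compl_comps T)" using \<epsilon> by (simp add: top_ends_def)
    fix K assume "K \<in> {K. compactin T K}"
    then have K: "compactin T K" by simp
    obtain X where X: "X \<in> \<X>" "K \<subseteq> induced_pts G X" using compactin_subset_induced[OF K] by blast
    have "ostar G (dir F X) \<subseteq> \<epsilon> K"
      using mono[OF K compactin_induced[OF X(1)] X(2)] c[OF X(1)] dirF[OF X(1)] by simp
    then show "top_end F K = \<epsilon> K" by (rule top_end(3)[OF F K comp[OF K] X])
  qed
  then show ?thesis using F by blast
qed

lemma top_ends_eq: "top_ends T = top_end ` filter_lim G"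
  using top_end_surj top_end_in_top_ends by blast

section \<open>The homeomorphism with the Freudenthal compactification\<close>

definition freudenthal_basis :: "('a pt + ('a pt set \<Rightarrow> 'a pt set)) set set" where
  "freudenthal_basis = {Inl ` U | U. openin T U} \<union>
     {Inl ` C \<union> Inr ` {\<epsilon> \<in> top_ends T. \<epsilon> K = C} | K C. compactin T K \<and> C \<in> compl_comps T K}"

lemma freudenthal_eq: "freudenthal T = topology_generated_by freudenthal_basis"
  by (simp add: freudenthal_def freudenthal_basis_def)

lemma topspace_freudenthal: "topspace (freudenthal T) = Inl ` points G \<union> Inr ` top_ends T"
proof
  have "W \<subseteq> Inl ` points G \<union> Inr ` top_ends T" if "W \<in> freudenthal_basis" for W
    using that openin_subset[of T] openin_compl_comps unfolding freudenthal_basis_def topspace_complex by blast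
  then show "topspace (freudenthal T) \<subseteq> Inl ` points G \<union> Inr ` top_ends T"
    unfolding freudenthal_eq topology_generated_by_topspace by blast
  have "Inl ` points G \<in> freudenthal_basis"
    unfolding freudenthal_basis_def using openin_topspace[of T] topspace_complex by (intro UnI1) auto
  moreover have "\<exists>W\<in>freudenthal_basis. Inr \<epsilon> \<in> W" if e: "\<epsilon> \<in> top_ends T" for \<epsilon>
  proof (rule bexI)
    show "Inr \<epsilon> \<in> Inl ` \<epsilon> {} \<union> Inr ` {\<epsilon>' \<in> top_ends T. \<epsilon>' {} = \<epsilon> {}}" using e by blast
    have "\<epsilon> {} \<in> compl_comps T {}" using e by (auto simp: top_ends_def)
    then show "Inl ` \<epsilon> {} \<union> Inr ` {\<epsilon>' \<in> top_ends T. \<epsilon>' {} = \<epsilon> {}} \<in> freudenthal_basis"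
      unfolding freudenthal_basis_def using compactin_empty by blast
  qed
  ultimately show "Inl ` points G \<union> Inr ` top_ends T \<subseteq> topspace (freudenthal T)"
    unfolding freudenthal_eq topology_generated_by_topspace by blast
qed

lemma openin_freudenthal_Inl: "openin T U \<Longrightarrow> openin (freudenthal T) (Inl ` U)"
  unfolding freudenthal_eq freudenthal_basis_def by (intro topology_generated_by_Basis) blast

lemma openin_freudenthal_set:
  "compactin T K \<Longrightarrow> C \<in> compl_comps T K \<Longrightarrow>
    openin (freudenthal T) (Inl ` C \<union> Inr ` {\<epsilon> \<in> top_ends T. \<epsilon> K = C})"
  unfolding freudenthal_eq freudenthal_basis_def by (intro topology_generated_by_Basis) blast

lemma homeomorphic_FG_freudenthal: "homeomorphic_map (FG G) (freudenthal T) (map_sum id top_end)"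
proof -
  let ?h = "map_sum id top_end" and ?g = "map_sum id (inv_into (filter_lim G) top_end)"
  have inv: "inv_into (filter_lim G) top_end (top_end F) = F" if "F \<in> filter_lim G" for F
    using that inj_on_top_end by (rule inv_into_f_f[rotated])
  have img: "?h ` topspace (FG G) = topspace (freudenthal T)"
    unfolding topspace_FG topspace_freudenthal top_ends_eq by (simp add: image_Un image_image)
  have gh: "?g (?h x) = x" if "x \<in> topspace (FG G)" for x
    using that inv unfolding topspace_FG by auto
  have hg: "?h (?g y) = y" if "y \<in> topspace (freudenthal T)" for y
    using that gh unfolding img[symmetric] by auto
  have "continuous_map (FG G) (topology_generated_by freudenthal_basis) ?h"
  proof (rule continuous_on_generated_topo)
    show "?h ` topspace (FG G) \<subseteq> \<Union>freudenthal_basis"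
      unfolding img unfolding freudenthal_eq by simp
    fix W assume "W \<in> freudenthal_basis"
    then consider A where "W = Inl ` A" "openin T A"
      | K C where "compactin T K" "C \<in> compl_comps T K" "W = Inl ` C \<union> Inr ` {\<epsilon> \<in> top_ends T. \<epsilon> K = C}"
      unfolding freudenthal_basis_def by blast
    then show "openin (FG G) (?h -` W \<inter> topspace (FG G))"
    proof cases
      case 1
      then have "?h -` W \<inter> topspace (FG G) = Inl ` A"
        using openin_subset[OF 1(2)] unfolding topspace_FG topspace_complex by auto
      then show ?thesis using openin_FG_Inl 1 by simp
    next
      case (2 K C)
      note opC = openin_compl_comps[OF 2(1,2)]
      \<comment> \<open>For general compact \<open>K\<close> the preimage need not be a basic set.
        It is the union of \<open>C\<close> with the basic sets of all components, taken at finite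
        sets large enough for \<open>K\<close>, whose star lies in \<open>C\<close>.\<close>
      let ?P = "{(X, D). X \<in> \<X> \<and> D \<in> comps G X \<and> K \<subseteq> induced_pts G X \<and> ostar G D \<subseteq> C}"
      have "?h -` W \<inter> topspace (FG G) = Inl ` C \<union> Inr ` {F \<in> filter_lim G. top_end F K = C}"
        using openin_subset[OF opC] top_end_in_top_ends
        unfolding topspace_FG 2(3) topspace_complex by auto
      also have "\<dots> = Inl ` C \<union> (\<Union>(X, D)\<in>?P. fg_set G X {D})"
      proof
        have "Inr F \<in> (\<Union>(X, D)\<in>?P. fg_set G X {D})" if F: "F \<in> filter_lim G" "top_end F K = C" for F
        proof -
          obtain X where X: "X \<in> \<X>" "K \<subseteq> induced_pts G X" using compactin_subset_induced[OF 2(1)] by blast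
          have "(X, dir F X) \<in> ?P" using X dir(1)[OF F(1) X(1)] top_end(2)[OF F(1) 2(1) X] F(2) by simp
          moreover have "Inr F \<in> fg_set G X {dir F X}"
            using sing_mem_iff_dir[OF F(1) X(1) dir(1)[OF F(1) X(1)]] F(1) by (simp add: Inr_in_fg_set)
          ultimately show ?thesis by blast
        qed
        then show "Inl ` C \<union> Inr ` {F \<in> filter_lim G. top_end F K = C} \<subseteq> Inl ` C \<union> (\<Union>(X, D)\<in>?P. fg_set G X {D})"
          by blast
        have "fg_set G X {D} \<subseteq> Inl ` C \<union> Inr ` {F \<in> filter_lim G. top_end F K = C}" if "(X, D) \<in> ?P" for X D
        proof -
          have P: "X \<in> \<X>" "D \<in> comps G X" "K \<subseteq> induced_pts G X" "ostar G D \<subseteq> C" using that by auto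
          have "top_end F K = C" if "F \<in> filter_lim G" "{D} \<in> F X" for F
            using top_end(3)[OF that(1) 2(1,2) P(1,3)] sing_mem_iff_dir[OF that(1) P(1,2)] that(2) P(4) by simp
          then show ?thesis using P(4) by (auto simp: fg_set_def)
        qed
        then show "Inl ` C \<union> (\<Union>(X, D)\<in>?P. fg_set G X {D}) \<subseteq> Inl ` C \<union> Inr ` {F \<in> filter_lim G. top_end F K = C}"
          by blast
      qed
      finally show ?thesis
        using openin_FG_Inl[OF opC] openin_FG_set[OF _ basic_at_sing] by (auto intro!: openin_Un openin_Union)
    qed
  qed
  then have cont: "continuous_map (FG G) (freudenthal T) ?h" by (simp only: freudenthal_eq)
  have "continuous_map (freudenthal T) (topology_generated_by (fg_basis G)) ?g"
  proof (rule continuous_on_generated_topo)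
    show "?g ` topspace (freudenthal T) \<subseteq> \<Union>(fg_basis G)"
      using gh unfolding img[symmetric] topology_generated_by_topspace[symmetric] FG_eq[symmetric] by auto
    fix W assume "W \<in> fg_basis G"
    then consider A where "W = Inl ` A" "openin T A" | X \<C> where "X \<in> \<X>" "basic_at G X \<C>" "W = fg_set G X \<C>"
      unfolding fg_basis_def by blast
    then show "openin (freudenthal T) (?g -` W \<inter> topspace (freudenthal T))"
    proof cases
      case 1
      then have "?g -` W \<inter> topspace (freudenthal T) = Inl ` A"
        using openin_subset[OF 1(2)] unfolding topspace_freudenthal topspace_complex by auto
      then show ?thesis using openin_freudenthal_Inl 1 by simp
    next
      case (2 X \<C>)
      \<comment> \<open>Without critical sets every basic family is a singleton, and the compact set
        \<open>induced_pts G X\<close> with the component \<open>ostar G C\<close> of its complement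
        gives the matching basic set.\<close>
      obtain C where C: "C \<in> comps G X" "\<C> = {C}" using 2(2) basic_at_iff[OF 2(1)] by blast
      have eq: "top_end F (induced_pts G X) = ostar G C \<longleftrightarrow> {C} \<in> F X" if F: "F \<in> filter_lim G" for F
        unfolding top_end_induced[OF F 2(1)] sing_mem_iff_dir[OF F 2(1) C(1)]
        using ostar_subset_iff by (metis order_refl subset_antisym)
      have "?g -` W \<inter> topspace (freudenthal T) =
          Inl ` ostar G C \<union> Inr ` {\<epsilon> \<in> top_ends T. \<epsilon> (induced_pts G X) = ostar G C}"
        using ostar_subset_points[OF comps_subset(1)[OF C(1)]] inv eq
        unfolding topspace_freudenthal top_ends_eq 2(3) C(2) by (auto simp: Inl_in_fg_set Inr_in_fg_set)
      then show ?thesis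
        using openin_freudenthal_set[OF compactin_induced[OF 2(1)], of "ostar G C"] C(1) compl_comps_induced by simp
    qed
  qed
  then have contg: "continuous_map (freudenthal T) (FG G) ?g" by (simp only: FG_eq)
  have "homeomorphic_maps (FG G) (freudenthal T) ?h ?g"
    unfolding homeomorphic_maps_def using cont contg gh hg by blast
  then show ?thesis unfolding homeomorphic_map_maps by blast
qed

end

theorem theorem5p4p2:
  fixes G :: "'v graph"
  assumes "is_graph G"
  shows "(Omega_compactification G (FG G) (map_sum id (end_pt G)) \<and>
          totally_disconnected_space
            (subtopology (FG G) (topspace (FG G) - Inl ` topspace (complex_top G)))) \<and>
         (locally_finite_graph G \<and> connected_graph G \<longrightarrow>
            filter_lim G = end_pt G ` ends G \<and>
            (\<exists>h. homeomorphic_map (FG G) (freudenthal (complex_top G)) h \<and>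
                 (\<forall>p\<in>topspace (complex_top G). h (Inl p) = Inl p)))"
proof (intro conjI impI)
  interpret sgraph G by standard (rule assms)
  show "Omega_compactification G (FG G) (map_sum id (end_pt G))" by (rule Omega_compactification_FG)
  show "totally_disconnected_space (subtopology (FG G) (topspace (FG G) - Inl ` topspace (complex_top G)))"
    by (rule totally_disconnected_FG)
  assume lf: "locally_finite_graph G \<and> connected_graph G"
  interpret lf_graph G by standard (use lf in auto)
  show "filter_lim G = end_pt G ` ends G" by (rule filter_lim_eq_ends)
  show "\<exists>h. homeomorphic_map (FG G) (freudenthal (complex_top G)) h \<and>
      (\<forall>p\<in>topspace (complex_top G). h (Inl p) = Inl p)"
    using homeomorphic_FG_freudenthal by (intro exI[of _ "map_sum id top_end"]) simp
qed

end
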